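(* Let $d\ge 2$, let $X=\Gamma\backslash G/K$ be a $d$-dimensional connected complete hyperbolic manifold of finite volume, and let $Y=\Gamma'\backslash G'/K'\subset X$ be a compact totally geodesic special cycle of codimension $1$ (all as described in the context), with fixed hyperbolic measure $dy$. Let $\psi$ be a normalized Maass form on $Y$. Then there exists a constant $C_\psi>0$ depending on $\psi$ (and on $X,Y$, but not on $\phi$) such that $$|P_Y(\phi,\psi)|\le C_\psi\qquad\text{as }\lambda\to\infty ,$$ that is, there is $\Lambda>0$ such that $|P_Y(\phi,\psi)|\le C_\psi$ for every normalized Maass form $\phi$ on $X$ whose Laplace eigenvalue $\lambda$ satisfies $\lambda\ge \Lambda$. Here $P_Y(\phi,\psi)=\int_Y\phi(y)\psi(y)\,dy$.
   Context: Setting. $G=O(1,d)$, $K=\{\mathrm{diag}(\pm1,k): k\in O(d)\}$ is a maximal compact subgroup, so $G/K$ is hyperbolic $d$-space, and $\Gamma\subset G$ is a torsion-free lattice. $X=\Gamma\backslash G/K$; it is not assumed compact or orientable. Special cycle. $G'=\{\mathrm{diag}(g_1,g_2)\in G: g_1\in O(1,d-1),\ g_2=\pm1\}$, $K'=K\cap G'$, $\Gamma'=\Gamma\cap G'$. It is assumed that $\Gamma'$ is a uniform (cocompact) lattice in $G'$ and that the natural map $\Gamma'\backslash G'/K'\to\Gamma\backslash G/K$ is an embedding whose image is a totally geodesic submanifold of $X$; $Y$ is this image, identified with $\Gamma'\backslash G'/K'$. It is a compact hyperbolic manifold of dimension $d-1$ with $\pi_1(Y)\cong\Gamma'$ (for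 $d=2$ it is a closed geodesic). Maass forms. A Maass form on $X$ (resp. $Y$) is a square-integrable eigenfunction of the (nonnegative) hyperbolic Laplacian on $X$ (resp. $Y$); it is normalized if its $L^2$-norm is $1$. The eigenvalue of $\phi$ is denoted $\lambda\ge 0$. Maass forms are smooth, so the integral $P_Y(\phi,\psi)$ over the compact $Y$ converges. *)

theory Defs
  imports "HOL-Analysis.Analysis" "HOL-Algebra.Coset"
begin

text \<open>
  Minkowski space of signature \<open>(1,n)\<close> is \<open>real^'k option\<close> with \<open>n = CARD('k)\<close>; the index
  \<^term>\<open>None\<close> is the time coordinate.  For the codimension one situation \<open>'k\<close> is \<open>'m option\<close>,
  so that \<open>d = CARD('m) + 1 \<ge> 2\<close> is arbitrary; the index \<open>Some None\<close> is then the coordinate on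
  which the second diagonal block of an element of \<open>G'\<close> acts.
\<close>

subsection \<open>The group \<open>O(1,n)\<close> and hyperbolic space\<close>

definition lor :: "real^('k::finite) option \<Rightarrow> real^'k option \<Rightarrow> real" where
  "lor x y = (\<Sum>j\<in>UNIV. x $ Some j * y $ Some j) - x $ None * y $ None"

definition lorentz_group :: "(real^('k::finite) option^'k option) monoid" where
  "lorentz_group =
     \<lparr>carrier = {A. \<forall>x y. lor (A *v x) (A *v y) = lor x y}, mult = (**), one = mat 1\<rparr>"

text \<open>The maximal compact subgroup \<open>K\<close> of all \<open>diag(\<plusminus>1, k)\<close> with \<open>k\<close> orthogonal.\<close>

definition maximal_compact :: "(real^('k::finite) option^'k option) set" where
  "maximal_compact = {(\<chi> i j. case i of None \<Rightarrow> (case j of None \<Rightarrow> s | Some b \<Rightarrow> 0)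
      | Some a \<Rightarrow> (case j of None \<Rightarrow> 0 | Some b \<Rightarrow> k $ a $ b)) | s k.
      s \<in> {1, -1} \<and> orthogonal_matrix k}"

definition hyp :: "(real^('k::finite) option) set" where
  "hyp = {x. lor x x = -1 \<and> 0 < x $ None}"

text \<open>
  \<open>G/K\<close> is the set of timelike lines, each of which meets the upper sheet \<^term>\<open>hyp\<close> in one
  point; elements of \<open>G\<close> exchanging the two sheets therefore act with a sign.
  The lemmas \<open>act_transitive\<close> and \<open>stabilizer_base_point\<close> below identify \<open>G/K\<close> with \<^term>\<open>hyp\<close>.
\<close>

definition act :: "real^('k::finite) option^'k option \<Rightarrow> real^'k option \<Rightarrow> real^'k option" where
  "act A x = (if 0 < (A *v x) $ None then A *v x else - (A *v x))"

definition hpt :: "real^('k::finite) \<Rightarrow> real^'k option" where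
  "hpt v = (\<chi> i. case i of None \<Rightarrow> sqrt (1 + v \<bullet> v) | Some j \<Rightarrow> v $ j)"

text \<open>
  \<^term>\<open>hpt\<close> is a global chart of \<^term>\<open>hyp\<close>.  The Riemannian metric, its volume measure and
  its (nonnegative) Laplace-Beltrami operator are written in this chart; \<open>hmetric_eq\<close>,
  \<open>det_hmetric\<close> and \<open>matrix_inv_hmetric\<close> give closed forms.
\<close>

definition hmetric :: "real^('k::finite) \<Rightarrow> real^'k^'k" where
  "hmetric v = (\<chi> i j. lor (frechet_derivative hpt (at v) (axis i 1))
                           (frechet_derivative hpt (at v) (axis j 1)))"

definition hdensity :: "real^('k::finite) \<Rightarrow> real" where
  "hdensity v = sqrt (det (hmetric v))"

definition hyp_measure :: "(real^('k::finite) option) measure" where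
  "hyp_measure = distr (density lborel (\<lambda>v. ennreal (hdensity v))) borel hpt"

definition pd :: "'k \<Rightarrow> (real^('k::finite) \<Rightarrow> complex) \<Rightarrow> real^'k \<Rightarrow> complex" where
  "pd i f v = frechet_derivative f (at v) (axis i 1)"

primrec Ck :: "nat \<Rightarrow> (real^('k::finite) \<Rightarrow> complex) \<Rightarrow> bool" where
  "Ck 0 f \<longleftrightarrow> continuous_on UNIV f"
| "Ck (Suc n) f \<longleftrightarrow> f differentiable_on UNIV \<and> (\<forall>i. Ck n (pd i f))"

definition smooth :: "(real^('k::finite) \<Rightarrow> complex) \<Rightarrow> bool" where
  "smooth f \<longleftrightarrow> (\<forall>n. Ck n f)"

definition laplacian :: "(real^('k::finite) \<Rightarrow> complex) \<Rightarrow> real^'k \<Rightarrow> complex" where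
  "laplacian f v = - ((1 / hdensity v) *\<^sub>R
     (\<Sum>i\<in>UNIV. pd i (\<lambda>w. hdensity w *\<^sub>R
        (\<Sum>j\<in>UNIV. (matrix_inv (hmetric w) $ i $ j) *\<^sub>R pd j f w)) v))"

subsection \<open>Quotient topologies and lattices\<close>

text \<open>The quotient topology on a partition \<open>Q\<close> of the space \<open>T\<close> (see \<open>openin_quot_topology\<close>).\<close>

definition quot_topology :: "'a topology \<Rightarrow> 'a set set \<Rightarrow> 'a set topology" where
  "quot_topology T Q = topology (\<lambda>U. U \<subseteq> Q \<and> openin T (\<Union>U))"

definition borel_of :: "'a topology \<Rightarrow> 'a measure" where
  "borel_of T = sigma (topspace T) {U. openin T U}"

definition coset_topology :: "('a::topological_space) monoid \<Rightarrow> 'a set \<Rightarrow> 'a set topology" where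
  "coset_topology G \<Gamma> = quot_topology (top_of_set (carrier G)) (rcosets\<^bsub>G\<^esub> \<Gamma>)"

text \<open>
  \<^term>\<open>G\<close> acts on \<open>\<Gamma>\G\<close> from the right; a lattice is a discrete subgroup for which
  \<open>\<Gamma>\G\<close> carries a nonzero finite invariant Borel measure.
\<close>

definition lattice_in :: "('a::topological_space) monoid \<Rightarrow> 'a set \<Rightarrow> bool" where
  "lattice_in G \<Gamma> \<longleftrightarrow> subgroup \<Gamma> G \<and> discrete \<Gamma> \<and>
     (\<exists>M. sets M = sets (borel_of (coset_topology G \<Gamma>)) \<and>
          finite_measure M \<and> emeasure M (space M) \<noteq> 0 \<and>
          (\<forall>g\<in>carrier G. \<forall>E\<in>sets M. emeasure M ((\<lambda>C. C #>\<^bsub>G\<^esub> g) ` E) = emeasure M E))"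

definition uniform_lattice_in :: "('a::topological_space) monoid \<Rightarrow> 'a set \<Rightarrow> bool" where
  "uniform_lattice_in G \<Gamma> \<longleftrightarrow> lattice_in G \<Gamma> \<and> compact_space (coset_topology G \<Gamma>)"

definition torsion_free_in :: "'a monoid \<Rightarrow> 'a set \<Rightarrow> bool" where
  "torsion_free_in G \<Gamma> \<longleftrightarrow> (\<forall>\<gamma>\<in>\<Gamma>. \<forall>n::nat. 0 < n \<longrightarrow> \<gamma> [^]\<^bsub>G\<^esub> n = \<one>\<^bsub>G\<^esub> \<longrightarrow> \<gamma> = \<one>\<^bsub>G\<^esub>)"

subsection \<open>The space \<open>\<Gamma>\G/K\<close> and Maass forms\<close>

definition orbit :: "(real^('k::finite) option^'k option) set \<Rightarrow> real^'k option \<Rightarrow> (real^'k option) set"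
  where "orbit \<Gamma> x = (\<lambda>\<gamma>. act \<gamma> x) ` \<Gamma>"

definition orbit_space :: "(real^('k::finite) option^'k option) set \<Rightarrow> (real^'k option) set set"
  where "orbit_space \<Gamma> = orbit \<Gamma> ` hyp"

definition orbit_topology :: "(real^('k::finite) option^'k option) set \<Rightarrow> (real^'k option) set topology"
  where "orbit_topology \<Gamma> = quot_topology (top_of_set hyp) (orbit_space \<Gamma>)"

definition fundamental_domain ::
  "(real^('k::finite) option^'k option) set \<Rightarrow> (real^'k option) set \<Rightarrow> bool" where
  "fundamental_domain \<Gamma> F \<longleftrightarrow>
     F \<in> sets borel \<and> F \<subseteq> hyp \<and> (\<forall>x\<in>hyp. \<exists>!y. y \<in> F \<and> y \<in> orbit \<Gamma> x)"

text \<open>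
  For a discrete torsion-free \<open>\<Gamma>\<close> the action on \<^term>\<open>hyp\<close> is free and properly
  discontinuous, so a fundamental domain exists, and by invariance of \<^term>\<open>hyp_measure\<close> the
  following measure does not depend on the one chosen: it is the Riemannian measure of the
  quotient.
\<close>

definition orbit_measure ::
  "(real^('k::finite) option^'k option) set \<Rightarrow> (real^'k option) set measure" where
  "orbit_measure \<Gamma> = distr (restrict_space hyp_measure (SOME F. fundamental_domain \<Gamma> F))
     (borel_of (orbit_topology \<Gamma>)) (orbit \<Gamma>)"

text \<open>The pullback of a function on the quotient to \<^term>\<open>hyp\<close>, read in the chart \<^term>\<open>hpt\<close>.\<close>

definition lift :: "(real^('k::finite) option^'k option) set
    \<Rightarrow> ((real^'k option) set \<Rightarrow> complex) \<Rightarrow> real^'k \<Rightarrow> complex" where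
  "lift \<Gamma> \<phi> v = \<phi> (orbit \<Gamma> (hpt v))"

definition Maass_form :: "(real^('k::finite) option^'k option) set \<Rightarrow> real
    \<Rightarrow> ((real^'k option) set \<Rightarrow> complex) \<Rightarrow> bool" where
  "Maass_form \<Gamma> lam \<phi> \<longleftrightarrow>
     smooth (lift \<Gamma> \<phi>) \<and>
     (\<exists>v. lift \<Gamma> \<phi> v \<noteq> 0) \<and>
     (\<forall>v. laplacian (lift \<Gamma> \<phi>) v = lam *\<^sub>R lift \<Gamma> \<phi> v) \<and>
     integrable (orbit_measure \<Gamma>) (\<lambda>c. (cmod (\<phi> c))\<^sup>2)"

definition normalized_Maass_form :: "(real^('k::finite) option^'k option) set \<Rightarrow> real
    \<Rightarrow> ((real^'k option) set \<Rightarrow> complex) \<Rightarrow> bool" where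
  "normalized_Maass_form \<Gamma> lam \<phi> \<longleftrightarrow>
     Maass_form \<Gamma> lam \<phi> \<and> sqrt (\<integral>c. (cmod (\<phi> c))\<^sup>2 \<partial>orbit_measure \<Gamma>) = 1"

subsection \<open>The special cycle of codimension one\<close>

definition block :: "real^('m::finite) option^'m option \<Rightarrow> real
    \<Rightarrow> real^'m option option^'m option option" where
  "block A s = (\<chi> i j. if i = Some None \<or> j = Some None then (if i = j then s else 0)
                       else A $ map_option the i $ map_option the j)"

definition cycle_group :: "(real^('m::finite) option option^'m option option) monoid" where
  "cycle_group = lorentz_group
     \<lparr>carrier := {block A s | A s. A \<in> carrier lorentz_group \<and> s \<in> {1, -1}}\<rparr>"

text \<open>
  \<open>G'/K'\<close> is hyperbolic space of dimension \<open>d - 1\<close>, on which \<open>G'\<close> acts through its first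
  block.  So \<open>Y = \<Gamma>'\G'/K'\<close> is the orbit space of the group of first blocks of elements of
  \<open>\<Gamma>' = \<Gamma> \<inter> G'\<close>; for torsion-free \<open>\<Gamma>\<close> passing to the first block is injective on \<open>\<Gamma>'\<close>.
\<close>

definition cycle_lattice :: "(real^('m::finite) option option^'m option option) set
    \<Rightarrow> (real^'m option^'m option) set" where
  "cycle_lattice \<Gamma> = {A \<in> carrier lorentz_group. \<exists>s\<in>{1, -1}. block A s \<in> \<Gamma>}"

definition incl :: "real^('m::finite) option \<Rightarrow> real^'m option option" where
  "incl x = (\<chi> i. if i = Some None then 0 else x $ map_option the i)"

text \<open>The natural map \<open>Y \<rightarrow> X\<close>; see \<open>cycle_map_orbit\<close>.\<close>

definition cycle_map :: "(real^('m::finite) option option^'m option option) set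
    \<Rightarrow> (real^'m option) set \<Rightarrow> (real^'m option option) set" where
  "cycle_map \<Gamma> C = (\<Union>x\<in>C. orbit \<Gamma> (incl x))"

definition period :: "(real^('m::finite) option option^'m option option) set
    \<Rightarrow> ((real^'m option option) set \<Rightarrow> complex) \<Rightarrow> ((real^'m option) set \<Rightarrow> complex) \<Rightarrow> complex"
  where
  "period \<Gamma> \<phi> \<psi> = (\<integral>y. \<phi> (cycle_map \<Gamma> y) * \<psi> y \<partial>orbit_measure (cycle_lattice \<Gamma>))"

subsection \<open>Consistency of the definitions\<close>

lemma UNIV_option_sum:
  "(\<Sum>i\<in>(UNIV :: 'k::finite option set). f i) = f None + (\<Sum>j\<in>UNIV. f (Some j))"
  by (simp add: UNIV_option_conv sum.reindex)

lemma lor_commute: "lor x y = lor y x"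
  by (simp add: lor_def mult.commute)

lemma lor_add_left: "lor (x + y) z = lor x z + lor y z"
  by (simp add: lor_def algebra_simps sum.distrib)

lemma lor_scale_left: "lor (c *\<^sub>R x) z = c * lor x z"
  by (simp add: lor_def algebra_simps sum_distrib_left)

lemma lor_add_right: "lor z (x + y) = lor z x + lor z y"
  by (metis lor_add_left lor_commute)

lemma lor_scale_right: "lor z (c *\<^sub>R x) = c * lor z x"
  by (metis lor_scale_left lor_commute)

lemma lor_minus [simp]: "lor (- x) y = - lor x y" "lor x (- y) = - lor x y"
  using lor_scale_left[of "-1"] lor_scale_right[of _ "-1"] by auto

lemma lor_axis: "lor x (axis i 1) = (case i of None \<Rightarrow> - x $ None | Some j \<Rightarrow> x $ Some j)"
  by (cases i) (auto simp: lor_def axis_def if_distrib cong: if_cong)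

lemma lor_nondegenerate: "(\<And>y. lor x y = 0) \<Longrightarrow> x = 0"
proof -
  assume *: "\<And>y. lor x y = 0"
  have "x $ i = 0" for i
    using *[of "axis i 1"] by (cases i) (auto simp: lor_axis)
  then show "x = 0" by (simp add: vec_eq_iff)
qed

lemma carrier_lorentz: "A \<in> carrier lorentz_group \<longleftrightarrow> (\<forall>x y. lor (A *v x) (A *v y) = lor x y)"
  by (simp add: lorentz_group_def)

lemma lorentz_invertible:
  assumes "A \<in> carrier lorentz_group"
  shows "\<exists>B\<in>carrier lorentz_group. B ** A = mat 1"
proof -
  have *: "lor (A *v x) (A *v y) = lor x y" for x y
    using assms by (simp add: carrier_lorentz)
  have "x = 0" if "A *v x = 0" for x
  proof (rule lor_nondegenerate)
    show "lor x y = 0" for y using *[of x y] that by (simp add: lor_def)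
  qed
  then obtain B where B: "B ** A = mat 1"
    using matrix_left_invertible_ker[of A] by blast
  then have B': "A ** B = mat 1" using matrix_left_right_inverse by blast
  have "lor (B *v x) (B *v y) = lor x y" for x y
    using *[of "B *v x" "B *v y"] by (simp add: matrix_vector_mul_assoc B')
  with B show ?thesis by (auto simp: carrier_lorentz)
qed

lemma group_lorentz: "group (lorentz_group :: (real^('k::finite) option^'k option) monoid)"
proof (rule groupI)
  show "\<one>\<^bsub>lorentz_group\<^esub> \<in> carrier lorentz_group"
    by (simp add: lorentz_group_def)
  show "\<exists>y\<in>carrier lorentz_group. y \<otimes>\<^bsub>lorentz_group\<^esub> x = \<one>\<^bsub>lorentz_group\<^esub>"
    if "x \<in> carrier lorentz_group" for x
    using lorentz_invertible[OF that] by (simp add: lorentz_group_def)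
qed (auto simp: lorentz_group_def matrix_mul_assoc simp flip: matrix_vector_mul_assoc)

lemma hpt_nth [simp]: "hpt v $ None = sqrt (1 + v \<bullet> v)" "hpt v $ Some j = v $ j"
  by (auto simp: hpt_def)

lemma hyp_eq_range_hpt: "(hyp :: (real^('k::finite) option) set) = range hpt"
proof (intro Set.set_eqI iffI)
  fix x :: "real^'k option" assume "x \<in> hyp"
  then have x: "lor x x = -1" "0 < x $ None" by (auto simp: hyp_def)
  define v where "v = (\<chi> j. x $ Some j)"
  have "(x $ None)\<^sup>2 = 1 + v \<bullet> v"
    using x(1) by (simp add: lor_def v_def inner_vec_def power2_eq_square)
  then have "x $ None = sqrt (1 + v \<bullet> v)"
    using x(2) by (metis less_eq_real_def real_sqrt_unique)
  then have "x = hpt v"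
    by (auto simp: vec_eq_iff hpt_def v_def split: option.split)
  then show "x \<in> range hpt" by blast
next
  fix x :: "real^'k option" assume "x \<in> range hpt"
  then obtain v where "x = hpt v" by blast
  moreover have "0 < 1 + v \<bullet> v" using inner_ge_zero[of v] by linarith
  ultimately show "x \<in> hyp" by (simp add: hyp_def lor_def inner_vec_def)
qed

lemma timelike_nonzero: "lor x x = -1 \<Longrightarrow> x $ None \<noteq> 0"
proof
  assume "lor x x = -1" "x $ None = 0"
  then have "(\<Sum>j\<in>UNIV. x $ Some j * x $ Some j) = -1" by (simp add: lor_def)
  moreover have "0 \<le> (\<Sum>j\<in>UNIV. x $ Some j * x $ Some j)" by (intro sum_nonneg) auto
  ultimately show False by linarith
qed

lemma act_in_hyp:
  assumes "A \<in> carrier lorentz_group" "x \<in> hyp"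
  shows "act A x \<in> hyp"
proof -
  have "lor (A *v x) (A *v x) = -1" using assms by (auto simp: carrier_lorentz hyp_def)
  with timelike_nonzero[OF this] show ?thesis by (auto simp: hyp_def act_def)
qed

lemma act_one: "x \<in> hyp \<Longrightarrow> act (mat 1) x = x"
  by (simp add: act_def hyp_def)

lemma matrix_vector_minus: "(A :: real^'n^'m) *v (- x) = - (A *v x)"
  using matrix_vector_mult_scaleR[of A "-1" x] by simp

lemma act_mult:
  assumes "A \<in> carrier lorentz_group" "B \<in> carrier lorentz_group" "x \<in> hyp"
  shows "act (A ** B) x = act A (act B x)"
proof -
  have "lor (B *v x) (B *v x) = -1" using assms by (auto simp: carrier_lorentz hyp_def)
  then have "lor (A *v (B *v x)) (A *v (B *v x)) = -1" using assms by (auto simp: carrier_lorentz)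
  from timelike_nonzero[OF this] show ?thesis
    by (auto simp: act_def matrix_vector_minus simp flip: matrix_vector_mul_assoc)
qed

lemma lor_hyp_neg:
  assumes "p \<in> hyp" "q \<in> hyp"
  shows "lor p q < 0"
proof -
  obtain v w where pq: "p = hpt v" "q = hpt w" using assms by (auto simp: hyp_eq_range_hpt)
  have "v \<bullet> w \<le> norm v * norm w" by (rule norm_cauchy_schwarz)
  also have "\<dots> \<le> norm v * sqrt (1 + w \<bullet> w)"
    by (intro mult_left_mono) (auto simp: norm_eq_sqrt_inner)
  also have "\<dots> < sqrt (1 + v \<bullet> v) * sqrt (1 + w \<bullet> w)"
  proof (intro mult_strict_right_mono)
    have "0 < 1 + w \<bullet> w" using inner_ge_zero[of w] by linarith
    then show "0 < sqrt (1 + w \<bullet> w)" by simp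
  qed (simp add: norm_eq_sqrt_inner)
  finally show ?thesis by (simp add: pq lor_def inner_vec_def)
qed

lemma act_transitive:
  assumes "p \<in> hyp" "q \<in> hyp"
  shows "\<exists>A\<in>carrier lorentz_group. act A p = q"
proof -
  define u where "u = p + q"
  have pq: "lor p p = -1" "lor q q = -1" "lor p q < 0" "lor q p = lor p q"
    using assms lor_hyp_neg[OF assms] by (auto simp: hyp_def lor_commute)
  have u: "lor u u = 2 * lor p q - 2" "lor p u = lor p q - 1"
    by (auto simp: u_def lor_add_left lor_add_right pq)
  define R where "R x = x + (- (2 * lor x u / lor u u)) *\<^sub>R u" for x
  have lin: "linear R"
    by (rule linearI)
       (auto simp: R_def lor_add_left lor_scale_left algebra_simps add_divide_distrib)
  have Rm: "matrix R *v x = R x" for x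
    using matrix_works[of R x] lin by (simp add: linear_matrix_vector_mul_eq)
  have "lor (R x) (R y) = lor x y" for x y
  proof -
    have "lor u u \<noteq> 0" using u pq by linarith
    moreover have "lor u x = lor x u" "lor u y = lor y u" by (auto simp: lor_commute)
    ultimately show ?thesis
      unfolding R_def lor_add_left lor_scale_left lor_add_right lor_scale_right
      by (simp add: field_simps)
  qed
  then have A: "matrix R \<in> carrier lorentz_group"
    by (simp add: carrier_lorentz Rm)
  have "2 * lor p u / lor u u = 1" using u pq by (simp add: field_simps)
  then have "R p = - q" by (simp add: R_def u_def)
  then have "act (matrix R) p = q"
    using assms(2) by (simp add: act_def Rm hyp_def)
  with A show ?thesis by blast
qed

lemma quot_istopology:
  assumes "disjoint Q"
  shows "istopology (\<lambda>U. U \<subseteq> Q \<and> openin T (\<Union>U))"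
  unfolding istopology_def
proof (intro conjI allI impI)
  fix U V assume "U \<subseteq> Q \<and> openin T (\<Union>U)" "V \<subseteq> Q \<and> openin T (\<Union>V)"
  then have UV: "U \<subseteq> Q" "V \<subseteq> Q" "openin T (\<Union>U)" "openin T (\<Union>V)" by auto
  have "\<Union>U \<inter> \<Union>V \<subseteq> \<Union>(U \<inter> V)"
  proof
    fix x assume "x \<in> \<Union>U \<inter> \<Union>V"
    then obtain a b where ab: "a \<in> U" "b \<in> V" "x \<in> a" "x \<in> b" by auto
    then have "a = b" using UV(1,2) assms unfolding disjoint_def by (metis IntI emptyE subsetD)
    with ab show "x \<in> \<Union>(U \<inter> V)" by auto
  qed
  then have "\<Union>(U \<inter> V) = \<Union>U \<inter> \<Union>V" by blast
  then show "openin T (\<Union>(U \<inter> V))" using UV by (simp add: openin_Int)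
  show "U \<inter> V \<subseteq> Q" using UV by blast
next
  fix \<U> assume *: "\<forall>U\<in>\<U>. U \<subseteq> Q \<and> openin T (\<Union>U)"
  then show "\<Union>\<U> \<subseteq> Q" by blast
  have "\<Union>(\<Union>\<U>) = \<Union>(Union ` \<U>)" by blast
  moreover have "openin T (\<Union>(Union ` \<U>))" using * by (intro openin_Union) auto
  ultimately show "openin T (\<Union>(\<Union>\<U>))" by simp
qed

lemma openin_quot_topology:
  assumes "disjoint Q"
  shows "openin (quot_topology T Q) U \<longleftrightarrow> U \<subseteq> Q \<and> openin T (\<Union>U)"
  unfolding quot_topology_def topology_inverse'[OF quot_istopology[OF assms, of T]] ..

lemma mem_orbit_iff:
  assumes "subgroup \<Gamma> lorentz_group" "x \<in> hyp" "y \<in> orbit \<Gamma> x"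
  shows "orbit \<Gamma> y = orbit \<Gamma> x"
proof -
  interpret subgroup \<Gamma> lorentz_group by fact
  interpret G: group lorentz_group by (rule group_lorentz)
  have mult: "A ** B \<in> \<Gamma>" if "A \<in> \<Gamma>" "B \<in> \<Gamma>" for A B
    using m_closed[OF that] by (simp add: lorentz_group_def)
  obtain g where g: "g \<in> \<Gamma>" "y = act g x" using assms by (auto simp: orbit_def)
  have "inv\<^bsub>lorentz_group\<^esub> g ** g = mat 1"
    using G.l_inv[OF mem_carrier[OF g(1)]] by (simp add: lorentz_group_def)
  moreover have gi: "inv\<^bsub>lorentz_group\<^esub> g \<in> \<Gamma>" using g by simp
  ultimately have x: "x = act (inv\<^bsub>lorentz_group\<^esub> g) y"
    using g assms(2) by (metis act_mult act_one mem_carrier)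
  have y: "y \<in> hyp" using g assms(2) act_in_hyp mem_carrier by blast
  have "act h y \<in> orbit \<Gamma> x" if "h \<in> \<Gamma>" for h
    using act_mult[OF mem_carrier[OF that] mem_carrier[OF g(1)] assms(2)] mult[OF that g(1)] g(2)
    by (auto simp: orbit_def image_iff intro!: bexI[of _ "h ** g"])
  moreover have "act h x \<in> orbit \<Gamma> y" if "h \<in> \<Gamma>" for h
    using act_mult[OF mem_carrier[OF that] mem_carrier[OF gi] y] mult[OF that gi] x
    by (auto simp: orbit_def image_iff intro!: bexI[of _ "h ** inv\<^bsub>lorentz_group\<^esub> g"])
  ultimately show ?thesis by (auto simp: orbit_def)
qed

lemma orbit_subset_hyp:
  "\<Gamma> \<subseteq> carrier lorentz_group \<Longrightarrow> x \<in> hyp \<Longrightarrow> orbit \<Gamma> x \<subseteq> hyp"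
  by (auto simp: orbit_def act_in_hyp)

lemma openin_orbit_topology:
  assumes "subgroup \<Gamma> lorentz_group"
  shows "openin (orbit_topology \<Gamma>) U \<longleftrightarrow> U \<subseteq> orbit_space \<Gamma> \<and> openin (top_of_set hyp) (\<Union>U)"
  unfolding orbit_topology_def
proof (rule openin_quot_topology)
  show "disjoint (orbit_space \<Gamma>)"
    unfolding disjoint_def orbit_space_def
    using mem_orbit_iff[OF assms] by (smt (verit) disjoint_iff imageE)
qed

lemma openin_coset_topology:
  assumes "group G" "subgroup \<Gamma> G"
  shows "openin (coset_topology G \<Gamma>) U \<longleftrightarrow>
    U \<subseteq> rcosets\<^bsub>G\<^esub> \<Gamma> \<and> openin (top_of_set (carrier G)) (\<Union>U)"
  unfolding coset_topology_def
  by (rule openin_quot_topology)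
     (use group.rcos_disjoint[OF assms] in \<open>simp add: disjoint_def pairwise_def disjnt_def\<close>)

lemma lor_axis_axis:
  "lor (axis i 1) (axis j 1) = (if i = j then if i = None then -1 else 1 else 0)"
  unfolding lor_axis by (cases j) (auto simp: axis_def)

lemma lorentz_entries:
  assumes "A \<in> carrier lorentz_group"
  shows "lor (A *v axis i 1) (A *v axis j 1) = (if i = j then if i = None then -1 else 1 else 0)"
  using assms by (simp add: carrier_lorentz lor_axis_axis)

lemma lorentzI:
  assumes *: "\<And>i j. lor (A *v axis i 1) (A *v axis j 1) = (if i = j then if i = None then -1 else 1 else 0)"
  shows "A \<in> carrier (lorentz_group :: (real^('k::finite) option^'k option) monoid)"
proof -
  have bil: "bilinear (\<lambda>x y. lor (A *v x) (A *v y))" "bilinear (lor :: real^'k option \<Rightarrow> _)"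
    unfolding bilinear_def
    by (auto intro!: linearI simp: lor_add_left lor_scale_left lor_add_right lor_scale_right
      matrix_vector_right_distrib matrix_vector_mult_scaleR)
  have "(\<lambda>x y. lor (A *v x) (A *v y)) = lor"
  proof (rule bilinear_eq_stdbasis[OF bil])
    fix i j :: "real^'k option" assume "i \<in> Basis" "j \<in> Basis"
    then obtain a b where "i = axis a 1" "j = axis b 1" by (auto simp: Basis_vec_def)
    then show "lor (A *v i) (A *v j) = lor i j"
      by (simp add: * lor_axis_axis)
  qed
  then show ?thesis by (simp add: carrier_lorentz fun_eq_iff)
qed

lemma matrix_vector_axis: "(A *v axis i 1) $ j = (A :: real^'n^'m) $ j $ i"
  by (simp add: matrix_vector_mult_basis column_def)

lemma hpt_0: "hpt 0 = axis None 1"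
  by (auto simp: vec_eq_iff hpt_def axis_def split: option.split)

lemma stabilizer_base_point:
  "{A \<in> carrier lorentz_group. act A (hpt 0) = hpt 0} =
     (maximal_compact :: (real^('k::finite) option^'k option) set)"
proof (intro Set.set_eqI iffI)
  fix A :: "real^'k option^'k option"
  assume "A \<in> {A \<in> carrier lorentz_group. act A (hpt 0) = hpt 0}"
  then have A: "A \<in> carrier lorentz_group" and "act A (axis None 1) = axis None 1"
    by (auto simp: hpt_0)
  then obtain s where s: "s \<in> {1, -1}" "A *v axis None 1 = s *\<^sub>R axis None 1"
    by (auto simp: act_def split: if_splits; metis minus_equation_iff scaleR_minus1_left scaleR_one)
  have c: "A $ i $ None = (if i = None then s else 0)" for i
    using arg_cong[OF s(2), of "\<lambda>x. x $ i"] unfolding matrix_vector_axis by (auto simp: axis_def)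
  have r: "A $ None $ Some j = 0" for j
    using lorentz_entries[OF A, of None "Some j"] s(1)
    by (auto simp: lor_def matrix_vector_axis c)
  define k where "k = (\<chi> a b. A $ Some a $ Some b)"
  have "transpose k ** k = mat 1"
    unfolding vec_eq_iff
  proof (intro allI)
    fix a b
    show "(transpose k ** k) $ a $ b = mat 1 $ a $ b"
      using lorentz_entries[OF A, of "Some a" "Some b"]
      by (auto simp: lor_def matrix_vector_axis r k_def matrix_matrix_mult_def transpose_def mat_def)
  qed
  then have "orthogonal_matrix k" by (simp add: orthogonal_matrix)
  moreover have "A = (\<chi> i j. case i of None \<Rightarrow> (case j of None \<Rightarrow> s | Some b \<Rightarrow> 0)
      | Some a \<Rightarrow> (case j of None \<Rightarrow> 0 | Some b \<Rightarrow> k $ a $ b))"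
    by (auto simp: vec_eq_iff k_def c r split: option.split)
  ultimately show "A \<in> maximal_compact" using s(1) by (auto simp: maximal_compact_def)
next
  fix A :: "real^'k option^'k option"
  assume "A \<in> maximal_compact"
  then obtain s k where s: "s \<in> {1, -1}" and k: "orthogonal_matrix k" and
    A: "A = (\<chi> i j. case i of None \<Rightarrow> (case j of None \<Rightarrow> s | Some b \<Rightarrow> 0)
      | Some a \<Rightarrow> (case j of None \<Rightarrow> 0 | Some b \<Rightarrow> k $ a $ b))"
    by (auto simp: maximal_compact_def)
  have "transpose k ** k = mat 1" using k by (simp add: orthogonal_matrix)
  then have k': "(\<Sum>c\<in>UNIV. k $ c $ a * k $ c $ b) = (if a = b then 1 else 0)" for a b
    by (simp add: vec_eq_iff matrix_matrix_mult_def transpose_def mat_def)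
  have "A \<in> carrier lorentz_group"
  proof (rule lorentzI)
    fix i j
    show "lor (A *v axis i 1) (A *v axis j 1) = (if i = j then if i = None then -1 else 1 else 0)"
      using s by (cases i; cases j) (auto simp: lor_def matrix_vector_axis A k')
  qed
  moreover have "(A *v axis None 1) = s *\<^sub>R axis None 1"
    unfolding vec_eq_iff matrix_vector_axis by (auto simp: A axis_def split: option.split)
  ultimately show "A \<in> {A \<in> carrier lorentz_group. act A (hpt 0) = hpt 0}"
    using s by (auto simp: hpt_0 act_def axis_def)
qed

lemma hpt_has_derivative:
  "(hpt has_derivative
     (\<lambda>h. \<chi> i. case i of None \<Rightarrow> (v \<bullet> h) / sqrt (1 + v \<bullet> v) | Some j \<Rightarrow> h $ j)) (at v)"
proof -
  define L where "L = (\<lambda>w :: real^'a. \<chi> i. case i of None \<Rightarrow> 0 | Some j \<Rightarrow> w $ j)"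
  have "linear L"
    by (rule linearI) (auto simp: L_def vec_eq_iff split: option.split)
  then have L: "(L has_derivative L) (at v)"
    by (intro linear_imp_has_derivative)
  have hpt: "hpt = (\<lambda>w. sqrt (1 + w \<bullet> w) *\<^sub>R axis None 1 + L w)"
    by (auto simp: fun_eq_iff vec_eq_iff hpt_def L_def axis_def split: option.split)
  have "0 < 1 + v \<bullet> v" using inner_ge_zero[of v] by linarith
  then have "((\<lambda>w. sqrt (1 + w \<bullet> w) *\<^sub>R axis None 1 + L w) has_derivative
     (\<lambda>h. ((v \<bullet> h) / sqrt (1 + v \<bullet> v)) *\<^sub>R axis None 1 + L h)) (at v)"
    by (auto intro!: derivative_eq_intros L simp: fun_eq_iff inner_commute field_simps)
  moreover have "(\<lambda>h. ((v \<bullet> h) / sqrt (1 + v \<bullet> v)) *\<^sub>R axis None 1 + L h) =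
     (\<lambda>h. \<chi> i. case i of None \<Rightarrow> (v \<bullet> h) / sqrt (1 + v \<bullet> v) | Some j \<Rightarrow> h $ j)"
    by (auto simp: fun_eq_iff vec_eq_iff L_def axis_def split: option.split)
  ultimately show ?thesis unfolding hpt by simp
qed

lemma hmetric_eq:
  "hmetric v = (\<chi> i j. (if i = j then 1 else 0) - v $ i * v $ j / (1 + v \<bullet> v))"
proof -
  have "0 < 1 + v \<bullet> v" using inner_ge_zero[of v] by linarith
  moreover have "frechet_derivative hpt (at v) =
      (\<lambda>h. \<chi> i. case i of None \<Rightarrow> (v \<bullet> h) / sqrt (1 + v \<bullet> v) | Some j \<Rightarrow> h $ j)"
    by (rule frechet_derivative_at[OF hpt_has_derivative, symmetric])
  moreover have "(\<Sum>k\<in>UNIV. axis i (1::real) $ k * axis j 1 $ k) = (if i = j then 1 else 0)" for i j :: 'a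
    using inner_axis_axis[of i "1::real" j 1] by (simp add: inner_vec_def)
  ultimately show ?thesis
    unfolding hmetric_def lor_def vec_eq_iff by (simp add: inner_axis)
qed

lemma hmetric_mult: "hmetric v *v x = x - ((v \<bullet> x) / (1 + v \<bullet> v)) *\<^sub>R v"
proof -
  have "(\<Sum>j\<in>UNIV. ((if i = j then 1 else 0) - v $ i * v $ j / (1 + v \<bullet> v)) * x $ j) =
    x $ i - (\<Sum>j\<in>UNIV. v $ j * x $ j) / (1 + v \<bullet> v) * v $ i" for i
  proof -
    have "(\<Sum>j\<in>UNIV. ((if i = j then 1 else 0) - v $ i * v $ j / (1 + v \<bullet> v)) * x $ j) =
      (\<Sum>j\<in>UNIV. (if i = j then x $ j else 0) - (v $ j * x $ j) * (v $ i / (1 + v \<bullet> v)))"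
      by (intro sum.cong) (auto simp: algebra_simps)
    also have "\<dots> = x $ i - (\<Sum>j\<in>UNIV. v $ j * x $ j) * (v $ i / (1 + v \<bullet> v))"
      unfolding sum_subtractf sum_distrib_right by simp
    finally show ?thesis by simp
  qed
  then show ?thesis
    by (simp add: vec_eq_iff hmetric_eq matrix_vector_mult_def inner_vec_def[of v x])
qed

lemma det_hmetric: "det (hmetric v) = 1 / (1 + v \<bullet> v)"
proof -
  have pos: "0 < 1 + v \<bullet> v" using inner_ge_zero[of v] by linarith
  fix k :: 'a
  have "axis k (norm v) = norm v *\<^sub>R axis k (1 :: real)"
    by (simp add: vec_eq_iff axis_def)
  then have "norm (axis k (norm v)) = norm v" by simp
  then obtain f where f: "orthogonal_transformation f" "f v = axis k (norm v)"
    using orthogonal_transformation_exists[of v "axis k (norm v)"] by metis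
  define Q where "Q = matrix f"
  have Q: "orthogonal_matrix Q" "\<And>x. Q *v x = f x"
    using f(1) by (auto simp: Q_def orthogonal_transformation_matrix linear_matrix_vector_mul_eq matrix_works)
  define D :: "real^'a^'a" where
    "D = (\<chi> i j. if i = j then (if i = k then 1 / (1 + v \<bullet> v) else 1) else 0)"
  have "Q ** hmetric v ** transpose Q = D"
    unfolding matrix_eq
  proof
    fix x
    have "Q *v (transpose Q *v x) = x"
      unfolding matrix_vector_mul_assoc using Q(1) by (simp add: orthogonal_matrix_def)
    moreover have "v \<bullet> (transpose Q *v x) = f v \<bullet> x"
      using dot_lmul_matrix[of x Q v] by (simp add: Q(2) inner_commute)
    ultimately have "(Q ** hmetric v ** transpose Q) *v x =
        x - ((f v \<bullet> x) / (1 + v \<bullet> v)) *\<^sub>R f v"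
      by (simp add: hmetric_mult matrix_vector_mult_diff_distrib matrix_vector_mult_scaleR Q(2)
          flip: matrix_vector_mul_assoc)
    also have "\<dots> = D *v x"
      unfolding vec_eq_iff
    proof
      fix i
      have "(D *v x) $ i = (\<Sum>j\<in>UNIV. if i = j then (if i = k then 1 / (1 + v \<bullet> v) else 1) * x $ j else 0)"
        unfolding D_def matrix_vector_mult_def vec_lambda_beta by (intro sum.cong) auto
      also have "\<dots> = (if i = k then 1 / (1 + v \<bullet> v) else 1) * x $ i" by simp
      also have "\<dots> = x $ i - (norm v * x $ k / (1 + v \<bullet> v)) * axis k (norm v) $ i"
      proof -
        have "1 / (1 + v \<bullet> v) * x $ k = x $ k - (norm v * x $ k / (1 + v \<bullet> v)) * norm v"
        proof -
          define c where "c = 1 + v \<bullet> v"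
          have "norm v * norm v = c - 1"
            by (simp add: c_def power2_norm_eq_inner flip: power2_eq_square)
          then have "norm v * x $ k * norm v = (c - 1) * x $ k"
            by (metis mult.assoc mult.commute)
          moreover have "c \<noteq> 0" using pos by (simp add: c_def)
          ultimately show ?thesis unfolding c_def[symmetric] by (simp add: field_simps)
        qed
        then show ?thesis by (auto simp: axis_def)
      qed
      finally show "(x - (f v \<bullet> x / (1 + v \<bullet> v)) *\<^sub>R f v) $ i = (D *v x) $ i"
        by (simp add: f(2) inner_axis')
    qed
    finally show "(Q ** hmetric v ** transpose Q) *v x = D *v x" .
  qed
  moreover have "det Q * det (transpose Q) = 1"
    using Q(1) by (metis det_I det_mul orthogonal_matrix_def)
  ultimately have "det (hmetric v) = det D"
    by (metis (no_types, lifting) det_mul mult.assoc mult.commute mult_1)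
  also have "\<dots> = (\<Prod>i\<in>UNIV. D $ i $ i)" by (rule det_diagonal) (simp add: D_def)
  also have "\<dots> = 1 / (1 + v \<bullet> v)" by (simp add: D_def)
  finally show ?thesis .
qed

lemma matrix_inv_hmetric: "matrix_inv (hmetric v) = (\<chi> i j. (if i = j then 1 else 0) + v $ i * v $ j)"
proof -
  have pos: "0 < 1 + v \<bullet> v" using inner_ge_zero[of v] by linarith
  define B where "B = (\<chi> i j. (if i = j then 1 else 0) + v $ i * v $ j)"
  have B: "B *v x = x + (v \<bullet> x) *\<^sub>R v" for x
    unfolding vec_eq_iff
  proof
    fix i
    have "(B *v x) $ i = (\<Sum>j\<in>UNIV. (if i = j then x $ j else 0) + v $ i * (v $ j * x $ j))"
      unfolding B_def matrix_vector_mult_def vec_lambda_beta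
      by (intro sum.cong) (auto simp: algebra_simps)
    also have "\<dots> = x $ i + v $ i * (v \<bullet> x)"
      unfolding sum.distrib sum_distrib_left[symmetric] by (simp add: inner_vec_def)
    finally show "(B *v x) $ i = (x + (v \<bullet> x) *\<^sub>R v) $ i" by simp
  qed
  have "B ** hmetric v = mat 1"
    unfolding matrix_eq
  proof
    fix x
    define c where "c = (v \<bullet> x) / (1 + v \<bullet> v)"
    have "v \<bullet> x = c * (1 + v \<bullet> v)" using pos by (simp add: c_def)
    then have "v \<bullet> (x - c *\<^sub>R v) = c" by (simp add: inner_diff_right algebra_simps)
    then have "B *v (hmetric v *v x) = x" by (simp add: B hmetric_mult flip: c_def)
    then show "(B ** hmetric v) *v x = mat 1 *v x" by (simp add: matrix_vector_mul_assoc)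
  qed
  then have BA: "B ** hmetric v = mat 1" "hmetric v ** B = mat 1"
    using matrix_left_right_inverse by blast+
  have "matrix_inv (hmetric v) = B"
    unfolding matrix_inv_def
  proof (rule some_equality)
    fix C assume "hmetric v ** C = mat 1 \<and> C ** hmetric v = mat 1"
    then show "C = B" using BA by (metis matrix_mul_assoc matrix_mul_lid matrix_mul_rid)
  qed (use BA in simp)
  then show ?thesis by (simp add: B_def)
qed

lemma hdensity_eq: "hdensity v = 1 / sqrt (1 + v \<bullet> v)"
  by (simp add: hdensity_def det_hmetric real_sqrt_divide)

lemma map_option_the_some [simp]: "map_option the (map_option Some i) = i"
  by (cases i) auto

lemma option_option_sum:
  "(\<Sum>i\<in>(UNIV :: 'm::finite option option set). f i) =
     f (Some None) + (\<Sum>i\<in>UNIV. f (map_option Some i))"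
  by (simp add: UNIV_option_sum add_ac)

lemma option_option_cases:
  obtains "i = Some None" | j where "i = map_option Some j" "i \<noteq> Some None"
proof (cases i)
  case None
  then show ?thesis using that(2)[of None] by simp
next
  case (Some a)
  then show ?thesis using that(1) that(2)[of a] by (cases a) auto
qed

lemma incl_nth [simp]: "incl x $ Some None = 0" "incl x $ map_option Some i = x $ i"
  "incl x $ None = x $ None"
  by (cases i; simp add: incl_def)+

lemma lor_incl: "lor (incl x) (incl y) = lor x y"
proof -
  have "incl x $ Some (Some j) = x $ Some j" for x :: "real^'a option" and j
    using incl_nth(2)[of x "Some j"] by simp
  then show ?thesis by (simp add: lor_def UNIV_option_sum)
qed

lemma incl_in_hyp: "x \<in> hyp \<Longrightarrow> incl x \<in> hyp"
  by (simp add: hyp_def lor_incl)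

lemma block_nth:
  "block A s $ Some None $ j = (if j = Some None then s else 0)"
  "block A s $ i $ Some None = (if i = Some None then s else 0)"
  "block A s $ map_option Some a $ map_option Some b = A $ a $ b"
  by (simp_all add: block_def)

lemma block_incl: "block A s *v incl x = incl (A *v x)"
  unfolding vec_eq_iff
proof
  fix i show "(block A s *v incl x) $ i = incl (A *v x) $ i"
    by (cases i rule: option_option_cases)
       (auto simp: matrix_vector_mult_def option_option_sum block_nth)
qed

lemma act_block_incl: "act (block A s) (incl x) = incl (act A x)"
proof -
  have "incl (- y) = - incl y" for y :: "real^'a option"
    by (auto simp: incl_def vec_eq_iff)
  then show ?thesis by (simp add: act_def block_incl)
qed

lemma block_mult: "block A s ** block B t = block (A ** B) (s * t)"
  unfolding vec_eq_iff
proof (intro allI)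
  fix i j show "(block A s ** block B t) $ i $ j = block (A ** B) (s * t) $ i $ j"
    by (cases i rule: option_option_cases; cases j rule: option_option_cases)
       (auto simp: matrix_matrix_mult_def option_option_sum block_nth)
qed

lemma block_one: "block (mat 1) 1 = mat 1"
  unfolding vec_eq_iff
proof (intro allI)
  fix i j :: "'a option option" show "block (mat 1) 1 $ i $ j = mat 1 $ i $ j"
    by (cases i; cases j) (auto simp: block_def mat_def split: option.split)
qed

lemma cycle_map_orbit:
  assumes "subgroup \<Gamma> lorentz_group" "x \<in> hyp"
  shows "cycle_map \<Gamma> (orbit (cycle_lattice \<Gamma>) x) = orbit \<Gamma> (incl x)"
proof -
  have "mat 1 \<in> \<Gamma>" using subgroup.one_closed[OF assms(1)] by (simp add: lorentz_group_def)
  then have "mat 1 \<in> cycle_lattice \<Gamma>"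
    by (auto simp: cycle_lattice_def carrier_lorentz block_one)
  moreover have "orbit \<Gamma> (incl (act A x)) = orbit \<Gamma> (incl x)" if A: "A \<in> cycle_lattice \<Gamma>" for A
  proof -
    obtain s where "block A s \<in> \<Gamma>" using A unfolding cycle_lattice_def by blast
    then have "incl (act A x) \<in> orbit \<Gamma> (incl x)"
      by (metis act_block_incl imageI orbit_def)
    then show ?thesis by (intro mem_orbit_iff assms incl_in_hyp)
  qed
  ultimately show ?thesis by (auto simp: cycle_map_def orbit_def[of "cycle_lattice \<Gamma>"])
qed

lemma block_in_lorentz:
  assumes "A \<in> carrier lorentz_group" "s \<in> {1, -1}"
  shows "block A s \<in> carrier lorentz_group"
proof -
  define p where "p = (\<lambda>x :: real^'a option option. \<chi> i. x $ map_option Some i)"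
  have l: "lor x y = lor (p x) (p y) + x $ Some None * y $ Some None" for x y
    by (simp add: lor_def p_def UNIV_option_sum)
  have "p (block A s *v x) = A *v p x" "(block A s *v x) $ Some None = s * x $ Some None" for x
    by (auto simp: vec_eq_iff p_def matrix_vector_mult_def option_option_sum block_nth)
  then show ?thesis using assms by (auto simp: carrier_lorentz l)
qed

lemma subgroup_cycle:
  "subgroup (carrier cycle_group)
     (lorentz_group :: (real^('m::finite) option option^'m option option) monoid)"
proof (rule group.subgroupI[OF group_lorentz])
  let ?G = "lorentz_group :: (real^'m option option^'m option option) monoid"
  let ?L = "lorentz_group :: (real^'m option^'m option) monoid"
  have C: "carrier cycle_group = {block A s | A s. A \<in> carrier ?L \<and> s \<in> {1, -1}}"
    by (simp add: cycle_group_def)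
  show "carrier cycle_group \<subseteq> carrier ?G" unfolding C using block_in_lorentz by blast
  have "mat 1 \<in> carrier ?L" by (simp add: carrier_lorentz)
  then have "block (mat 1) 1 \<in> {block A s | A s. A \<in> carrier ?L \<and> s \<in> {1, -1}}" by blast
  then show "carrier cycle_group \<noteq> ({} :: (real^'m option option^'m option option) set)" unfolding C by blast
  fix a :: "real^'m option option^'m option option" assume "a \<in> carrier cycle_group"
  then obtain A s where a: "a = block A s" "A \<in> carrier ?L" "s \<in> {1, -1}" unfolding C by blast
  obtain B where B: "B \<in> carrier ?L" "B ** A = mat 1" using lorentz_invertible[OF a(2)] by blast
  have "block B s ** a = mat 1"
    using a B by (auto simp: block_mult block_one)
  then have "inv\<^bsub>?G\<^esub> a = block B s"
    using group.inv_equality[OF group_lorentz, of "block B s" a]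
      block_in_lorentz[OF a(2,3)] block_in_lorentz[OF B(1) a(3)] a(1)
    by (simp add: lorentz_group_def)
  then show "inv\<^bsub>?G\<^esub> a \<in> carrier cycle_group" unfolding C using a B by blast
  fix b :: "real^'m option option^'m option option" assume "b \<in> carrier cycle_group"
  then obtain A' t where b: "b = block A' t" "A' \<in> carrier ?L" "t \<in> {1, -1}" unfolding C by blast
  have "A ** A' \<in> carrier ?L" "s * t \<in> {1, -1}"
    using a b by (auto simp: carrier_lorentz simp flip: matrix_vector_mul_assoc)
  then show "a \<otimes>\<^bsub>?G\<^esub> b \<in> carrier cycle_group"
    unfolding C using a b by (auto simp: lorentz_group_def block_mult)
qed

lemma group_cycle: "group cycle_group"
  using group.subgroup_imp_group[OF group_lorentz subgroup_cycle] by (simp add: cycle_group_def)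

end

theory Submission
  imports Defs
begin

text \<open>
  Let \<open>t\<close> be the signed distance to the totally geodesic hypersurface covering \<open>Y\<close> and \<open>k\<^sup>2 = \<lambda>\<close>.
  With a \<open>C\<^sup>2\<close> weight of compact support whose translates under \<open>\<Gamma>'\<close> add up to \<open>1\<close>, the period
  becomes an integral of \<open>\<phi> b\<close> over the hypersurface, for a fixed compactly supported \<open>b\<close> on
  hyperbolic space. Green's identity on the side \<open>t > 0\<close>, applied to the lift of \<open>\<phi>\<close> and to
  \<open>u = b sin(k t) / k\<close>, which vanishes at \<open>t = 0\<close> with normal derivative \<open>b\<close>, rewrites this as the
  integral of \<open>\<phi>\<close> against \<open>(\<Delta> - k\<^sup>2) u\<close>. Since \<open>|\<nabla>t| = 1\<close>, the terms of size \<open>k\<close> cancel, so the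
  period is bounded by the \<open>L\<^sup>1\<close> norm of \<open>\<phi>\<close> on a fixed compact set. That norm is bounded because
  the compact set covers every point of \<open>X\<close> at most a fixed number of times and \<open>\<phi>\<close> is normalized.
\<close>

subsection \<open>Lorentz transformations\<close>

text \<open>Green's identity is used upstairs, on one side of a hyperplane in hyperbolic space, so
  \<open>Y\<close> need not have two sides in \<open>X\<close>. For a test function u its boundary
  term combines u times the normal derivative of \<phi> with \<phi> times the normal derivative of
  u. Letting u vanish on the hypersurface removes the normal derivative of \<phi>, for which no
  uniform bound is at hand. The factor s(t) = sin(k t) / k is the solution of s'' = - k^2 s with
  s(0) = 0 and s'(0) = 1, tuned to the eigenvalue k^2. What remains in the interior is s(k
  t-profile) and its derivative cos(k t), each multiplied by a function made from b alone; both
  oscillating factors are at most 1 in modulus once k \<ge> 1. So the constant sees b but not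
  \<phi>, and \<Lambda> = 1 serves. Two derivatives fall on b, which is why weights built from cubes
  of positive parts are smooth enough.\<close>

lemma act_eq_linear:
  fixes A :: "real^('k::finite) option^'k option"
  assumes A: "A \<in> carrier lorentz_group"
  obtains s :: real where "s \<in> {1, -1}" "\<And>x. x \<in> hyp \<Longrightarrow> act A x = s *\<^sub>R (A *v x)"
proof -
  let ?o = "hpt 0 :: real^'k option"
  have o: "?o \<in> hyp" by (simp add: hyp_eq_range_hpt)
  \<comment> \<open>\<open>act\<close> chooses its sign point by point, but the choice is constant
    on \<open>hyp\<close>: \<open>lor\<close> of two points of one sheet is negative and is
    preserved by \<open>A\<close>, whereas images on opposite sheets would make it positive.\<close>
  have same: "0 < (A *v ?o) $ None \<longleftrightarrow> 0 < (A *v x) $ None" if x: "x \<in> hyp" for x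
  proof -
    have n: "lor (A *v ?o) (A *v x) < 0" using A lor_hyp_neg[OF o x] by (simp add: carrier_lorentz)
    have l: "lor (A *v ?o) (A *v ?o) = -1" "lor (A *v x) (A *v x) = -1"
      using A o x by (auto simp: carrier_lorentz hyp_def)
    show ?thesis
    proof (rule ccontr)
      assume *: "\<not> ?thesis"
      have nz: "(A *v ?o) $ None \<noteq> 0" "(A *v x) $ None \<noteq> 0" using timelike_nonzero l by blast+
      from * consider "0 < (A *v ?o) $ None" "(A *v x) $ None < 0"
        | "(A *v ?o) $ None < 0" "0 < (A *v x) $ None" using nz by fastforce
      then show False
      proof cases
        case 1
        then have "lor (A *v ?o) (- (A *v x)) < 0" by (intro lor_hyp_neg) (auto simp: hyp_def l)
        with n show False by simp
      next
        case 2
        then have "lor (- (A *v ?o)) (A *v x) < 0" by (intro lor_hyp_neg) (auto simp: hyp_def l)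
        with n show False by simp
      qed
    qed
  qed
  show thesis
  proof (cases "0 < (A *v ?o) $ None")
    case True
    show ?thesis by (rule that[of 1]) (use same True in \<open>auto simp: act_def\<close>)
  next
    case False
    show ?thesis by (rule that[of "-1"]) (use same False in \<open>auto simp: act_def\<close>)
  qed
qed

lemma lor_act:
  assumes "A \<in> carrier lorentz_group" "x \<in> hyp" "y \<in> hyp"
  shows "lor (act A x) (act A y) = lor x y"
proof -
  obtain s :: real where "s \<in> {1, -1}" "\<And>x. x \<in> hyp \<Longrightarrow> act A x = s *\<^sub>R (A *v x)"
    using act_eq_linear[OF assms(1)] by metis
  with assms show ?thesis by (auto simp: carrier_lorentz)
qed

lemma continuous_on_act:
  assumes "A \<in> carrier lorentz_group"
  shows "continuous_on hyp (act A)"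
proof -
  obtain s :: real where "\<And>x. x \<in> hyp \<Longrightarrow> act A x = s *\<^sub>R (A *v x)"
    using act_eq_linear[OF assms] by metis
  moreover have "continuous_on hyp (\<lambda>x. s *\<^sub>R (A *v x))"
    by (intro continuous_intros linear_continuous_on_compose[OF _ matrix_vector_mul_linear])
  ultimately show ?thesis by (metis (no_types, lifting) continuous_on_eq)
qed

lemma borel_measurable_act [measurable]: "act A \<in> borel_measurable borel"
proof -
  have [measurable]: "(*v) A \<in> borel_measurable borel"
    by (intro borel_measurable_continuous_onI linear_continuous_on)
       (simp add: linear_linear)
  have [measurable]: "(\<lambda>x :: real^'a option. x $ None) \<in> borel_measurable borel"
    by (intro borel_measurable_continuous_onI continuous_intros)
  show ?thesis unfolding act_def by measurable
qed

lemma mat_1_lorentz [simp]: "mat 1 \<in> carrier lorentz_group"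
  by (simp add: carrier_lorentz)

lemma lorentz_mult_closed:
  "A \<in> carrier lorentz_group \<Longrightarrow> B \<in> carrier lorentz_group \<Longrightarrow> A ** B \<in> carrier lorentz_group"
  by (simp add: carrier_lorentz flip: matrix_vector_mul_assoc)

text \<open>The time coordinate is cosh of the distance to \<open>hpt 0\<close>, and
  \<open>- lor p q\<close> is cosh of the distance of \<open>p\<close> and \<open>q\<close>. The
  last two bounds are the triangle inequality in the form cosh (a + b) \<le> 2 cosh a cosh
  b.\<close>

lemma hyp_time_bounds:
  assumes "p \<in> hyp" "q \<in> hyp"
  shows "1 \<le> p $ None" "\<bar>p $ i\<bar> \<le> p $ None"
    "- lor p q \<le> 2 * p $ None * q $ None" "q $ None \<le> 2 * p $ None * (- lor p q)"
proof -
  obtain v w where pq: "p = hpt v" "q = hpt w" using assms by (auto simp: hyp_eq_range_hpt)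
  define a b c d where "a = sqrt (1 + v \<bullet> v)" "b = sqrt (1 + w \<bullet> w)" "c = norm v" "d = norm w"
  have ac: "a\<^sup>2 = 1 + c\<^sup>2" "b\<^sup>2 = 1 + d\<^sup>2"
    by (simp_all add: a_b_c_d_def power2_norm_eq_inner add_nonneg_nonneg)
  have pos: "0 \<le> c" "0 \<le> d" "1 \<le> a" "1 \<le> b" by (auto simp: a_b_c_d_def)
  have lt: "c < a" "d < b" using ac pos by (smt (verit) power2_less_imp_less)+
  have l: "- lor p q = a * b - v \<bullet> w" by (simp add: pq lor_def a_b_c_d_def inner_vec_def)
  have vw: "\<bar>v \<bullet> w\<bar> \<le> c * d" unfolding a_b_c_d_def by (rule Cauchy_Schwarz_ineq2)
  have None: "p $ None = a" "q $ None = b" by (simp_all add: pq a_b_c_d_def)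
  show "1 \<le> p $ None" using pos None by simp
  show "\<bar>p $ i\<bar> \<le> p $ None"
  proof (cases i)
    case None then show ?thesis using pos \<open>p $ None = a\<close> by simp
  next
    case (Some j)
    have "\<bar>v $ j\<bar> \<le> c" unfolding a_b_c_d_def by (rule component_le_norm_cart)
    then show ?thesis using Some lt None by (simp add: pq)
  qed
  have cd: "c * d \<le> a * b" using lt pos by (intro mult_mono) auto
  then show "- lor p q \<le> 2 * p $ None * q $ None" using l vw None by (simp add: None)
  have "c * d \<le> c * b" using lt pos by (intro mult_left_mono) auto
  then have 1: "b * (a - c) \<le> - lor p q" using l vw by (simp add: algebra_simps)
  \<comment> \<open>The inserted factor is \<open>a\<^sup>2 - c\<^sup>2 = 1\<close>.\<close>
  have "b = b * ((a - c) * (a + c))" using ac(1) by (simp add: power2_eq_square algebra_simps)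
  also have "\<dots> = (a + c) * (b * (a - c))" by simp
  also have "\<dots> \<le> (2 * a) * (b * (a - c))" using pos lt by (intro mult_right_mono) auto
  also have "\<dots> \<le> (2 * a) * (- lor p q)" using 1 pos by (intro mult_left_mono) auto
  finally show "q $ None \<le> 2 * p $ None * (- lor p q)" by (simp add: None)
qed

text \<open>An isometry that moves one point of a ball into the same ball moves every other point by
  a controlled amount. Applied to a few points of \<open>hyp\<close> that span Minkowski space, this
  bounds all columns.\<close>

lemma lorentz_entries_bounded:
  assumes A: "A \<in> carrier lorentz_group" and x: "x \<in> hyp" "x $ None \<le> R" "act A x $ None \<le> R"
  shows "\<bar>A $ i $ j\<bar> \<le> 8 * R\<^sup>2"
proof -
  obtain s :: real where s: "s \<in> {1, -1}" "\<And>x. x \<in> hyp \<Longrightarrow> act A x = s *\<^sub>R (A *v x)"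
    using act_eq_linear[OF A] by metis
  have y: "act A x \<in> hyp" using A x(1) by (rule act_in_hyp)
  have R: "1 \<le> R" using hyp_time_bounds(1)[OF x(1) x(1)] x(2) by simp
  have b: "\<bar>(A *v z) $ i\<bar> \<le> 4 * R\<^sup>2 * z $ None" if z: "z \<in> hyp" for z
  proof -
    have w: "act A z \<in> hyp" using A z by (rule act_in_hyp)
    have z1: "1 \<le> z $ None" by (rule hyp_time_bounds[OF z z])
    have "act A z $ None \<le> 2 * act A x $ None * (- lor x z)"
      using hyp_time_bounds(4)[OF y w] lor_act[OF A x(1) z] by simp
    also have "\<dots> \<le> 2 * R * (- lor x z)"
      using lor_hyp_neg[OF x(1) z] x(3) by (intro mult_right_mono mult_left_mono) auto
    also have "\<dots> \<le> 2 * R * (2 * x $ None * z $ None)"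
      using hyp_time_bounds(3)[OF x(1) z] R by (intro mult_left_mono) auto
    also have "\<dots> \<le> 2 * R * (2 * R * z $ None)"
      using x(2) R z1 by (intro mult_left_mono mult_right_mono) auto
    finally have "act A z $ None \<le> 4 * R\<^sup>2 * z $ None" by (simp add: power2_eq_square)
    then have "\<bar>act A z $ i\<bar> \<le> 4 * R\<^sup>2 * z $ None" using hyp_time_bounds(2)[OF w w, of i] by simp
    then show ?thesis using s z by auto
  qed
  have hyp: "hpt v \<in> hyp" for v by (simp add: hyp_eq_range_hpt)
  show ?thesis
  proof (cases j)
    case None
    have "\<bar>(A *v hpt 0) $ i\<bar> \<le> 4 * R\<^sup>2" using b[OF hyp[of 0]] by simp
    then show ?thesis using None by (simp add: hpt_0 matrix_vector_axis)
  next
    case (Some k)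
    let ?e = "axis k 1"
    \<comment> \<open>A spatial axis is half the difference of two points of \<open>hyp\<close> with
      time \<open>sqrt 2\<close>, which is less than 2; with the factor \<open>4 * R\<^sup>2\<close>
      from above this gives \<open>8 * R\<^sup>2\<close>.\<close>
    have "axis j 1 = (1/2) *\<^sub>R (hpt ?e - hpt (- ?e))"
      by (auto simp: vec_eq_iff Some axis_def hpt_def split: option.split)
    then have "(A *v axis j 1) $ i = (1/2) * ((A *v hpt ?e) $ i - (A *v hpt (- ?e)) $ i)"
      by (simp add: matrix_vector_mult_scaleR matrix_vector_mult_diff_distrib)
    moreover have "4 * R\<^sup>2 * sqrt 2 \<le> 4 * R\<^sup>2 * 2" using sqrt2_less_2 by (intro mult_left_mono) auto
    then have "\<bar>(A *v hpt ?e) $ i\<bar> \<le> 4 * R\<^sup>2 * 2" "\<bar>(A *v hpt (- ?e)) $ i\<bar> \<le> 4 * R\<^sup>2 * 2"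
      using b[OF hyp[of ?e]] b[OF hyp[of "- ?e"]] by (simp_all add: inner_axis_axis mult_ac)
    ultimately have "\<bar>(A *v axis j 1) $ i\<bar> \<le> 8 * R\<^sup>2" by (simp add: abs_le_iff)
    then show ?thesis by (simp add: matrix_vector_axis)
  qed
qed

lemma lorentz_inverse:
  assumes "subgroup \<Gamma> lorentz_group" "A \<in> \<Gamma>"
  obtains B where "B \<in> \<Gamma>" "B ** A = mat 1" "A ** B = mat 1"
    "\<And>x. x \<in> hyp \<Longrightarrow> act B (act A x) = x" "\<And>x. x \<in> hyp \<Longrightarrow> act A (act B x) = x"
proof -
  interpret subgroup \<Gamma> lorentz_group by fact
  interpret G: group lorentz_group by (rule group_lorentz)
  define B where "B = inv\<^bsub>lorentz_group\<^esub> A"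
  have B: "B \<in> \<Gamma>" "B ** A = mat 1" "A ** B = mat 1"
    using G.l_inv[OF mem_carrier[OF assms(2)]] G.r_inv[OF mem_carrier[OF assms(2)]] assms(2)
    unfolding B_def by (simp, simp_all add: lorentz_group_def)
  show thesis
    by (rule that[OF B])
       (metis B act_mult act_one assms(2) mem_carrier)+
qed

lemma subgroup_lorentz_mult:
  "subgroup \<Gamma> lorentz_group \<Longrightarrow> A \<in> \<Gamma> \<Longrightarrow> B \<in> \<Gamma> \<Longrightarrow> A ** B \<in> \<Gamma>"
  using subgroup.m_closed[of \<Gamma> lorentz_group A B] by (simp add: lorentz_group_def)

lemma subgroup_lorentz_one: "subgroup \<Gamma> lorentz_group \<Longrightarrow> mat 1 \<in> \<Gamma>"
  using subgroup.one_closed[of \<Gamma> lorentz_group] by (simp add: lorentz_group_def)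

lemma norm_matrix_le:
  fixes A :: "real^'n^'m"
  assumes "\<And>i j. \<bar>A $ i $ j\<bar> \<le> M"
  shows "norm A \<le> real CARD('m) * (real CARD('n) * M)"
proof -
  have "norm (A $ i) \<le> real CARD('n) * M" for i
    using norm_le_l1_cart[of "A $ i"] sum_bounded_above[of UNIV "\<lambda>j. \<bar>A $ i $ j\<bar>" M] assms by simp
  then have "(\<Sum>i\<in>UNIV. norm (A $ i)) \<le> real CARD('m) * (real CARD('n) * M)"
    using sum_bounded_above[of UNIV "\<lambda>i. norm (A $ i)"] by simp
  moreover have "norm A \<le> (\<Sum>i\<in>UNIV. norm (A $ i))"
    unfolding norm_vec_def by (rule L2_set_le_sum) auto
  ultimately show ?thesis by linarith
qed

text \<open>The elements in question are bounded as matrices. They are also uniformly separated: if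
  \<open>A\<close> and \<open>B\<close> were very close, then the inverse of \<open>A\<close> times
  \<open>B\<close> would lie in the neighbourhood that isolates the identity. Bounded and uniformly
  discrete sets are finite.\<close>

lemma discrete_imp_proper:
  fixes \<Gamma> :: "(real^('k::finite) option^'k option) set"
  assumes sub: "subgroup \<Gamma> lorentz_group" and dis: "discrete \<Gamma>"
  shows "finite {A\<in>\<Gamma>. \<exists>x\<in>hyp. x $ None \<le> R \<and> act A x $ None \<le> R}" (is "finite ?S")
proof -
  define N where "N = real CARD('k option) * (real CARD('k option) * (8 * R\<^sup>2))"
  have carr: "A \<in> carrier lorentz_group" if "A \<in> \<Gamma>" for A using subgroup.mem_carrier[OF sub that] .
  have N: "norm A \<le> N" if "A \<in> ?S" for A
  proof -
    obtain x where x: "x \<in> hyp" "x $ None \<le> R" "act A x $ None \<le> R" using \<open>A \<in> ?S\<close> by blast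
    have "A \<in> carrier lorentz_group" using that by (intro carr) simp
    from lorentz_entries_bounded[OF this x] show ?thesis unfolding N_def by (rule norm_matrix_le)
  qed
  then have "bounded ?S" by (auto simp: bounded_iff)
  moreover have "uniform_discrete ?S"
  proof -
    obtain T where T: "open T" "T \<inter> \<Gamma> = {mat 1}"
      using dis subgroup_lorentz_one[OF sub] by (auto simp: discrete_def isolated_in_def)
    then have "mat 1 \<in> T" by blast
    with T(1) obtain e where e: "0 < e" "ball (mat 1) e \<subseteq> T" by (rule openE)
    have "bilinear ((**) :: real^'k option^'k option \<Rightarrow> real^'k option^'k option \<Rightarrow> _)"
      unfolding bilinear_def
      by (auto intro!: linearI simp: matrix_add_ldistrib matrix_matrix_mult_def vec_eq_iff
          algebra_simps sum.distrib sum_distrib_left)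
    then have "bounded_bilinear ((**) :: real^'k option^'k option \<Rightarrow> real^'k option^'k option \<Rightarrow> _)"
      by (simp only: bilinear_conv_bounded_bilinear)
    from bounded_bilinear.pos_bounded[OF this] obtain K where K: "0 < K"
      "\<And>(X :: real^'k option^'k option) (Y :: real^'k option^'k option).
         norm (X ** Y) \<le> norm X * norm Y * K"
      by blast
    \<comment> \<open>Multiplying by an inverse enlarges distances by at most
      \<open>K * (\<bar>N\<bar> + 1)\<close>; the summand 1 keeps the divisor positive.\<close>
    define d where "d = e / (K * (\<bar>N\<bar> + 1))"
    have d: "0 < d" using e K by (simp add: d_def)
    show ?thesis
    proof (rule uniformI1[OF d])
      fix A B assume AB: "A \<in> ?S" "B \<in> ?S" "dist A B < d"
      have A: "A \<in> \<Gamma>" using AB by simp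
      obtain C where C: "C \<in> \<Gamma>" "C ** A = mat 1" "A ** C = mat 1"
        "\<And>x. x \<in> hyp \<Longrightarrow> act C (act A x) = x" using lorentz_inverse[OF sub A] by metis
      obtain x where "x \<in> hyp" "x $ None \<le> R" "act A x $ None \<le> R" using AB(1) by blast
      \<comment> \<open>The inverse carries \<open>act A x\<close> back to \<open>x\<close>, so it
        belongs to the same set and obeys the same norm bound.\<close>
      then have "C \<in> ?S" using C(1,4) act_in_hyp[OF carr[OF A]] by (auto intro!: bexI[of _ "act A x"])
      then have "norm C \<le> \<bar>N\<bar> + 1" using N[of C] by linarith
      have "C ** B - mat 1 = C ** (B - A)"
        using C(2) matrix_add_ldistrib[of C "B - A" A] by simp
      then have "dist (mat 1) (C ** B) \<le> norm C * norm (B - A) * K"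
        using K(2)[of C "B - A"] by (simp add: dist_norm norm_minus_commute[of "mat 1"])
      also have "\<dots> \<le> (\<bar>N\<bar> + 1) * norm (B - A) * K"
        using \<open>norm C \<le> _\<close> K(1) by (intro mult_right_mono) auto
      also have "\<dots> < (\<bar>N\<bar> + 1) * d * K"
        using AB(3) K(1) by (intro mult_strict_right_mono mult_strict_left_mono)
          (auto simp: dist_norm norm_minus_commute)
      also have "\<dots> = e"
      proof -
        have "K \<noteq> 0" "\<bar>N\<bar> + 1 \<noteq> 0" using K(1) by linarith+
        then show ?thesis by (simp add: d_def)
      qed
      finally have "C ** B \<in> T" using e by auto
      moreover have "C ** B \<in> \<Gamma>" using C AB by (intro subgroup_lorentz_mult[OF sub]) auto
      ultimately have "C ** B = mat 1" using T by blast
      then show "A = B" by (metis C(3) matrix_mul_assoc matrix_mul_lid matrix_mul_rid)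
    qed

  qed
  ultimately show ?thesis using uniform_discrete_finite_iff[of ?S] by metis
qed

subsection \<open>Invariance of the hyperbolic measure\<close>

text \<open>The change of variables theorems of \<open>HOL-Analysis\<close> need a well-ordered index type. A finite
  index type is therefore replaced by an initial segment of the natural numbers of the same size.\<close>

typedef ('a::finite) ix = "{..<CARD('a)}"
  by (intro exI[of _ 0]) simp

lemma bij_Rep_ix: "bij_betw (Rep_ix :: 'a::finite ix \<Rightarrow> nat) UNIV {..<CARD('a)}"
  using type_definition.Rep_range[OF type_definition_ix]
  by (auto simp: bij_betw_def inj_on_def Rep_ix_inject)

instance ix :: (finite) finite
proof
  show "finite (UNIV :: 'a ix set)"
    using bij_betw_finite[OF bij_Rep_ix] by auto
qed

instantiation ix :: (finite) wellorder
begin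
definition less_eq_ix :: "'a ix \<Rightarrow> 'a ix \<Rightarrow> bool" where "less_eq_ix a b \<longleftrightarrow> Rep_ix a \<le> Rep_ix b"
definition less_ix :: "'a ix \<Rightarrow> 'a ix \<Rightarrow> bool" where "less_ix a b \<longleftrightarrow> Rep_ix a < Rep_ix b"
instance
proof
  fix P :: "'a ix \<Rightarrow> bool" and a
  assume *: "\<And>x. (\<And>y. y < x \<Longrightarrow> P y) \<Longrightarrow> P x"
  show "P a"
    by (induction "Rep_ix a" arbitrary: a rule: less_induct) (metis * less_ix_def)
qed (auto simp: less_eq_ix_def less_ix_def Rep_ix_inject)
end

lemma bij_ix: obtains h :: "'a::finite ix \<Rightarrow> 'a" where "bij h"
proof -
  obtain f where "bij_betw f {..<CARD('a)} (UNIV :: 'a set)"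
    using ex_bij_betw_nat_finite[of "UNIV :: 'a set"] by (auto simp: lessThan_atLeast0)
  from bij_betw_trans[OF bij_Rep_ix this] show thesis by (rule that)
qed

section \<open>Isometries and the volume density in the global chart\<close>

abbreviation chart :: "real^('k::finite) option \<Rightarrow> real^'k" where
  "chart x \<equiv> \<chi> j. x $ Some j"

lemma chart_hpt [simp]: "chart (hpt v) = v"
  by (simp add: vec_eq_iff)

lemma hpt_chart: "x \<in> hyp \<Longrightarrow> hpt (chart x) = x"
  unfolding hyp_eq_range_hpt using chart_hpt by (metis imageE)

lemma hpt_in_hyp [simp]: "hpt v \<in> hyp"
  by (simp add: hyp_eq_range_hpt)

lemma continuous_on_hpt [continuous_intros]: "continuous_on S hpt"
  using hpt_has_derivative
  by (meson continuous_at_imp_continuous_on differentiable_def differentiable_imp_continuous_within)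

lemma continuous_on_chart [continuous_intros]: "continuous_on S chart"
  by (intro continuous_intros)

lemma one_plus_inner_pos [simp]: "0 < 1 + v \<bullet> v"
  by (simp add: add_pos_nonneg)

lemma hdensity_pos: "0 < hdensity v"
  by (simp add: hdensity_eq)

lemma continuous_on_hdensity: "continuous_on S hdensity"
  unfolding hdensity_eq[abs_def]
  by (intro continuous_intros) (use one_plus_inner_pos in \<open>metis less_irrefl real_sqrt_eq_zero_cancel_iff\<close>)

text \<open>The differential of \<open>hpt\<close> at \<open>v\<close>, which embeds tangent vectors
  of the chart in Minkowski space.\<close>

definition dhpt :: "real^('k::finite) \<Rightarrow> real^'k \<Rightarrow> real^'k option" where
  "dhpt v h = (\<chi> i. case i of None \<Rightarrow> (v \<bullet> h) / sqrt (1 + v \<bullet> v) | Some j \<Rightarrow> h $ j)"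

lemma lor_dhpt: "lor (dhpt v h) (dhpt v h') = h \<bullet> (hmetric v *v h')"
  by (simp add: lor_def dhpt_def hmetric_mult inner_diff_right inner_vec_def[of h h']
      inner_commute[of h v])

text \<open>The metric is the pullback of \<open>lor\<close> along \<open>hpt\<close>, and
  \<open>act A\<close> preserves \<open>lor\<close>. So the Jacobian matrix M of the chart map
  satisfies M^T g(T v) M = g(v); the claim is the square root of the determinants.\<close>

lemma density_act:
  fixes A :: "real^('k::finite) option^'k option"
  assumes "A \<in> carrier lorentz_group"
  obtains D where
    "\<And>v. ((\<lambda>v. chart (act A (hpt v))) has_derivative D v) (at v)"
    "\<And>v. \<bar>det (matrix (D v))\<bar> * hdensity (chart (act A (hpt v))) = hdensity v"
proof -
  obtain s :: real where s: "s \<in> {1, -1}" "\<And>x. x \<in> hyp \<Longrightarrow> act A x = s *\<^sub>R (A *v x)"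
    using act_eq_linear[OF assms] by metis
  define T where "T v = chart (act A (hpt v))" for v
  have T: "T v = chart (s *\<^sub>R (A *v hpt v))" for v by (simp add: T_def s)
  have hT: "hpt (T v) = s *\<^sub>R (A *v hpt v)" for v
    using hpt_chart[OF act_in_hyp[OF assms hpt_in_hyp]] by (simp add: T_def s)
  define D where "D v h = chart (s *\<^sub>R (A *v dhpt v h))" for v h
  have hd: "(hpt has_derivative dhpt v) (at v)" for v :: "real^'k"
    using hpt_has_derivative[of v] by (simp add: dhpt_def[abs_def])
  have lin: "bounded_linear (\<lambda>x :: real^'k option. s *\<^sub>R (A *v x))"
    by (intro bounded_linear_const_scaleR) (simp add: linear_linear)
  have lin2: "bounded_linear (chart :: real^'k option \<Rightarrow> real^'k)"
    unfolding linear_conv_bounded_linear[symmetric] by (rule linearI) (auto simp: vec_eq_iff)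
  have d1: "((\<lambda>v. s *\<^sub>R (A *v hpt v)) has_derivative (\<lambda>h. s *\<^sub>R (A *v dhpt v h))) (at v)" for v
    by (rule bounded_linear.has_derivative[OF lin hd])
  have dT: "(T has_derivative D v) (at v)" for v
    unfolding T[abs_def] D_def[abs_def] by (rule bounded_linear.has_derivative[OF lin2 d1])
  \<comment> \<open>The two sides are the derivatives of one map, \<open>hpt\<close> after
    \<open>T\<close>, computed in two ways.\<close>
  have comp: "dhpt (T v) (D v h) = s *\<^sub>R (A *v dhpt v h)" for v h
  proof -
    have "((\<lambda>v. hpt (T v)) has_derivative (\<lambda>h. dhpt (T v) (D v h))) (at v)"
      by (rule has_derivative_compose[OF dT hd])
    then have "(\<lambda>h. dhpt (T v) (D v h)) = (\<lambda>h. s *\<^sub>R (A *v dhpt v h))"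
      unfolding hT by (rule has_derivative_unique[OF _ d1])
    then show ?thesis by (rule fun_cong)
  qed
  have "\<bar>det (matrix (D v))\<bar> * hdensity (T v) = hdensity v" for v
  proof -
    define M where "M = matrix (D v)"
    have M: "D v h = M *v h" for h
      using dT[of v] by (simp add: M_def has_derivative_linear)
    have "transpose M ** hmetric (T v) ** M = hmetric v"
      unfolding vec_eq_iff
    proof (intro allI)
      fix i j
      have "hmetric v $ i $ j = axis i 1 \<bullet> (hmetric v *v axis j 1)"
        by (simp add: inner_axis' matrix_vector_mult_basis column_def)
      also have "\<dots> = lor (dhpt (T v) (D v (axis i 1))) (dhpt (T v) (D v (axis j 1)))"
        using assms s(1) by (auto simp: comp lor_dhpt[symmetric] carrier_lorentz)
      also have "\<dots> = (M *v axis i 1) \<bullet> (hmetric (T v) *v (M *v axis j 1))"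
        by (simp add: lor_dhpt M)
      also have "\<dots> = axis i 1 \<bullet> ((transpose M ** hmetric (T v) ** M) *v axis j 1)"
        by (metis (no_types) dot_lmul_matrix vector_transpose_matrix matrix_vector_mul_assoc)
      also have "\<dots> = (transpose M ** hmetric (T v) ** M) $ i $ j"
        by (simp add: inner_axis' matrix_vector_mult_basis column_def)
      finally show "(transpose M ** hmetric (T v) ** M) $ i $ j = hmetric v $ i $ j" by simp
    qed
    moreover have "det (transpose M ** hmetric (T v) ** M) = (det M)\<^sup>2 * det (hmetric (T v))"
      by (simp add: det_mul power2_eq_square)
    ultimately have "det (hmetric v) = (det M)\<^sup>2 * det (hmetric (T v))" by simp
    then show ?thesis
      by (simp add: hdensity_def real_sqrt_mult M_def)
  qed
  with dT show thesis unfolding T_def by (rule that)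
qed

lemma measurable_hpt [measurable]: "hpt \<in> borel_measurable borel"
  by (intro borel_measurable_continuous_onI continuous_on_hpt)

lemma measurable_chart [measurable]: "chart \<in> borel_measurable borel"
  by (intro borel_measurable_continuous_onI continuous_on_chart)

lemma measurable_hdensity [measurable]: "hdensity \<in> borel_measurable borel"
  by (intro borel_measurable_continuous_onI continuous_on_hdensity)

lemma sets_hyp_measure [measurable_cong, simp]: "sets hyp_measure = sets borel"
  by (simp add: hyp_measure_def)

lemma space_hyp_measure [simp]: "space hyp_measure = UNIV"
  by (simp add: hyp_measure_def)

lemma nn_integral_hyp_measure:
  assumes [measurable]: "f \<in> borel_measurable borel"
  shows "(\<integral>\<^sup>+x. f x \<partial>hyp_measure) = (\<integral>\<^sup>+v. ennreal (hdensity v) * f (hpt v) \<partial>lborel)"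
  unfolding hyp_measure_def by (simp add: nn_integral_distr nn_integral_density)

text \<open>Change of variables along the chart map \<open>T\<close> with inverse \<open>S\<close>;
  by \<open>density_act\<close> the Jacobian of \<open>S\<close> turns the density at
  \<open>S v\<close> into the density at \<open>v\<close>.\<close>

lemma hyp_measure_invariant_wellorder:
  fixes A :: "real^('k::{finite,wellorder}) option^'k option"
  assumes A: "A \<in> carrier lorentz_group"
  shows "distr hyp_measure borel (act A) = hyp_measure"
proof -
  obtain B where B: "B \<in> carrier lorentz_group" "B ** A = mat 1"
    using lorentz_invertible[OF A] by blast
  then have B': "A ** B = mat 1" using matrix_left_right_inverse by blast
  obtain D where D: "\<And>v. ((\<lambda>v. chart (act A (hpt v))) has_derivative D v) (at v)"
    using density_act[OF A] by metis
  obtain E where E: "\<And>v. ((\<lambda>v. chart (act B (hpt v))) has_derivative E v) (at v)"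
    "\<And>v. \<bar>det (matrix (E v))\<bar> * hdensity (chart (act B (hpt v))) = hdensity v"
    using density_act[OF B(1)] by metis
  define T where "T v = chart (act A (hpt v))" for v
  define S where "S v = chart (act B (hpt v))" for v
  have hT: "hpt (T v) = act A (hpt v)" "hpt (S v) = act B (hpt v)" for v
    unfolding T_def S_def by (subst hpt_chart; simp add: act_in_hyp A B)+
  have inv: "T (S v) = v" "S (T v) = v" for v
    unfolding T_def[of "S v"] S_def[of "T v"] hT
    using act_mult[OF A B(1), of "hpt v"] act_mult[OF B(1) A, of "hpt v"]
    by (simp_all add: B B' act_one)
  have dT: "(T has_derivative D v) (at v)" and dS: "(S has_derivative E v) (at v)" for v
    using D E(1) by (simp_all add: T_def[abs_def] S_def[abs_def])
  have [measurable]: "T \<in> borel_measurable borel"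
    unfolding T_def[abs_def] by measurable
  define \<rho> where "\<rho> = density lborel (\<lambda>v :: real^'k::_. ennreal (hdensity v))"
  have sets [measurable_cong]: "sets \<rho> = sets borel" by (simp add: \<rho>_def)
  have "distr \<rho> borel T = \<rho>"
  proof (rule measure_eqI)
    show "sets (distr \<rho> borel T) = sets \<rho>" by (simp add: sets)
    \<comment> \<open>On a bounded set the density has a finite integral \<open>I\<close>, which the
      change of variables can carry over. Arbitrary Borel sets are then exhausted by their
      intersections with balls.\<close>
    have bdd: "emeasure (distr \<rho> borel T) X = emeasure \<rho> X"
      if [measurable]: "X \<in> sets borel" and "bounded X" for X
    proof -
      obtain a b where ab: "X \<subseteq> cbox a b" using bounded_subset_cbox_symmetric[OF \<open>bounded X\<close>] by metis
      have "hdensity absolutely_integrable_on cbox a b"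
        by (intro absolutely_integrable_continuous continuous_on_hdensity)
      then have "hdensity integrable_on X"
        using ab set_integrable_subset[of lebesgue "cbox a b" hdensity X]
        by (auto intro!: set_lebesgue_integral_eq_integral(1))
      then obtain I where I: "(hdensity has_integral I) X" by blast

      have "((\<lambda>x. \<bar>det (matrix (E x))\<bar> * hdensity (S x)) has_integral I) X \<longleftrightarrow>
        (hdensity has_integral I) (T -` X)"
      proof (rule cov_invertible_nonneg_eq[where h = T and h' = D])
        show "(S has_derivative E x) (at x within X)" "(T has_derivative D x) (at x within T -` X)" for x
          using dS dT has_derivative_at_withinI by blast+
        show "D y \<circ> E (T y) = id" for y
        proof -
          have "((T \<circ> S) has_derivative (D (S (T y)) \<circ> E (T y))) (at (T y))"
            by (rule diff_chain_at[OF dS dT])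
          moreover have "T \<circ> S = id" by (simp add: fun_eq_iff inv)
          ultimately have "(id has_derivative (D y \<circ> E (T y))) (at (T y))" by (simp add: inv)
          then show ?thesis using has_derivative_unique[OF _ has_derivative_id] by (auto simp: id_def)
        qed
      qed (auto simp: inv less_imp_le[OF hdensity_pos])
      then have J: "(hdensity has_integral I) (T -` X)" using I E(2) by (simp add: S_def)
      have [measurable]: "T -` X \<in> sets borel"
        using measurable_sets[of T borel borel X] by simp
      have em: "emeasure \<rho> Y = I" if [measurable]: "Y \<in> sets borel" and Y: "(hdensity has_integral I) Y" for Y
      proof -
        have "emeasure \<rho> Y = (\<integral>\<^sup>+x. ennreal (indicator Y x * hdensity x) \<partial>lborel)"
          unfolding \<rho>_def by (subst emeasure_density) (auto intro!: nn_integral_cong split: split_indicator)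
        also have "\<dots> = I"
          by (rule nn_integral_has_integral_lebesgue[OF less_imp_le[OF hdensity_pos] Y])
        finally show ?thesis .
      qed
      show ?thesis using em[OF _ I] em[OF _ J] by (simp add: emeasure_distr sets_eq_imp_space_eq[OF sets])
    qed
    fix X assume "X \<in> sets (distr \<rho> borel T)"
    then have X [measurable]: "X \<in> sets borel" by simp
    define Y where "Y n = X \<inter> cball 0 (real n)" for n :: nat
    have Y: "range Y \<subseteq> sets borel" "incseq Y"
      by (auto simp: Y_def incseq_def)
    have U: "(\<Union>n. Y n) = X" using real_arch_simple by (auto simp: Y_def)
    have "bounded (Y n)" for n unfolding Y_def by (simp add: bounded_Int)
    then have "emeasure (distr \<rho> borel T) (Y n) = emeasure \<rho> (Y n)" for n using Y by (intro bdd) auto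
    then show "emeasure (distr \<rho> borel T) X = emeasure \<rho> X"
      using SUP_emeasure_incseq[of Y "distr \<rho> borel T"] SUP_emeasure_incseq[of Y \<rho>] Y U
      by (simp add: sets)
  qed
  then have "distr (distr \<rho> borel T) borel hpt = hyp_measure" by (simp add: hyp_measure_def \<rho>_def)
  moreover have "distr (distr \<rho> borel T) borel hpt = distr hyp_measure borel (act A)"
    unfolding hyp_measure_def \<rho>_def[symmetric]
    by (subst (1 2) distr_distr) (auto simp: comp_def hT)
  ultimately show ?thesis by simp
qed

section \<open>Transfer of the invariance to arbitrary finite index types\<close>

lemma prod_Basis_vec:
  fixes f :: "real^'a \<Rightarrow> real"
  shows "prod f Basis = (\<Prod>i\<in>UNIV. f (axis i 1))"
proof -
  have B: "(Basis :: (real^'a) set) = range (\<lambda>i. axis i 1)" by (auto simp: Basis_vec_def)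
  show ?thesis unfolding B by (subst prod.reindex) (auto simp: inj_on_def axis_eq_axis)
qed

lemma emeasure_lborel_box_vec:
  fixes l u :: "real^'a"
  assumes "\<And>i. l $ i \<le> u $ i"
  shows "emeasure lborel (box l u) = ennreal (\<Prod>i\<in>UNIV. u $ i - l $ i)"
proof -
  have "\<forall>b\<in>Basis. l \<bullet> b \<le> u \<bullet> b" using assms by (auto simp: Basis_vec_def inner_axis)
  then show ?thesis by (simp add: emeasure_lborel_box_eq prod_Basis_vec inner_axis)
qed

lemma lborel_reindex:
  fixes h :: "'n::finite \<Rightarrow> 'k::finite"
  assumes "bij h"
  shows "distr (lborel :: (real^'k) measure) borel (\<lambda>v. \<chi> i. v $ h i) = (lborel :: (real^'n) measure)"
proof (rule lborel_eqI[symmetric])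
  have [measurable]: "(\<lambda>v :: real^'k. (\<chi> i. v $ h i) :: real^'n) \<in> borel_measurable borel"
    by (intro borel_measurable_continuous_onI continuous_intros)

  fix l u :: "real^'n"
  assume lu: "\<And>b. b \<in> Basis \<Longrightarrow> l \<bullet> b \<le> u \<bullet> b"
  have lu': "l $ i \<le> u $ i" for i using lu[of "axis i 1"] by (simp add: inner_axis)
  define g where "g = inv_into UNIV h"
  have g: "h (g k) = k" "g (h i) = i" for k i
    using assms by (auto simp: g_def bij_is_surj surj_f_inv_f bij_is_inj)
  define l' u' where "l' = (\<chi> k. l $ g k)" and "u' = (\<chi> k. u $ g k)"
  have "(\<lambda>v :: real^'k. (\<chi> i. v $ h i) :: real^'n) -` box l u = box l' u'"
    by (auto simp: mem_box_cart l'_def u'_def) (metis g)+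
  then have "emeasure (distr lborel borel (\<lambda>v :: real^'k. (\<chi> i. v $ h i) :: real^'n)) (box l u)
     = (\<Prod>k\<in>UNIV. u' $ k - l' $ k)"
    by (simp add: emeasure_distr emeasure_lborel_box_vec l'_def u'_def lu')
  also have "\<dots> = (\<Prod>i\<in>UNIV. u $ i - l $ i)"
    using prod.reindex_bij_betw[OF assms, of "\<lambda>k. u' $ k - l' $ k"] by (simp add: l'_def u'_def g)
  also have "\<dots> = (\<Prod>b\<in>Basis. (u - l) \<bullet> b)"
    by (simp add: prod_Basis_vec inner_axis)
  finally show "emeasure (distr lborel borel (\<lambda>v :: real^'k. (\<chi> i. v $ h i) :: real^'n)) (box l u) =
     ennreal (\<Prod>b\<in>Basis. (u - l) \<bullet> b)" by simp
qed simp

text \<open>Renaming spatial coordinates along a bijection with the well-ordered type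
  \<open>'k ix\<close> is an isometry \<open>R\<close> of Minkowski spaces. It intertwines the
  actions of \<open>A'\<close> and \<open>A\<close> and carries one hyperbolic measure to the other,
  so invariance under \<open>A'\<close> passes to \<open>A\<close>.\<close>

lemma hyp_measure_invariant:
  fixes A :: "real^('k::finite) option^'k option"
  assumes A: "A \<in> carrier lorentz_group"
  shows "distr hyp_measure borel (act A) = hyp_measure"
proof -
  obtain h :: "'k ix \<Rightarrow> 'k" where h: "bij h" by (rule bij_ix)
  define g where "g = inv_into UNIV h"
  have hg: "h (g k) = k" "g (h i) = i" for k i
    using h by (auto simp: g_def bij_is_surj surj_f_inv_f bij_is_inj)
  have bg: "bij g" using h by (simp add: g_def bij_imp_bij_inv)
  have sum_h: "(\<Sum>i\<in>UNIV. f (h i)) = (\<Sum>k\<in>UNIV. f k)" for f :: "'k \<Rightarrow> real"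
    using h by (rule sum.reindex_bij_betw)
  define R where "R x = (\<chi> i. x $ map_option g i)" for x :: "real^'k ix option"
  define A' where "A' = (\<chi> i j. A $ map_option h i $ map_option h j)"
  have lorR: "lor (R x) (R y) = lor x y" for x y
    by (simp add: lor_def R_def sum_h[symmetric] hg)
  have RA: "R (A' *v x) = A *v R x" for x
    by (simp add: vec_eq_iff R_def A'_def matrix_vector_mult_def UNIV_option_sum sum_h[symmetric] hg
        option.map_comp comp_def option.map_ident)
  have A': "A' \<in> carrier lorentz_group"
    unfolding carrier_lorentz using A by (metis RA lorR carrier_lorentz)
  have actR: "act A (R x) = R (act A' x)" for x
    by (simp add: act_def RA[symmetric]) (simp add: R_def vec_eq_iff)
  have R [measurable]: "R \<in> borel_measurable borel"
    unfolding R_def[abs_def] by (intro borel_measurable_continuous_onI continuous_intros)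
  define r where "r v = (\<chi> k. v $ g k)" for v :: "real^'k ix"
  have r [measurable]: "r \<in> borel_measurable borel"
    unfolding r_def[abs_def] by (intro borel_measurable_continuous_onI continuous_intros)
  have lb: "distr lborel borel r = lborel" unfolding r_def[abs_def] by (rule lborel_reindex[OF bg])
  have rr: "r v \<bullet> r v = v \<bullet> v" for v
  proof -
    have "r v \<bullet> r v = (\<Sum>k\<in>UNIV. v $ g k * v $ g k)" unfolding inner_vec_def r_def by simp
    also have "\<dots> = (\<Sum>i\<in>UNIV. v $ g (h i) * v $ g (h i))" by (rule sum_h[symmetric])
    also have "\<dots> = v \<bullet> v" unfolding inner_vec_def hg by simp
    finally show ?thesis .
  qed
  have hr: "hpt (r v) = R (hpt v)" for v
    by (auto simp: vec_eq_iff hpt_def rr[unfolded r_def] R_def r_def split: option.split)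
  have M: "distr hyp_measure borel R = hyp_measure"
  proof (rule measure_eqI)
    fix X assume "X \<in> sets (distr hyp_measure borel R)"
    then have [measurable]: "X \<in> sets borel" by simp
    have "emeasure hyp_measure X = (\<integral>\<^sup>+v. ennreal (hdensity v) * indicator X (hpt v) \<partial>lborel)"
      using nn_integral_hyp_measure[of "indicator X"] by simp
    also have "\<dots> = (\<integral>\<^sup>+v. ennreal (hdensity (r v)) * indicator X (hpt (r v)) \<partial>lborel)"
      by (subst lb[symmetric], subst nn_integral_distr) auto
    also have "\<dots> = (\<integral>\<^sup>+v. ennreal (hdensity v) * indicator X (R (hpt v)) \<partial>lborel)"
      by (simp add: hr rr hdensity_eq)
    also have "\<dots> = (\<integral>\<^sup>+x. indicator X (R x) \<partial>hyp_measure)"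
      by (subst nn_integral_hyp_measure) simp_all
    also have "\<dots> = (\<integral>\<^sup>+x. indicator X x \<partial>distr hyp_measure borel R)"
      by (subst nn_integral_distr) simp_all
    also have "\<dots> = emeasure (distr hyp_measure borel R) X"
      by simp
    finally show "emeasure (distr hyp_measure borel R) X = emeasure hyp_measure X" by simp
  qed simp
  have "distr hyp_measure borel (act A) = distr (distr hyp_measure borel R) borel (act A)"
    by (simp add: M)
  also have "\<dots> = distr (distr hyp_measure borel (act A')) borel R"
    by (subst (1 2) distr_distr) (auto simp: comp_def actR)
  also have "\<dots> = hyp_measure" by (simp add: hyp_measure_invariant_wellorder[OF A'] M)
  finally show ?thesis .
qed

subsection \<open>Free and properly discontinuous actions\<close>

lemma sets_hyp [measurable]: "hyp \<in> sets borel"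
proof -
  have "hyp = {x :: real^'a option. hpt (chart x) = x}"
    using hpt_chart hpt_in_hyp by (auto, metis)
  also have "closed \<dots>"
    by (intro closed_Collect_eq continuous_on_compose2[OF continuous_on_hpt continuous_on_chart])
       (auto intro: continuous_intros)
  finally show ?thesis by (simp add: borel_closed)
qed

text \<open>Common ground for \<open>X\<close> and \<open>Y\<close>: both \<Gamma> and
  \<open>cycle_lattice \<Gamma>\<close> are shown to be instances, so quotient measures, unfolding
  and partitions of unity are developed once.\<close>

locale free_proper =
  fixes \<Gamma> :: "(real^('k::finite) option^'k option) set"
  assumes sub: "subgroup \<Gamma> lorentz_group"
    and proper: "\<And>R. finite {A\<in>\<Gamma>. \<exists>x\<in>hyp. x $ None \<le> R \<and> act A x $ None \<le> R}"
    and free: "\<And>A x. A \<in> \<Gamma> \<Longrightarrow> x \<in> hyp \<Longrightarrow> act A x = x \<Longrightarrow> A = mat 1"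
begin

text \<open>Its cardinality will bound how many points of a single orbit, counted by group elements,
  lie in the ball of time at most \<open>R\<close>; see \<open>card_return_le\<close>.\<close>

definition near :: "real \<Rightarrow> (real^'k option^'k option) set" where
  "near R = {A\<in>\<Gamma>. \<exists>x\<in>hyp. x $ None \<le> R \<and> act A x $ None \<le> R}"

lemma finite_near [simp]: "finite (near R)"
  using proper by (simp add: near_def)

lemma carr: "A \<in> \<Gamma> \<Longrightarrow> A \<in> carrier lorentz_group"
  by (rule subgroup.mem_carrier[OF sub])

lemma act_hyp: "A \<in> \<Gamma> \<Longrightarrow> x \<in> hyp \<Longrightarrow> act A x \<in> hyp"
  by (intro act_in_hyp carr)

lemma act_comp: "A \<in> \<Gamma> \<Longrightarrow> B \<in> \<Gamma> \<Longrightarrow> x \<in> hyp \<Longrightarrow> act (A ** B) x = act A (act B x)"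
  by (intro act_mult carr)

lemma mult_in: "A \<in> \<Gamma> \<Longrightarrow> B \<in> \<Gamma> \<Longrightarrow> A ** B \<in> \<Gamma>"
  by (rule subgroup_lorentz_mult[OF sub])

lemma one_in: "mat 1 \<in> \<Gamma>"
  by (rule subgroup_lorentz_one[OF sub])

definition iv :: "real^'k option^'k option \<Rightarrow> real^'k option^'k option" where
  "iv A = (SOME B. B \<in> \<Gamma> \<and> B ** A = mat 1 \<and> A ** B = mat 1)"

lemma iv:
  assumes "A \<in> \<Gamma>"
  shows "iv A \<in> \<Gamma>" "iv A ** A = mat 1" "A ** iv A = mat 1"
proof -
  have "iv A \<in> \<Gamma> \<and> iv A ** A = mat 1 \<and> A ** iv A = mat 1"
    unfolding iv_def by (rule someI_ex) (metis lorentz_inverse[OF sub assms])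
  then show "iv A \<in> \<Gamma>" "iv A ** A = mat 1" "A ** iv A = mat 1" by auto
qed

lemma act_iv:
  assumes "A \<in> \<Gamma>" "x \<in> hyp"
  shows "act (iv A) (act A x) = x" "act A (act (iv A) x) = x"
  using act_comp[OF iv(1)[OF assms(1)] assms] act_comp[OF assms(1) iv(1)[OF assms(1)] assms(2)]
  by (simp_all add: iv[OF assms(1)] act_one assms(2))

lemma countable_group: "countable \<Gamma>"
proof -
  have o: "hpt 0 \<in> hyp" by simp
  have "A \<in> (\<Union>n :: nat. near (real n))" if "A \<in> \<Gamma>" for A
  proof -
    obtain n where n: "max (hpt 0 $ None) (act A (hpt 0) $ None) \<le> real n" using real_arch_simple by blast
    then have "A \<in> near (real n)" unfolding near_def using that o by (auto intro!: bexI[of _ "hpt 0"])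
    then show ?thesis by blast
  qed
  then have "\<Gamma> \<subseteq> (\<Union>n :: nat. near (real n))" by blast
  then show ?thesis by (rule countable_subset) (rule countable_UN; simp add: countable_finite)
qed

lemma act_eq_imp_eq:
  assumes "A \<in> \<Gamma>" "B \<in> \<Gamma>" "x \<in> hyp" "act A x = act B x"
  shows "A = B"
proof -
  have "act (iv B ** A) x = x"
    using assms act_comp[OF iv(1)[OF assms(2)] assms(1,3)] by (simp add: act_iv)
  then have "iv B ** A = mat 1" using free mult_in iv(1) assms by blast
  then show ?thesis by (metis iv(3)[OF assms(2)] matrix_mul_assoc matrix_mul_lid matrix_mul_rid)
qed

text \<open>Only the finitely many elements of \<open>near (x $ None + 1)\<close> can return a point
  of the unit ball around \<open>x\<close> to that ball. By freeness each of them except the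
  identity moves \<open>x\<close>, so a small enough ball is disjoint from all its
  translates.\<close>

lemma slice:
  assumes x: "x \<in> hyp"
  obtains U where "open U" "x \<in> U"
    "\<And>A y. A \<in> \<Gamma> \<Longrightarrow> y \<in> hyp \<Longrightarrow> y \<in> U \<Longrightarrow> act A y \<in> U \<Longrightarrow> A = mat 1"
proof -
  define S where "S = near (x $ None + 1) - {mat 1}"
  have "\<exists>e>0. \<forall>y\<in>hyp. dist y x < e \<longrightarrow> e \<le> dist (act A y) x" if "A \<in> S" for A
  proof -
    have A: "A \<in> \<Gamma>" "A \<noteq> mat 1" using that by (auto simp: S_def near_def)
    define D where "D = dist (act A x) x"
    have D: "0 < D" using free[OF A(1) x] A(2) by (auto simp: D_def)
    obtain d where d: "0 < d" "\<And>y. y \<in> hyp \<Longrightarrow> dist y x < d \<Longrightarrow> dist (act A y) (act A x) < D / 2"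
      using continuous_on_act[OF carr[OF A(1)]] x D unfolding continuous_on_iff by (metis half_gt_zero)
    have "min d (D / 2) \<le> dist (act A y) x" if "y \<in> hyp" "dist y x < min d (D / 2)" for y
    proof -
      have "D \<le> dist (act A y) (act A x) + dist (act A y) x"
        unfolding D_def by (metis dist_commute dist_triangle)
      then show ?thesis using d(2)[of y] that by auto
    qed
    then show ?thesis using d(1) D by (intro exI[of _ "min d (D / 2)"]) auto
  qed
  then obtain e where e: "\<And>A. A \<in> S \<Longrightarrow> 0 < e A"
    "\<And>A y. A \<in> S \<Longrightarrow> y \<in> hyp \<Longrightarrow> dist y x < e A \<Longrightarrow> e A \<le> dist (act A y) x"
    by metis
  \<comment> \<open>The inserted 1 makes the minimum exist when \<open>S\<close> is empty and keeps
    the ball inside the region of time at most \<open>x $ None + 1\<close>, where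
    \<open>near\<close> sees every returning element.\<close>
  define r where "r = Min (insert 1 (e ` S))"
  have fin: "finite (insert 1 (e ` S))" by (simp add: S_def)
  have r: "0 < r" "r \<le> 1" "\<And>A. A \<in> S \<Longrightarrow> r \<le> e A"
    unfolding r_def using fin e(1) by (auto intro!: Min_le)
  show thesis
  proof (rule that[of "ball x r"])
    fix A y assume *: "A \<in> \<Gamma>" "y \<in> hyp" "y \<in> ball x r" "act A y \<in> ball x r"
    have c: "\<bar>z $ None - x $ None\<bar> \<le> dist z x" for z
      using component_le_norm_cart[of "z - x" None] by (simp add: dist_norm)
    have "A \<in> near (x $ None + 1)"
      using * c[of y] c[of "act A y"] r(2) unfolding near_def by (auto simp: dist_commute intro!: bexI[of _ y])
    moreover have "A \<notin> S"
    proof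
      assume "A \<in> S"
      then show False using e(2)[of A y] r(3)[of A] * by (auto simp: dist_commute)
    qed
    ultimately show "A = mat 1" by (simp add: S_def)
  qed (use r in auto)
qed

text \<open>Cover \<open>hyp\<close> by countably many open slices \<open>u n\<close> and represent
  each orbit by its point in the first slice that it meets. There is only one such point, since no
  element but the identity maps a point of a slice into the same slice.\<close>

lemma fundamental_domain_exists: "\<exists>F. fundamental_domain \<Gamma> F"
proof -
  obtain \<B> :: "(real^'k option) set set" where B: "countable \<B>" "topological_basis \<B>"
    using ex_countable_basis by auto
  define \<G> where "\<G> = {U\<in>\<B>. \<forall>A\<in>\<Gamma>. \<forall>y\<in>hyp. y \<in> U \<longrightarrow> act A y \<in> U \<longrightarrow> A = mat 1}"
  have cover: "\<exists>U\<in>\<G>. x \<in> U" if xh: "x \<in> hyp" for x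
  proof -
    obtain U where U: "open U" "x \<in> U"
      "\<And>A y. A \<in> \<Gamma> \<Longrightarrow> y \<in> hyp \<Longrightarrow> y \<in> U \<Longrightarrow> act A y \<in> U \<Longrightarrow> A = mat 1"
      using slice[OF xh] by blast
    obtain V where "V \<in> \<B>" "x \<in> V" "V \<subseteq> U" using topological_basisE[OF B(2) U(1,2)] by metis
    then show ?thesis using U(3) unfolding \<G>_def by blast
  qed
  have cG: "countable \<G>" using B(1) unfolding \<G>_def by (rule countable_subset[rotated]) auto
  have nG: "\<G> \<noteq> {}" using cover[OF hpt_in_hyp[of 0]] by auto
  define u where "u = from_nat_into \<G>"
  have u: "u n \<in> \<G>" for n unfolding u_def by (rule from_nat_into[OF nG])
  have ucov: "\<exists>n. x \<in> u n" if "x \<in> hyp" for x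
    using cover[OF that] range_from_nat_into[OF nG cG] unfolding u_def by (metis imageE)
  have uG: "A = mat 1" if "A \<in> \<Gamma>" "y \<in> hyp" "y \<in> u n" "act A y \<in> u n" for A y n
    using u[of n] that unfolding \<G>_def by blast
  have [measurable]: "u n \<in> sets borel" for n
    using u[of n] topological_basis_open[OF B(2)] by (auto simp: \<G>_def)
  \<comment> \<open>The points whose orbit meets the slice \<open>u m\<close>; countability of the
    group keeps this Borel.\<close>
  define V where "V m = (\<Union>A\<in>\<Gamma>. act A -` u m)" for m
  define F where "F = hyp \<inter> (\<Union>n. u n - (\<Union>m\<in>{..<n}. V m))"
  have "act A -` u m \<in> sets borel" for A m
    using measurable_sets[OF borel_measurable_act[of A], of "u m"] by simp
  then have [measurable]: "V m \<in> sets borel" for m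
    unfolding V_def by (intro sets.countable_UN'' countable_group) auto
  have Fm: "F \<in> sets borel" unfolding F_def by measurable
  have "\<exists>!y. y \<in> F \<and> y \<in> orbit \<Gamma> x" if x: "x \<in> hyp" for x
  proof (rule ex_ex1I)
    define n where "n = (LEAST n. \<exists>A\<in>\<Gamma>. act A x \<in> u n)"
    have "\<exists>n. \<exists>A\<in>\<Gamma>. act A x \<in> u n"
      using ucov[OF x] one_in act_one[OF x] by metis
    then have "\<exists>A\<in>\<Gamma>. act A x \<in> u n" unfolding n_def by (rule LeastI_ex)
    then obtain A where A: "A \<in> \<Gamma>" "act A x \<in> u n" by blast
    have "act B (act A x) \<notin> u m" if "m < n" "B \<in> \<Gamma>" for m B
    proof
      assume "act B (act A x) \<in> u m"
      then have "\<exists>A\<in>\<Gamma>. act A x \<in> u m" using mult_in[OF that(2) A(1)] act_comp[OF that(2) A(1) x] by metis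
      then have "n \<le> m" unfolding n_def by (rule Least_le)
      with that show False by simp
    qed
    then show "\<exists>y. y \<in> F \<and> y \<in> orbit \<Gamma> x"
      using A x unfolding F_def V_def orbit_def by (intro exI[of _ "act A x"]) (auto intro: act_hyp)
    fix y z assume y: "y \<in> F \<and> y \<in> orbit \<Gamma> x" and z: "z \<in> F \<and> z \<in> orbit \<Gamma> x"
    have hyp: "y \<in> hyp" "z \<in> hyp" using y z by (auto simp: F_def)
    obtain A B where AB: "A \<in> \<Gamma>" "B \<in> \<Gamma>" "y = act A x" "z = act B x"
      using y z by (auto simp: orbit_def)
    obtain i where i: "y \<in> u i" "\<And>m A. m < i \<Longrightarrow> A \<in> \<Gamma> \<Longrightarrow> act A y \<notin> u m"
      using y by (auto simp: F_def V_def)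
    obtain j where j: "z \<in> u j" "\<And>m A. m < j \<Longrightarrow> A \<in> \<Gamma> \<Longrightarrow> act A z \<notin> u m"
      using z by (auto simp: F_def V_def)
    define C where "C = B ** iv A"
    have C: "C \<in> \<Gamma>" "act C y = z"
      unfolding C_def AB using AB(1,2) x by (auto intro: mult_in iv(1) simp: act_comp iv(1) act_hyp act_iv)
    then have C': "act (iv C) z = y" using act_iv(1)[OF C(1) hyp(1)] by simp
    \<comment> \<open>Both indices are the first slice met by the common orbit of \<open>y\<close>
      and \<open>z\<close>.\<close>
    have "i = j"
      using i(2)[of j C] j(2)[of i "iv C"] i(1) j(1) C C' iv(1)[OF C(1)] by (metis linorder_neqE_nat)
    then have "C = mat 1" using uG[OF C(1) hyp(1), of i] i(1) j(1) C(2) by simp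
    then show "y = z" using C(2) act_one[OF hyp(1)] by simp
  qed
  then have "fundamental_domain \<Gamma> F" using Fm unfolding fundamental_domain_def by (auto simp: F_def)
  then show ?thesis by blast
qed

definition fd :: "(real^'k option) set" where "fd = (SOME F. fundamental_domain \<Gamma> F)"

lemma fd: "fundamental_domain \<Gamma> fd"
  unfolding fd_def by (rule someI_ex[OF fundamental_domain_exists])

lemma sets_fd [measurable]: "fd \<in> sets borel" and fd_hyp: "fd \<subseteq> hyp"
  using fd by (auto simp: fundamental_domain_def)

lemma nn_integral_act:
  assumes [measurable]: "g \<in> borel_measurable borel" and A: "A \<in> \<Gamma>"
  shows "(\<integral>\<^sup>+x. g (act A x) \<partial>hyp_measure) = (\<integral>\<^sup>+x. g x \<partial>hyp_measure)"
  by (subst (2) hyp_measure_invariant[OF carr[OF A], symmetric], subst nn_integral_distr) auto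

lemma nn_integral_hyp_cong:
  assumes [measurable]: "f \<in> borel_measurable borel" "g \<in> borel_measurable borel"
    and "\<And>x. x \<in> hyp \<Longrightarrow> f x = g x"
  shows "(\<integral>\<^sup>+x. f x \<partial>hyp_measure) = (\<integral>\<^sup>+x. g x \<partial>hyp_measure)"
  using assms(3) by (simp add: nn_integral_hyp_measure)

lemma borel_measurable_nn_integral_group:
  fixes f :: "_ \<Rightarrow> 'b \<Rightarrow> ennreal"
  assumes [measurable]: "\<And>A. f A \<in> borel_measurable M"
  shows "(\<lambda>x. \<integral>\<^sup>+A. f A x \<partial>count_space \<Gamma>) \<in> borel_measurable M"
proof -
  interpret sigma_finite_measure "count_space \<Gamma>"
    using countable_group by (rule sigma_finite_measure_count_space_countable)
  have "(\<lambda>(A, x). f A x) \<in> borel_measurable (count_space \<Gamma> \<Otimes>\<^sub>M M)"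
    by (rule measurable_pair_measure_countable1[OF countable_group]) simp
  then have "(\<lambda>(x, A). f A x) \<in> borel_measurable (M \<Otimes>\<^sub>M count_space \<Gamma>)"
    by (subst measurable_pair_swap_iff) (simp add: case_prod_beta')
  then show ?thesis by (rule borel_measurable_nn_integral)
qed

text \<open>The translates of \<open>fd\<close> tile \<open>hyp\<close>. Exchange sum and integral,
  move each translation from \<open>g\<close> to the indicator by invariance of the measure, and use
  that exactly one translate contains a given point.\<close>

lemma unfolding_nn_integral:
  assumes [measurable]: "g \<in> borel_measurable borel"
  shows "(\<integral>\<^sup>+x. g x \<partial>hyp_measure) =
    (\<integral>\<^sup>+x. indicator fd x * (\<integral>\<^sup>+A. g (act A x) \<partial>count_space \<Gamma>) \<partial>hyp_measure)"
proof -
  have "(\<integral>\<^sup>+x. indicator fd x * (\<integral>\<^sup>+A. g (act A x) \<partial>count_space \<Gamma>) \<partial>hyp_measure) =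
     (\<integral>\<^sup>+x. (\<integral>\<^sup>+A. indicator fd x * g (act A x) \<partial>count_space \<Gamma>) \<partial>hyp_measure)"
    by (subst nn_integral_cmult) auto
  also have "\<dots> = (\<integral>\<^sup>+A. (\<integral>\<^sup>+x. indicator fd x * g (act A x) \<partial>hyp_measure) \<partial>count_space \<Gamma>)"
    by (intro nn_integral_count_space_nn_integral countable_group) measurable
  also have "\<dots> = (\<integral>\<^sup>+A. (\<integral>\<^sup>+x. indicator fd (act (iv A) x) * g x \<partial>hyp_measure) \<partial>count_space \<Gamma>)"
  proof (rule nn_integral_cong)
    fix A assume "A \<in> space (count_space \<Gamma>)"
    then have A: "A \<in> \<Gamma>" by simp
    have "(\<integral>\<^sup>+x. indicator fd (act (iv A) x) * g x \<partial>hyp_measure) =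
      (\<integral>\<^sup>+x. indicator fd (act (iv A) (act A x)) * g (act A x) \<partial>hyp_measure)"
      by (rule nn_integral_act[OF _ A, symmetric]) measurable
    also have "\<dots> = (\<integral>\<^sup>+x. indicator fd x * g (act A x) \<partial>hyp_measure)"
      by (rule nn_integral_hyp_cong) (auto simp: act_iv A)
    finally show "(\<integral>\<^sup>+x. indicator fd x * g (act A x) \<partial>hyp_measure) =
      (\<integral>\<^sup>+x. indicator fd (act (iv A) x) * g x \<partial>hyp_measure)" by simp
  qed
  also have "\<dots> = (\<integral>\<^sup>+x. (\<integral>\<^sup>+A. indicator fd (act (iv A) x) * g x \<partial>count_space \<Gamma>) \<partial>hyp_measure)"
    by (rule nn_integral_count_space_nn_integral[symmetric, OF countable_group]) measurable
  also have "\<dots> = (\<integral>\<^sup>+x. g x \<partial>hyp_measure)"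
  proof (rule nn_integral_hyp_cong[OF _ assms])
    show "(\<lambda>x. \<integral>\<^sup>+A. indicator fd (act (iv A) x) * g x \<partial>count_space \<Gamma>) \<in> borel_measurable borel"
      by (rule borel_measurable_nn_integral_group) measurable
  next
    fix y :: "real^'k option" assume y: "y \<in> hyp"
    obtain z where z: "z \<in> fd" "z \<in> orbit \<Gamma> y" "\<And>z'. z' \<in> fd \<Longrightarrow> z' \<in> orbit \<Gamma> y \<Longrightarrow> z' = z"
      using fd y unfolding fundamental_domain_def by metis
    obtain C where C: "C \<in> \<Gamma>" "z = act C y" using z(2) by (auto simp: orbit_def)
    \<comment> \<open>\<open>C\<close> carries \<open>y\<close> to the representative of its orbit;
      by freeness only its inverse indexes a translate of \<open>fd\<close> that contains
      \<open>y\<close>.\<close>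
    have one: "A \<in> {iv C}" if "A \<in> \<Gamma>" "act (iv A) y \<in> fd" for A
    proof -
      have "act (iv A) y = act C y" using z(3)[OF that(2)] that(1) iv(1) C(2) by (auto simp: orbit_def)
      then have "iv A = C" using act_eq_imp_eq iv(1) that(1) C(1) y by blast
      then have "C ** A = mat 1" using iv(2)[OF that(1)] by simp
      then show ?thesis using iv(2)[OF C(1)] by (metis matrix_mul_assoc matrix_mul_lid matrix_mul_rid singletonI)
    qed
    have "iv (iv C) = C"
      using iv[OF C(1)] iv[OF iv(1)[OF C(1)]] by (metis matrix_mul_assoc matrix_mul_lid matrix_mul_rid)
    then have in_fd: "act (iv (iv C)) y \<in> fd" using z(1) C(2) by simp
    have "indicator fd (act (iv A) y) * g y = g y * indicator {iv C} A" if "A \<in> \<Gamma>" for A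
    proof (cases "A = iv C")
      case True
      then show ?thesis using in_fd by simp
    next
      case False
      then have "act (iv A) y \<notin> fd" using one[OF that] by blast
      with False show ?thesis by simp
    qed
    then have "(\<integral>\<^sup>+A. indicator fd (act (iv A) y) * g y \<partial>count_space \<Gamma>) =
      (\<integral>\<^sup>+A. g y * indicator {iv C} A \<partial>count_space \<Gamma>)"
      by (intro nn_integral_cong) simp
    also have "\<dots> = g y"
      using iv(1)[OF C(1)] by (subst nn_integral_cmult) (auto simp: emeasure_count_space)
    finally show "(\<integral>\<^sup>+A. indicator fd (act (iv A) y) * g y \<partial>count_space \<Gamma>) = g y" .
  qed
  finally show ?thesis by simp
qed

section \<open>The quotient as a measure space\<close>

lemma topspace_orbit: "topspace (orbit_topology \<Gamma>) = orbit_space \<Gamma>"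
proof -
  have "\<Union>(orbit_space \<Gamma>) = hyp"
  proof
    show "\<Union>(orbit_space \<Gamma>) \<subseteq> hyp" by (auto simp: orbit_space_def orbit_def intro: act_hyp)
    show "hyp \<subseteq> \<Union>(orbit_space \<Gamma>)"
      using one_in act_one unfolding orbit_space_def orbit_def by (force simp: image_iff)
  qed
  then have "openin (orbit_topology \<Gamma>) (orbit_space \<Gamma>)"
    unfolding openin_orbit_topology[OF sub] by simp
  then show ?thesis
    using openin_orbit_topology[OF sub] unfolding topspace_def by (metis (no_types, lifting) Sup_upper
      Sup_least mem_Collect_eq subset_antisym)
qed

lemma mem_self_orbit: "x \<in> hyp \<Longrightarrow> x \<in> orbit \<Gamma> x"
  unfolding orbit_def using one_in act_one by (metis image_eqI)

lemma orbit_vimage: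
  assumes "U \<subseteq> orbit_space \<Gamma>" "x \<in> hyp"
  shows "orbit \<Gamma> x \<in> U \<longleftrightarrow> x \<in> \<Union>U"
proof
  assume "x \<in> \<Union>U"
  then obtain c where c: "c \<in> U" "x \<in> c" by blast
  then obtain y where "y \<in> hyp" "c = orbit \<Gamma> y" using assms by (auto simp: orbit_space_def)
  then show "orbit \<Gamma> x \<in> U" using mem_orbit_iff[OF sub, of y x] c by simp
qed (use mem_self_orbit[OF assms(2)] in blast)

lemma space_borel_orbit: "space (borel_of (orbit_topology \<Gamma>)) = orbit_space \<Gamma>"
  by (auto simp: borel_of_def topspace_orbit space_measure_of_conv)

text \<open>Orbits of points outside \<open>hyp\<close> are not points of the quotient, so
  \<open>orbit \<Gamma>\<close> can only be composed with maps into \<open>hyp\<close>. This is why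
  \<open>hpt v\<close> and \<open>hpt (chart x)\<close> occur as arguments in what follows.\<close>

lemma measurable_orbit:
  assumes S: "S \<subseteq> hyp" and [measurable]: "f \<in> borel_measurable M" and fS: "\<And>x. x \<in> space M \<Longrightarrow> f x \<in> S"
  shows "(\<lambda>x. orbit \<Gamma> (f x)) \<in> measurable M (borel_of (orbit_topology \<Gamma>))"
  unfolding borel_of_def
proof (rule measurable_measure_of)
  show "{U. openin (orbit_topology \<Gamma>) U} \<subseteq> Pow (topspace (orbit_topology \<Gamma>))"
    by (auto dest: openin_subset)
  show "(\<lambda>x. orbit \<Gamma> (f x)) \<in> space M \<rightarrow> topspace (orbit_topology \<Gamma>)"
    using fS S unfolding topspace_orbit orbit_space_def by blast
  fix U assume "U \<in> {U. openin (orbit_topology \<Gamma>) U}"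
  then have U: "U \<subseteq> orbit_space \<Gamma>" "openin (top_of_set hyp) (\<Union>U)" by (simp_all add: openin_orbit_topology[OF sub])
  then obtain T where T: "open T" "\<Union>U = hyp \<inter> T" by (auto simp: openin_open)
  have "(\<lambda>x. orbit \<Gamma> (f x)) -` U \<inter> space M = f -` T \<inter> space M"
  proof -
    have "orbit \<Gamma> (f x) \<in> U \<longleftrightarrow> f x \<in> T" if "x \<in> space M" for x
    proof -
      have "f x \<in> hyp" using fS[OF that] S by blast
      then show ?thesis using orbit_vimage[OF U(1)] T(2) by (metis IntD2 IntI)
    qed
    then show ?thesis by auto
  qed
  also have "\<dots> \<in> sets M" using T(1) by measurable
  finally show "(\<lambda>x. orbit \<Gamma> (f x)) -` U \<inter> space M \<in> sets M" .
qed

lemma measurable_orbit_hpt [measurable]: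
  "(\<lambda>v. orbit \<Gamma> (hpt v)) \<in> measurable borel (borel_of (orbit_topology \<Gamma>))"
  by (rule measurable_orbit[where S = hyp]) auto

lemma measurable_orbit_hpt_chart [measurable]:
  "(\<lambda>x. orbit \<Gamma> (hpt (chart x))) \<in> measurable borel (borel_of (orbit_topology \<Gamma>))"
  by (rule measurable_orbit[where S = hyp]) auto

lemma measurable_from_orbit:
  fixes h :: "_ \<Rightarrow> 'b::topological_space"
  assumes "continuous_on UNIV (\<lambda>v. h (orbit \<Gamma> (hpt v)))"
  shows "h \<in> borel_measurable (borel_of (orbit_topology \<Gamma>))"
proof (rule borel_measurableI)
  fix S :: "'b set" assume S: "open S"
  define U where "U = h -` S \<inter> orbit_space \<Gamma>"
  have "\<Union>U = hyp \<inter> chart -` ((\<lambda>v. h (orbit \<Gamma> (hpt v))) -` S)"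
  proof (intro Set.set_eqI)
    fix x
    have 1: "x \<in> hyp" if "x \<in> \<Union>U" using that by (auto simp: U_def orbit_space_def orbit_def intro: act_hyp)
    have 2: "orbit \<Gamma> x \<in> U \<longleftrightarrow> x \<in> \<Union>U" if "x \<in> hyp"
      using that by (intro orbit_vimage) (auto simp: U_def)
    have 3: "orbit \<Gamma> x \<in> U \<longleftrightarrow> h (orbit \<Gamma> (hpt (chart x))) \<in> S" if "x \<in> hyp"
      using that by (auto simp: U_def orbit_space_def hpt_chart)
    show "x \<in> \<Union>U \<longleftrightarrow> x \<in> hyp \<inter> chart -` ((\<lambda>v. h (orbit \<Gamma> (hpt v))) -` S)"
      unfolding Int_iff vimage_eq using 1 2 3 by metis
  qed
  moreover have "open (chart -` ((\<lambda>v. h (orbit \<Gamma> (hpt v))) -` S))"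
    using S assms continuous_on_chart by (intro open_vimage) (auto intro: open_vimage)
  ultimately have "openin (orbit_topology \<Gamma>) U"
    unfolding openin_orbit_topology[OF sub] by (auto simp: U_def openin_open)
  then have "U \<in> sets (borel_of (orbit_topology \<Gamma>))"
    unfolding borel_of_def by (subst sets_measure_of) (auto dest: openin_subset)
  then show "h -` S \<inter> space (borel_of (orbit_topology \<Gamma>)) \<in> sets (borel_of (orbit_topology \<Gamma>))"
    by (simp add: space_borel_orbit U_def)
qed

lemma sets_orbit_measure [measurable_cong]: "sets (orbit_measure \<Gamma>) = sets (borel_of (orbit_topology \<Gamma>))"
  by (simp add: orbit_measure_def)

text \<open>\<open>hpt (chart x)\<close> equals \<open>x\<close> on \<open>fd\<close>; elsewhere it
  retracts to \<open>hyp\<close>, which makes the integrand measurable on all of Minkowski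
  space.\<close>

lemma nn_integral_orbit_measure:
  assumes [measurable]: "G \<in> borel_measurable (borel_of (orbit_topology \<Gamma>))"
  shows "(\<integral>\<^sup>+c. G c \<partial>orbit_measure \<Gamma>) =
    (\<integral>\<^sup>+x. indicator fd x * G (orbit \<Gamma> (hpt (chart x))) \<partial>hyp_measure)"
proof -
  have [measurable]: "orbit \<Gamma> \<in> measurable (restrict_space hyp_measure fd) (borel_of (orbit_topology \<Gamma>))"
    by (rule measurable_orbit[OF fd_hyp, where f = "\<lambda>x. x", simplified])
       (auto simp: space_restrict_space intro!: measurable_restrict_space1)
  have "(\<integral>\<^sup>+c. G c \<partial>orbit_measure \<Gamma>) = (\<integral>\<^sup>+x. G (orbit \<Gamma> x) \<partial>restrict_space hyp_measure fd)"
    unfolding orbit_measure_def fd_def[symmetric] by (simp add: nn_integral_distr)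
  also have "\<dots> = (\<integral>\<^sup>+x. G (orbit \<Gamma> x) * indicator fd x \<partial>hyp_measure)"
    by (subst nn_integral_restrict_space) simp_all
  also have "\<dots> = (\<integral>\<^sup>+x. indicator fd x * G (orbit \<Gamma> (hpt (chart x))) \<partial>hyp_measure)"
    by (intro nn_integral_cong) (auto split: split_indicator simp: hpt_chart[OF subsetD[OF fd_hyp]])
  finally show ?thesis .
qed

lemma orbit_act: "A \<in> \<Gamma> \<Longrightarrow> x \<in> hyp \<Longrightarrow> orbit \<Gamma> (act A x) = orbit \<Gamma> x"
  by (rule mem_orbit_iff[OF sub]) (auto simp: orbit_def)

text \<open>After unfolding, the invariant factor \<open>G\<close> leaves the sum over the group,
  and only the orbit sum of the weight \<open>p\<close> remains. Two weights matter: a partition of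
  unity, with orbit sum 1, and the indicator of a ball, whose orbit sum counts returns.\<close>

lemma unfolding_orbit:
  assumes [measurable]: "G \<in> borel_measurable (borel_of (orbit_topology \<Gamma>))" "p \<in> borel_measurable borel"
  shows "(\<integral>\<^sup>+v. ennreal (hdensity v) * (p (hpt v) * G (orbit \<Gamma> (hpt v))) \<partial>lborel) =
    (\<integral>\<^sup>+x. (\<integral>\<^sup>+A. p (act A x) \<partial>count_space \<Gamma>) * (indicator fd x * G (orbit \<Gamma> (hpt (chart x)))) \<partial>hyp_measure)"
proof -
  have "(\<integral>\<^sup>+v. ennreal (hdensity v) * (p (hpt v) * G (orbit \<Gamma> (hpt v))) \<partial>lborel) =
    (\<integral>\<^sup>+x. p x * G (orbit \<Gamma> (hpt (chart x))) \<partial>hyp_measure)"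
    by (subst nn_integral_hyp_measure) simp_all
  also have "\<dots> = (\<integral>\<^sup>+x. indicator fd x * (\<integral>\<^sup>+A. p (act A x) * G (orbit \<Gamma> (hpt (chart (act A x))))
      \<partial>count_space \<Gamma>) \<partial>hyp_measure)"
    by (rule unfolding_nn_integral) measurable
  also have "\<dots> = (\<integral>\<^sup>+x. (\<integral>\<^sup>+A. p (act A x) \<partial>count_space \<Gamma>) *
      (indicator fd x * G (orbit \<Gamma> (hpt (chart x)))) \<partial>hyp_measure)"
  proof (rule nn_integral_hyp_cong)
    fix x :: "real^'k option" assume x: "x \<in> hyp"
    have "(\<integral>\<^sup>+A. p (act A x) * G (orbit \<Gamma> (hpt (chart (act A x)))) \<partial>count_space \<Gamma>) =
      (\<integral>\<^sup>+A. p (act A x) * G (orbit \<Gamma> (hpt (chart x))) \<partial>count_space \<Gamma>)"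
      using x by (intro nn_integral_cong) (simp add: hpt_chart act_hyp orbit_act)
    also have "\<dots> = (\<integral>\<^sup>+A. p (act A x) \<partial>count_space \<Gamma>) * G (orbit \<Gamma> (hpt (chart x)))"
      by (rule nn_integral_multc) simp
    finally show "indicator fd x * (\<integral>\<^sup>+A. p (act A x) * G (orbit \<Gamma> (hpt (chart (act A x)))) \<partial>count_space \<Gamma>) =
      (\<integral>\<^sup>+A. p (act A x) \<partial>count_space \<Gamma>) * (indicator fd x * G (orbit \<Gamma> (hpt (chart x))))"
      by (simp add: mult_ac)
  next
    show "(\<lambda>x. indicator fd x * (\<integral>\<^sup>+A. p (act A x) * G (orbit \<Gamma> (hpt (chart (act A x)))) \<partial>count_space \<Gamma>)) \<in> borel_measurable borel"
      by (intro borel_measurable_times_ennreal borel_measurable_nn_integral_group) measurable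
    show "(\<lambda>x. (\<integral>\<^sup>+A. p (act A x) \<partial>count_space \<Gamma>) * (indicator fd x * G (orbit \<Gamma> (hpt (chart x))))) \<in> borel_measurable borel"
      by (intro borel_measurable_times_ennreal borel_measurable_nn_integral_group) measurable
  qed
  finally show ?thesis .
qed

text \<open>A weight with orbit sum 1 can replace the indicator of the fundamental domain. Unlike
  that indicator it may be taken twice differentiable.\<close>

lemma orbit_measure_eq_distr:
  assumes [measurable]: "p \<in> borel_measurable borel"
    and p: "\<And>x. x \<in> hyp \<Longrightarrow> (\<integral>\<^sup>+A. ennreal (p (act A x)) \<partial>count_space \<Gamma>) = 1"
  shows "orbit_measure \<Gamma> = distr (density lborel (\<lambda>v. ennreal (hdensity v) * ennreal (p (hpt v))))
    (borel_of (orbit_topology \<Gamma>)) (\<lambda>v. orbit \<Gamma> (hpt v))" (is "_ = ?N")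
proof (rule measure_eqI)
  show "sets (orbit_measure \<Gamma>) = sets ?N" by (simp add: sets_orbit_measure)
  fix E assume "E \<in> sets (orbit_measure \<Gamma>)"
  then have E [measurable]: "E \<in> sets (borel_of (orbit_topology \<Gamma>))" by (simp add: sets_orbit_measure)
  have "emeasure ?N E = (\<integral>\<^sup>+c. indicator E c \<partial>?N)" using E by simp
  also have "\<dots> = (\<integral>\<^sup>+v. ennreal (hdensity v) * (ennreal (p (hpt v)) * indicator E (orbit \<Gamma> (hpt v))) \<partial>lborel)"
    by (subst nn_integral_distr, simp_all) (subst nn_integral_density, simp_all add: mult.assoc)
  also have "\<dots> = (\<integral>\<^sup>+x. (\<integral>\<^sup>+A. ennreal (p (act A x)) \<partial>count_space \<Gamma>) *
      (indicator fd x * indicator E (orbit \<Gamma> (hpt (chart x)))) \<partial>hyp_measure)"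
    by (rule unfolding_orbit) measurable
  also have "\<dots> = (\<integral>\<^sup>+x. indicator fd x * indicator E (orbit \<Gamma> (hpt (chart x))) \<partial>hyp_measure)"
    by (intro nn_integral_cong) (use fd_hyp p in \<open>auto split: split_indicator\<close>)
  also have "\<dots> = (\<integral>\<^sup>+c. indicator E c \<partial>orbit_measure \<Gamma>)"
    by (rule nn_integral_orbit_measure[symmetric]) measurable
  also have "\<dots> = emeasure (orbit_measure \<Gamma>) E" by (simp add: sets_orbit_measure E)
  finally show "emeasure (orbit_measure \<Gamma>) E = emeasure ?N E" by simp
qed

text \<open>The bound must not depend on \<open>x\<close>. Fix one element \<open>B\<close> that
  brings \<open>x\<close> into the ball: then \<open>A ** iv B\<close> moves a point of the ball to
  a point of the ball, and \<open>A\<close> is determined by it.\<close>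

lemma card_return_le:
  assumes x: "x \<in> hyp"
  shows "finite {A\<in>\<Gamma>. act A x $ None \<le> R} \<and> card {A\<in>\<Gamma>. act A x $ None \<le> R} \<le> card (near R)"
    (is "finite ?S \<and> _")
proof (cases "?S = {}")
  case False
  then obtain B where B: "B \<in> \<Gamma>" "act B x $ None \<le> R" by blast
  have img: "(\<lambda>A. A ** iv B) ` ?S \<subseteq> near R"
  proof
    fix C assume "C \<in> (\<lambda>A. A ** iv B) ` ?S"
    then obtain A where A: "A \<in> \<Gamma>" "act A x $ None \<le> R" "C = A ** iv B" by blast
    have "act C (act B x) = act A x"
      unfolding A(3) using A(1) B(1) x by (simp add: act_comp iv(1) act_hyp act_iv)
    then show "C \<in> near R" unfolding near_def
      using A B x mult_in[OF A(1) iv(1)[OF B(1)]] by (auto intro!: bexI[of _ "act B x"] act_hyp)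
  qed
  have inj: "inj_on (\<lambda>A. A ** iv B) ?S"
    by (rule inj_onI) (metis iv(2)[OF B(1)] matrix_mul_assoc matrix_mul_rid)
  show ?thesis
    by (rule conjI[OF inj_on_finite[OF inj img finite_near] card_inj_on_le[OF inj img finite_near]])
next
  case True
  show ?thesis unfolding True by simp
qed

lemma nn_integral_ball_le:
  assumes [measurable]: "G \<in> borel_measurable (borel_of (orbit_topology \<Gamma>))"
  shows "(\<integral>\<^sup>+v. ennreal (hdensity v) * (indicator {..R} (hpt v $ None) * G (orbit \<Gamma> (hpt v))) \<partial>lborel)
    \<le> of_nat (card (near R)) * (\<integral>\<^sup>+c. G c \<partial>orbit_measure \<Gamma>)"
proof -
  have [measurable]: "(\<lambda>x :: real^'k option. x $ None) \<in> borel_measurable borel"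
    by (intro borel_measurable_continuous_onI continuous_intros)
  have count: "(\<integral>\<^sup>+A. indicator {..R} (act A x $ None) \<partial>count_space \<Gamma>) \<le> of_nat (card (near R))"
    if x: "x \<in> hyp" for x
  proof -
    define S where "S = {A\<in>\<Gamma>. act A x $ None \<le> R}"
    have "finite S \<and> card S \<le> card (near R)" unfolding S_def by (rule card_return_le[OF x])
    moreover have "(\<integral>\<^sup>+A. indicator {..R} (act A x $ None) \<partial>count_space \<Gamma>) =
        (\<integral>\<^sup>+A. indicator S A \<partial>count_space \<Gamma>)"
      by (intro nn_integral_cong) (auto simp: S_def split: split_indicator)
    moreover have "S \<subseteq> \<Gamma>" by (auto simp: S_def)
    ultimately show ?thesis by (simp add: emeasure_count_space)
  qed
  have "(\<integral>\<^sup>+v. ennreal (hdensity v) * (indicator {..R} (hpt v $ None) * G (orbit \<Gamma> (hpt v))) \<partial>lborel) =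
    (\<integral>\<^sup>+x. (\<integral>\<^sup>+A. indicator {..R} (act A x $ None) \<partial>count_space \<Gamma>) *
      (indicator fd x * G (orbit \<Gamma> (hpt (chart x)))) \<partial>hyp_measure)"
    by (rule unfolding_orbit[where p = "\<lambda>x. indicator {..R} (x $ None)"]) measurable
  also have "\<dots> \<le> (\<integral>\<^sup>+x. of_nat (card (near R)) * (indicator fd x * G (orbit \<Gamma> (hpt (chart x)))) \<partial>hyp_measure)"
    by (intro nn_integral_mono) (use fd_hyp count in \<open>auto split: split_indicator intro!: mult_right_mono\<close>)
  also have "\<dots> = of_nat (card (near R)) * (\<integral>\<^sup>+c. G c \<partial>orbit_measure \<Gamma>)"
    by (subst nn_integral_cmult) (simp_all add: nn_integral_orbit_measure)
  finally show ?thesis .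
qed

end

subsection \<open>Differentiability in coordinates\<close>

lemma pd_eq:
  assumes "(f has_derivative f') (at v)"
  shows "pd i f v = f' (axis i 1)"
  unfolding pd_def using frechet_derivative_at[OF assms] by simp

lemma has_derivative_frechet:
  "f differentiable (at v) \<Longrightarrow> (f has_derivative frechet_derivative f (at v)) (at v)"
  using frechet_derivative_works by blast

lemma pd_const [simp]: "pd i (\<lambda>_. c) v = 0"
  by (subst pd_eq[OF has_derivative_const]) simp

lemma pd_add:
  assumes "f differentiable (at v)" "g differentiable (at v)"
  shows "pd i (\<lambda>v. f v + g v) v = pd i f v + pd i g v"
  by (subst pd_eq[OF has_derivative_add[OF assms[THEN has_derivative_frechet]]]) (simp add: pd_def)

lemma pd_diff:
  assumes "f differentiable (at v)" "g differentiable (at v)"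
  shows "pd i (\<lambda>v. f v - g v) v = pd i f v - pd i g v"
  by (subst pd_eq[OF has_derivative_diff[OF assms[THEN has_derivative_frechet]]]) (simp add: pd_def)

lemma pd_mult:
  assumes "f differentiable (at v)" "g differentiable (at v)"
  shows "pd i (\<lambda>v. f v * g v) v = pd i f v * g v + f v * pd i g v"
  by (subst pd_eq[OF has_derivative_mult[OF assms[THEN has_derivative_frechet]]]) (simp add: pd_def)

lemma pd_inverse:
  assumes "f differentiable (at v)" "f v \<noteq> 0"
  shows "pd i (\<lambda>v. inverse (f v)) v = - (pd i f v * (inverse (f v) * inverse (f v)))"
  by (subst pd_eq[OF Deriv.has_derivative_inverse[OF assms(2) has_derivative_frechet[OF assms(1)]]])
     (simp add: pd_def)

lemma has_derivative_coord:
  "((\<lambda>v. complex_of_real (v $ j)) has_derivative (\<lambda>h. complex_of_real (h $ j))) (at v)"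
  by (intro derivative_intros bounded_linear_imp_has_derivative bounded_linear_vec_nth)

lemma pd_coord: "pd i (\<lambda>v. complex_of_real (v $ j)) v = (if i = j then 1 else 0)"
  by (subst pd_eq[OF has_derivative_coord]) (auto simp: axis_def)

text \<open>\<open>pd\<close> and \<open>Ck\<close> are formulated for complex functions. The
  derivative of a real-valued one is real, so the real chain rule can be applied to its real
  part.\<close>

lemma has_derivative_of_real_compose:
  assumes g: "((\<lambda>v. complex_of_real (g v)) has_derivative G) (at v)"
    and h: "(h has_real_derivative d) (at (g v))"
  shows "((\<lambda>v. complex_of_real (h (g v))) has_derivative (\<lambda>x. complex_of_real d * G x)) (at v)"
proof -
  have g': "(g has_derivative (\<lambda>x. Re (G x))) (at v)"
    using has_derivative_Re[OF g] by simp
  have "((\<lambda>v. complex_of_real (g v)) has_derivative (\<lambda>x. complex_of_real (Re (G x)))) (at v)"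
    by (intro derivative_intros g')
  from has_derivative_unique[OF g this] have G: "complex_of_real (Re (G x)) = G x" for x by metis
  have "((\<lambda>v. h (g v)) has_derivative (\<lambda>x. d * Re (G x))) (at v)"
    using has_derivative_compose[OF g' h[unfolded has_field_derivative_def]] by simp
  then have "((\<lambda>v. complex_of_real (h (g v))) has_derivative (\<lambda>x. complex_of_real (d * Re (G x)))) (at v)"
    by (intro derivative_intros)
  then show ?thesis by (simp add: G)
qed

lemma pd_of_real_compose:
  assumes "(\<lambda>v. complex_of_real (g v)) differentiable (at v)" "(h has_real_derivative d) (at (g v))"
  shows "(\<lambda>v. complex_of_real (h (g v))) differentiable (at v)"
    "pd i (\<lambda>v. complex_of_real (h (g v))) v = complex_of_real d * pd i (\<lambda>v. complex_of_real (g v)) v"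
proof -
  note * = has_derivative_of_real_compose[OF has_derivative_frechet[OF assms(1)] assms(2)]
  show "(\<lambda>v. complex_of_real (h (g v))) differentiable (at v)"
    using * by (auto simp: differentiable_def)
  show "pd i (\<lambda>v. complex_of_real (h (g v))) v = complex_of_real d * pd i (\<lambda>v. complex_of_real (g v)) v"
    using pd_eq[OF *] by (simp add: pd_def)
qed

lemma Ck_SucI:
  assumes "\<And>v. f differentiable (at v)" "\<And>i. pd i f = g i" "\<And>i. Ck n (g i)"
  shows "Ck (Suc n) f"
  using assms by (simp add: differentiable_on_def)

lemma Ck_diff: "Ck (Suc n) f \<Longrightarrow> f differentiable (at v)"
  by (simp add: differentiable_on_def)

lemma Ck_pd: "Ck (Suc n) f \<Longrightarrow> Ck n (pd i f)"
  by simp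

lemma Ck_SucD: "Ck (Suc n) f \<Longrightarrow> Ck n f"
proof (induction n arbitrary: f)
  case 0
  then show ?case by (simp add: differentiable_imp_continuous_on)
next
  case (Suc n)
  show ?case
    by (rule Ck_SucI[OF Ck_diff[OF Suc.prems] refl Suc.IH[OF Ck_pd[OF Suc.prems]]])
qed

lemma Ck_mono: "Ck n f \<Longrightarrow> m \<le> n \<Longrightarrow> Ck m f"
  by (induction n) (auto simp: le_Suc_eq intro: Ck_SucD simp del: Ck.simps(2))

lemma Ck_cont: "Ck n f \<Longrightarrow> continuous_on UNIV f"
  using Ck_mono[of n f 0] by simp

lemma Ck_const [intro]: "Ck n (\<lambda>_. c)"
proof (induction n arbitrary: c)
  case (Suc n)
  show ?case by (rule Ck_SucI[where g = "\<lambda>_ _. 0"]) (simp_all add: fun_eq_iff Suc)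
qed simp

lemma Ck_add [intro]: "Ck n f \<Longrightarrow> Ck n g \<Longrightarrow> Ck n (\<lambda>v. f v + g v)"
proof (induction n arbitrary: f g)
  case 0
  then show ?case by (auto intro: continuous_intros)
next
  case (Suc n)
  note d = Ck_diff[OF Suc.prems(1)] Ck_diff[OF Suc.prems(2)]
  show ?case
    by (rule Ck_SucI[OF _ ext[OF pd_add[OF d]]])
       (intro differentiable_add d Suc.IH Ck_pd[OF Suc.prems(1)] Ck_pd[OF Suc.prems(2)])+
qed

lemma Ck_mult [intro]: "Ck n f \<Longrightarrow> Ck n g \<Longrightarrow> Ck n (\<lambda>v. f v * g v)"
proof (induction n arbitrary: f g)
  case 0
  then show ?case by (auto intro: continuous_intros)
next
  case (Suc n)
  note d = Ck_diff[OF Suc.prems(1)] Ck_diff[OF Suc.prems(2)]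
  show ?case
    by (rule Ck_SucI[OF _ ext[OF pd_mult[OF d]]])
       (intro differentiable_mult d Ck_add Suc.IH Ck_pd[OF Suc.prems(1)] Ck_pd[OF Suc.prems(2)]
        Ck_SucD[OF Suc.prems(1)] Ck_SucD[OF Suc.prems(2)])+
qed

lemma Ck_uminus [intro]: "Ck n f \<Longrightarrow> Ck n (\<lambda>v. - f v)"
  using Ck_mult[OF Ck_const[of n "-1"]] by simp

lemma Ck_minus [intro]: "Ck n f \<Longrightarrow> Ck n g \<Longrightarrow> Ck n (\<lambda>v. f v - g v)"
  using Ck_add[OF _ Ck_uminus] by simp

lemma Ck_sum [intro]: "(\<And>j. j \<in> J \<Longrightarrow> Ck n (f j)) \<Longrightarrow> Ck n (\<lambda>v. \<Sum>j\<in>J. f j v)"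
  by (induction J rule: infinite_finite_induct) (auto intro: Ck_const Ck_add)

lemma Ck_coord: "Ck n (\<lambda>v. complex_of_real (v $ j))"
proof (cases n)
  case (Suc m)
  have "(\<lambda>v. complex_of_real (v $ j)) differentiable (at v)" for v
    using has_derivative_coord by (auto simp: differentiable_def)
  then show ?thesis unfolding Suc by (rule Ck_SucI[OF _ ext[OF pd_coord]]) (rule Ck_const)
qed (auto intro: continuous_intros)

lemma Ck_inverse:
  assumes "\<And>v. f v \<noteq> 0" "Ck n f"
  shows "Ck n (\<lambda>v. inverse (f v))"
  using assms(2)
proof (induction n)
  case 0
  then show ?case using assms(1) by (auto intro: continuous_intros)
next
  case (Suc n)
  note d = Ck_diff[OF Suc.prems]
  note IH = Suc.IH[OF Ck_SucD[OF Suc.prems]]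
  have "(\<lambda>v. inverse (f v)) differentiable (at v)" for v
    using Deriv.has_derivative_inverse[OF assms(1) has_derivative_frechet[OF d]]
    by (auto simp: differentiable_def)
  then show ?case
    by (rule Ck_SucI[OF _ ext[OF pd_inverse[OF d assms(1)]]])
       (intro Ck_uminus Ck_mult Ck_pd[OF Suc.prems] IH)
qed

lemma Ck_sqrt:
  assumes "\<And>v. 0 < g v" "Ck n (\<lambda>v. complex_of_real (g v))"
  shows "Ck n (\<lambda>v. complex_of_real (sqrt (g v)))"
  using assms(2)
proof (induction n)
  case 0
  have "continuous_on UNIV (\<lambda>v. Re (complex_of_real (g v)))"
    using 0 by (intro continuous_intros) simp
  then show ?case by (auto intro!: continuous_intros)
next
  case (Suc n)
  note d = Ck_diff[OF Suc.prems]
  note IH = Suc.IH[OF Ck_SucD[OF Suc.prems]]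
  have D: "(sqrt has_real_derivative inverse (2 * sqrt (g v))) (at (g v))" for v
    using DERIV_real_sqrt[OF assms(1)[of v]] by (simp add: field_simps)
  note c = pd_of_real_compose[OF d D]
  have nz: "2 * complex_of_real (sqrt (g v)) \<noteq> 0" for v using assms(1)[of v] by simp
  have "Ck n (\<lambda>v. complex_of_real (inverse (2 * sqrt (g v))) * pd i (\<lambda>v. complex_of_real (g v)) v)" for i
  proof -
    have "Ck n (\<lambda>v. inverse (2 * complex_of_real (sqrt (g v))) * pd i (\<lambda>v. complex_of_real (g v)) v)"
      by (intro Ck_mult Ck_inverse nz Ck_const IH Ck_pd[OF Suc.prems])
    then show ?thesis by (simp only: of_real_inverse of_real_mult of_real_numeral)
  qed
  then show ?case by (rule Ck_SucI[OF c(1) ext[OF c(2)]])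
qed

section \<open>Truncated powers and the basic coordinate functions\<close>

lemma DERIV_max_sq: "((\<lambda>s :: real. (max 0 s)\<^sup>2) has_real_derivative 2 * max 0 x) (at x)"
proof -
  consider "0 < x" | "x < 0" | "x = 0" by linarith
  then show ?thesis
  proof cases
    case 1
    have "((\<lambda>s :: real. s\<^sup>2) has_real_derivative 2 * x) (at x)" by (auto intro!: derivative_eq_intros)
    then have "((\<lambda>s :: real. (max 0 s)\<^sup>2) has_real_derivative 2 * x) (at x)"
      by (rule has_field_derivative_transform_within_open[where S = "{0<..}"]) (use 1 in auto)
    then show ?thesis using 1 by simp
  next
    case 2
    have "((\<lambda>s :: real. 0) has_real_derivative 0) (at x)" by simp
    then have "((\<lambda>s :: real. (max 0 s)\<^sup>2) has_real_derivative 0) (at x)"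
      by (rule has_field_derivative_transform_within_open[where S = "{..<0}"]) (use 2 in auto)
    then show ?thesis using 2 by simp
  next
    case 3
    have "((\<lambda>h :: real. (max 0 h)\<^sup>2 / h) \<longlongrightarrow> 0) (at 0)"
    proof (rule Lim_null_comparison)
      show "\<forall>\<^sub>F h :: real in at 0. norm ((max 0 h)\<^sup>2 / h) \<le> \<bar>h\<bar>"
        by (intro always_eventually allI) (auto simp: max_def power2_eq_square)
      show "((\<lambda>h :: real. \<bar>h\<bar>) \<longlongrightarrow> 0) (at 0)" using tendsto_rabs_zero[OF tendsto_ident_at] by simp
    qed
    then show ?thesis using 3 by (simp add: DERIV_def)
  qed
qed

lemma DERIV_max_cube: "((\<lambda>s :: real. (max 0 s) ^ 3) has_real_derivative 3 * (max 0 x)\<^sup>2) (at x)"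
proof -
  have "(\<lambda>s :: real. (max 0 s) ^ 3) = (\<lambda>s. (max 0 s)\<^sup>2 * s)"
    by (auto simp: fun_eq_iff max_def power2_eq_square power3_eq_cube)
  moreover have "2 * max 0 x * x + 1 * (max 0 x)\<^sup>2 = 3 * (max 0 x)\<^sup>2"
    by (simp add: max_def power2_eq_square)
  ultimately show ?thesis using DERIV_mult[OF DERIV_max_sq DERIV_ident, of x] by (simp only:)
qed

text \<open>The cube is the lowest integral power of the positive part that is twice continuously
  differentiable. It supplies compactly supported weights that Green's identity accepts.\<close>

lemma Ck_max_cube:
  assumes "Ck 2 (\<lambda>v. complex_of_real (g v))"
  shows "Ck 2 (\<lambda>v. complex_of_real ((max 0 (g v)) ^ 3))"
proof -
  have g: "Ck (Suc (Suc 0)) (\<lambda>v. complex_of_real (g v))" using assms by (simp add: numeral_2_eq_2)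
  note d = Ck_diff[OF g]
  have "continuous_on UNIV (\<lambda>v. Re (complex_of_real (g v)))"
    using Ck_cont[OF g] by (intro continuous_intros) simp
  then have c0: "Ck 0 (\<lambda>v. complex_of_real (2 * max 0 (g v)))"
    by (auto intro!: continuous_intros)
  note c1 = pd_of_real_compose[OF d DERIV_max_sq]
  have C1: "Ck (Suc 0) (\<lambda>v. complex_of_real ((max 0 (g v))\<^sup>2))"
    by (rule Ck_SucI[OF c1(1) ext[OF c1(2)]]) (intro Ck_mult c0 Ck_SucD[OF Ck_pd[OF g]])
  note c2 = pd_of_real_compose[OF d DERIV_max_cube]
  have "Ck (Suc 0) (\<lambda>v. complex_of_real (3 * (max 0 (g v))\<^sup>2) * pd i (\<lambda>v. complex_of_real (g v)) v)" for i
    unfolding of_real_mult by (intro Ck_mult Ck_const C1 Ck_pd[OF g])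
  then have "Ck (Suc (Suc 0)) (\<lambda>v. complex_of_real ((max 0 (g v)) ^ 3))"
    by (rule Ck_SucI[OF c2(1) ext[OF c2(2)]])
  then show ?thesis by (simp only: numeral_2_eq_2)
qed

lemma Ck_norm_sq: "Ck n (\<lambda>v. complex_of_real (1 + v \<bullet> v))"
  by (simp add: inner_vec_def) (intro Ck_add Ck_const Ck_sum Ck_mult Ck_coord)

lemma Ck_time: "Ck n (\<lambda>v. complex_of_real (sqrt (1 + v \<bullet> v)))"
  by (intro Ck_sqrt Ck_norm_sq) simp

lemma Ck_hdensity: "Ck n (\<lambda>v. complex_of_real (hdensity v))"
proof -
  have e: "(\<lambda>v. complex_of_real (hdensity v)) = (\<lambda>v. inverse (complex_of_real (sqrt (1 + v \<bullet> v))))"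
    by (simp add: hdensity_eq fun_eq_iff inverse_eq_divide)
  have "complex_of_real (sqrt (1 + v \<bullet> v)) \<noteq> 0" for v :: "real^'a"
    using one_plus_inner_pos[of v] by (simp del: one_plus_inner_pos)
  then show ?thesis unfolding e by (rule Ck_inverse) (rule Ck_time)
qed

lemma Ck_act_time:
  assumes "A \<in> carrier lorentz_group"
  shows "Ck n (\<lambda>v. complex_of_real (act A (hpt v) $ None))"
proof -
  obtain s :: real where s: "\<And>x. x \<in> hyp \<Longrightarrow> act A x = s *\<^sub>R (A *v x)"
    using act_eq_linear[OF assms] by metis
  have "(\<lambda>v. complex_of_real (act A (hpt v) $ None)) =
    (\<lambda>v. complex_of_real s * (complex_of_real (A $ None $ None) * complex_of_real (sqrt (1 + v \<bullet> v)) +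
       (\<Sum>j\<in>UNIV. complex_of_real (A $ None $ Some j) * complex_of_real (v $ j))))"
    by (simp add: fun_eq_iff s matrix_vector_mult_def UNIV_option_sum)
  then show ?thesis
    by (simp only:) (intro Ck_mult Ck_add Ck_const Ck_sum Ck_coord Ck_time)
qed

text \<open>Here \<open>chart\<close> does not read a point of \<open>hyp\<close>: it drops the
  normal coordinate \<open>None\<close> of the ambient chart. The lemma extends a function on the
  hypersurface constantly in the normal direction.\<close>

lemma Ck_compose_tang: "Ck n f \<Longrightarrow> Ck n (\<lambda>v :: real^('m::finite) option. f (chart v))"
proof (induction n arbitrary: f)
  case 0
  then have "continuous_on UNIV f" by simp
  from continuous_on_compose2[OF this continuous_on_chart[of UNIV] subset_UNIV] show ?case by simp
next
  case (Suc n)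
  note d = Ck_diff[OF Suc.prems]
  have lin2: "bounded_linear (chart :: real^'m option \<Rightarrow> real^'m)"
    unfolding linear_conv_bounded_linear[symmetric] by (rule linearI) (auto simp: vec_eq_iff)
  have der: "((\<lambda>v :: real^'m option. f (chart v)) has_derivative
      (\<lambda>h. frechet_derivative f (at (chart v)) (chart h))) (at v)" for v
    by (rule has_derivative_compose[OF bounded_linear_imp_has_derivative[OF lin2] has_derivative_frechet[OF d]])
  have "chart (axis (Some j) 1 :: real^'m option) = axis j 1" "chart (axis None 1 :: real^'m option) = 0" for j
    by (auto simp: vec_eq_iff axis_def)
  then have "pd i (\<lambda>v :: real^'m option. f (chart v)) =
      (case i of None \<Rightarrow> (\<lambda>_. 0) | Some j \<Rightarrow> (\<lambda>v. pd j f (chart v)))" for i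
    using linear_0[OF has_derivative_linear[OF has_derivative_frechet[OF d]]]
    by (cases i) (auto simp: fun_eq_iff pd_eq[OF der] pd_def[of _ f])
  moreover have "Ck n (case i of None \<Rightarrow> (\<lambda>_ :: real^'m option. 0) | Some j \<Rightarrow> (\<lambda>v. pd j f (chart v)))" for i
    using Suc.IH[OF Ck_pd[OF Suc.prems]] by (auto split: option.split)
  moreover have "(\<lambda>v :: real^'m option. f (chart v)) differentiable (at v)" for v
    using der by (auto simp: differentiable_def)
  ultimately show ?case by (metis (no_types) Ck_SucI)
qed

lemma pd_eq_0_outside:
  assumes "\<And>v. R < norm v \<Longrightarrow> f v = 0" "R < norm v"
  shows "pd i f v = 0"
proof -
  have "((\<lambda>_. 0) has_derivative (\<lambda>_. 0)) (at v)" by simp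
  then have "(f has_derivative (\<lambda>_. 0)) (at v)"
  proof (rule has_derivative_transform_within_open[where s = "{v. R < norm v}"])
    show "open {v :: real^'a. R < norm v}" by (intro open_Collect_less continuous_intros)
  qed (use assms in auto)
  from pd_eq[OF this] show ?thesis by simp
qed

subsection \<open>Integration over a half space\<close>

text \<open>Ambient chart coordinates split into tangential part \<open>x\<close> and normal
  coordinate \<open>t\<close>. The index \<open>None\<close> of the chart is the index
  \<open>Some None\<close> of Minkowski space, and \<open>t = 0\<close> is the hypersurface covering
  \<open>Y\<close> (see \<open>incl_hpt\<close>).\<close>

definition cons :: "real^('m::finite) \<Rightarrow> real \<Rightarrow> real^'m option" where
  "cons x t = (\<chi> i. case i of None \<Rightarrow> t | Some j \<Rightarrow> x $ j)"

lemma cons_nth [simp]: "cons x t $ None = t" "cons x t $ Some j = x $ j"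
  by (simp_all add: cons_def)

lemma cons_add_axis: "cons x t = cons x 0 + t *\<^sub>R axis None 1"
  by (auto simp: vec_eq_iff cons_def axis_def split: option.split)

lemma continuous_on_cons [continuous_intros]: "continuous_on S (\<lambda>(x, t). cons x t)"
  unfolding cons_def case_prod_beta continuous_on_vec_lambda
proof -
  have "continuous_on S (\<lambda>p. (case i of None \<Rightarrow> snd p | Some j \<Rightarrow> fst p $ j) :: real)" for i
    by (cases i) (auto intro!: continuous_intros)
  then show "continuous_on S (\<lambda>p. \<chi> i. case i of None \<Rightarrow> snd p | Some j \<Rightarrow> fst p $ j)"
    by (intro continuous_intros)
qed

lemma measurable_cons [measurable]:
  "(\<lambda>(x, t). cons x t) \<in> borel_measurable (borel \<Otimes>\<^sub>M borel)"
  unfolding borel_prod by (intro borel_measurable_continuous_onI continuous_on_cons)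

lemma norm_cons_bounds: "norm x \<le> norm (cons x t)" "\<bar>t\<bar> \<le> norm (cons x t)"
  "norm (cons x t) \<le> norm x + \<bar>t\<bar>"
proof -
  have n: "(norm (cons x t))\<^sup>2 = t\<^sup>2 + (norm x)\<^sup>2"
    unfolding power2_norm_eq_inner by (simp add: inner_vec_def UNIV_option_sum power2_eq_square)
  show "norm x \<le> norm (cons x t)" by (rule power2_le_imp_le) (simp_all add: n)
  show "\<bar>t\<bar> \<le> norm (cons x t)" by (rule power2_le_imp_le) (simp_all add: n)
  show "norm (cons x t) \<le> norm x + \<bar>t\<bar>" by (rule power2_le_imp_le) (simp_all add: n power2_sum)
qed

lemma lborel_cons:
  "distr (lborel \<Otimes>\<^sub>M lborel) borel (\<lambda>(x, t). cons x t) = (lborel :: (real^('m::finite) option) measure)"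
proof (rule lborel_eqI[symmetric])
  fix l u :: "real^'m option"
  assume "\<And>b. b \<in> Basis \<Longrightarrow> l \<bullet> b \<le> u \<bullet> b"
  from this[of "axis _ 1"] have lu: "l $ i \<le> u $ i" for i by (simp add: inner_axis)
  have "(\<lambda>(x, t). cons x t) -` box l u = box (chart l) (chart u) \<times> {l $ None<..<u $ None}"
    by (auto simp: mem_box_cart) (metis cons_nth option.exhaust)+
  moreover have "emeasure (lborel \<Otimes>\<^sub>M lborel) (box (chart l) (chart u) \<times> {l $ None<..<u $ None}) =
    ennreal ((\<Prod>i\<in>UNIV. u $ Some i - l $ Some i) * (u $ None - l $ None))"
    using lu by (subst lborel.emeasure_pair_measure_Times)
      (auto simp: emeasure_lborel_box_vec ennreal_mult' prod_nonneg)
  moreover have "(\<Prod>i\<in>UNIV. u $ Some i - l $ Some i) * (u $ None - l $ None) = (\<Prod>b\<in>Basis. (u - l) \<bullet> b)"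
    by (simp add: prod_Basis_vec inner_axis UNIV_option_conv prod.reindex mult.commute)
  ultimately show "emeasure (distr (lborel \<Otimes>\<^sub>M lborel) borel (\<lambda>(x, t). cons x t)) (box l u) =
      ennreal (\<Prod>b\<in>Basis. (u - l) \<bullet> b)"
    by (subst emeasure_distr) (auto simp: space_pair_measure)
qed simp

lemma integral_cons:
  fixes f :: "real^('m::finite) option \<Rightarrow> complex"
  assumes "integrable lborel f"
  shows "(\<integral>v. f v \<partial>lborel) = (\<integral>x. \<integral>t. f (cons x t) \<partial>lborel \<partial>lborel)"
proof -
  have f [measurable]: "f \<in> borel_measurable borel" using assms by simp
  have "integrable (lborel \<Otimes>\<^sub>M lborel) (\<lambda>p. f (case p of (x, t) \<Rightarrow> cons x t))"
    using assms by (subst (asm) lborel_cons[symmetric], subst (asm) integrable_distr_eq) simp_all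
  then have i: "integrable (lborel \<Otimes>\<^sub>M lborel) (\<lambda>(x, t). f (cons x t))"
    by (simp add: case_prod_unfold)
  have "(\<integral>v. f v \<partial>lborel) = (\<integral>p. f (case p of (x, t) \<Rightarrow> cons x t) \<partial>(lborel \<Otimes>\<^sub>M lborel))"
    by (subst lborel_cons[symmetric], subst integral_distr) simp_all
  also have "\<dots> = (\<integral>p. (\<lambda>(x, t). f (cons x t)) p \<partial>(lborel \<Otimes>\<^sub>M lborel))"
    by (simp add: case_prod_beta)
  also have "\<dots> = (\<integral>x. \<integral>t. f (cons x t) \<partial>lborel \<partial>lborel)"
    using lborel_pair.integral_fst'[OF i] by simp
  finally show ?thesis .
qed

lemma has_vector_derivative_pd:
  assumes "f differentiable (at (v + s *\<^sub>R axis i 1))"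
  shows "((\<lambda>s. f (v + s *\<^sub>R axis i 1)) has_vector_derivative pd i f (v + s *\<^sub>R axis i 1)) (at s)"
proof -
  have l: "((\<lambda>s. v + s *\<^sub>R axis i 1) has_derivative (\<lambda>h. h *\<^sub>R axis i 1)) (at s)"
    by (auto intro!: derivative_eq_intros)
  note d = has_derivative_frechet[OF assms]
  have "((\<lambda>s. f (v + s *\<^sub>R axis i 1)) has_derivative
     (\<lambda>h. frechet_derivative f (at (v + s *\<^sub>R axis i 1)) (h *\<^sub>R axis i 1))) (at s)"
    by (rule has_derivative_compose[OF l d])
  then show ?thesis unfolding has_vector_derivative_def pd_def
    by (simp add: linear_cmul[OF has_derivative_linear[OF d]])
qed

definition upper :: "(real^('m::finite) option) set" where "upper = {v. 0 < v $ None}"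

lemma sets_upper [measurable]: "upper \<in> sets borel"
  unfolding upper_def by (intro borel_open open_Collect_less continuous_intros)

lemma integrable_upper:
  fixes f :: "real^('m::finite) option \<Rightarrow> complex"
  assumes "continuous_on UNIV f" "\<And>v. R < norm v \<Longrightarrow> f v = 0"
  shows "integrable lborel (\<lambda>v. indicator upper v *\<^sub>R f v)"
proof -
  have "integrable lborel (\<lambda>v. indicator (cball 0 R) v *\<^sub>R f v)"
    using assms(1) by (intro borel_integrable_compact) (auto intro: continuous_on_subset)
  moreover have "(\<lambda>v. indicator (cball 0 R) v *\<^sub>R f v) = f"
    using assms(2) by (auto simp: fun_eq_iff split: split_indicator)
  ultimately show ?thesis by (intro integrable_mult_indicator) auto
qed

text \<open>Fubini reduces this to the fundamental theorem of calculus on each normal line, where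
  only the end point on the hypersurface contributes.\<close>

lemma integral_pd_normal:
  fixes w :: "real^('m::finite) option \<Rightarrow> complex"
  assumes w: "Ck (Suc 0) w" and R: "\<And>v. R < norm v \<Longrightarrow> w v = 0"
  shows "(\<integral>v. indicator upper v *\<^sub>R pd None w v \<partial>lborel) = - (\<integral>x. w (cons x 0) \<partial>lborel)"
proof -
  have c: "continuous_on UNIV (pd None w)" using Ck_pd[OF w] by simp
  have z: "R < norm v \<Longrightarrow> pd None w v = 0" for v by (rule pd_eq_0_outside[OF R])
  have cons_eq: "\<exists>y. \<forall>t. cons x t = y + t *\<^sub>R axis None 1" for x :: "real^'m"
    using cons_add_axis[of x] by blast
  define T where "T = \<bar>R\<bar> + 1"
  have "(\<integral>t. indicator upper (cons x t) *\<^sub>R pd None w (cons x t) \<partial>lborel) = - w (cons x 0)" for x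
  proof -
    obtain y where cx: "\<And>t. cons x t = y + t *\<^sub>R axis None 1" using cons_eq by blast
    have T: "0 \<le> T" "R < norm (cons x t)" if "T \<le> t" for t
      using norm_cons_bounds(2)[of t x] that unfolding T_def by linarith+
    have "(\<integral>t. indicator upper (cons x t) *\<^sub>R pd None w (cons x t) \<partial>lborel) =
      (\<integral>t. indicator {0..T} t *\<^sub>R pd None w (cons x t) \<partial>lborel)"
    proof (rule integral_cong_AE)
      have [measurable]: "(\<lambda>t. cons x t) \<in> borel_measurable borel"
        unfolding cx by measurable
      have [measurable]: "pd None w \<in> borel_measurable borel" by (rule borel_measurable_continuous_onI[OF c])
      show "(\<lambda>t. indicator upper (cons x t) *\<^sub>R pd None w (cons x t)) \<in> borel_measurable lborel"
        "(\<lambda>t. indicator {0..T} t *\<^sub>R pd None w (cons x t)) \<in> borel_measurable lborel" by measurable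
      \<comment> \<open>The indicators disagree at \<open>t = 0\<close>, a null set, and above
        \<open>T\<close>, where the support of \<open>w\<close> has been left.\<close>
      show "AE t in lborel. indicator upper (cons x t) *\<^sub>R pd None w (cons x t) =
          indicator {0..T} t *\<^sub>R pd None w (cons x t)"
        using AE_lborel_singleton[of 0]
      proof eventually_elim
        case (elim t)
        show ?case
        proof (cases "T \<le> t")
          case True
          then show ?thesis using z[OF T(2)[OF True]] by simp
        next
          case False
          then show ?thesis using elim by (auto simp: upper_def split: split_indicator)
        qed
      qed
    qed
    also have "\<dots> = w (cons x T) - w (cons x 0)"
    proof (rule integral_FTC_Icc)
      show "continuous_on {0..T} (\<lambda>t. pd None w (cons x t))"
        unfolding cx by (intro continuous_on_compose2[OF c] continuous_intros) auto
      show "((\<lambda>t. w (cons x t)) has_vector_derivative pd None w (cons x t)) (at t within {0..T})" for t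
        unfolding cx
        by (rule has_vector_derivative_at_within[OF has_vector_derivative_pd[OF Ck_diff[OF w]]])
    qed (auto simp: T_def)
    also have "w (cons x T) = 0" using R T(2)[of T] by simp
    finally show ?thesis by simp
  qed
  then show ?thesis
    using integral_cons[OF integrable_upper[OF c z]] by simp
qed

lemma vector_derivative_limit:
  fixes f :: "real \<Rightarrow> 'b::real_normed_vector"
  assumes "(f has_vector_derivative d) (at 0)"
  shows "((\<lambda>s. inverse s *\<^sub>R (f s - f 0)) \<longlongrightarrow> d) (at 0)"
proof -
  have L: "((\<lambda>h. norm (f h - f 0 - h *\<^sub>R d) / norm h) \<longlongrightarrow> 0) (at 0)"
    using assms by (simp add: has_vector_derivative_def has_derivative_at)
  have *: "norm (f h - f 0 - h *\<^sub>R d) / norm h = norm (d - inverse h *\<^sub>R (f h - f 0))" if "h \<noteq> 0" for h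
  proof -
    have "d - inverse h *\<^sub>R (f h - f 0) = (- inverse h) *\<^sub>R (f h - f 0 - h *\<^sub>R d)"
      using that by (simp add: algebra_simps)
    then show ?thesis by (simp only: norm_scaleR) (simp add: divide_inverse)
  qed
  have ev: "\<forall>\<^sub>F h in at 0. norm (f h - f 0 - h *\<^sub>R d) / norm h = norm (d - inverse h *\<^sub>R (f h - f 0))"
    unfolding eventually_at_filter by (intro always_eventually allI impI *)
  have "((\<lambda>h. norm (d - inverse h *\<^sub>R (f h - f 0))) \<longlongrightarrow> 0) (at 0)"
    by (rule Lim_transform_eventually[OF L ev])
  from tendsto_diff[OF tendsto_const tendsto_norm_zero_cancel[OF this], of d]
  show ?thesis by simp
qed

text \<open>Tangential translations preserve both the half space and Lebesgue measure, so every
  difference quotient has integral 0. Dominated convergence passes this on to the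
  derivative.\<close>

lemma integral_pd_tangential:
  fixes w :: "real^('m::finite) option \<Rightarrow> complex"
  assumes w: "Ck (Suc 0) w" and R: "\<And>v. R < norm v \<Longrightarrow> w v = 0"
  shows "(\<integral>v. indicator upper v *\<^sub>R pd (Some j) w v \<partial>lborel) = 0"
proof -
  define e where "e = axis (Some j) (1 :: real)"
  define h where "h n = inverse (real (Suc n))" for n
  have h: "0 < h n" "h n \<le> 1" for n by (auto simp: h_def field_simps)
  have c: "continuous_on UNIV (pd (Some j) w)" using Ck_pd[OF w] by simp
  have cw: "continuous_on UNIV w" using Ck_cont[OF w] .
  have [measurable]: "w \<in> borel_measurable borel" "pd (Some j) w \<in> borel_measurable borel"
    by (rule borel_measurable_continuous_onI[OF cw], rule borel_measurable_continuous_onI[OF c])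
  define g where "g n v = indicator upper v *\<^sub>R (inverse (h n) *\<^sub>R (w (v + h n *\<^sub>R e) - w v))" for n v
  obtain M where M: "\<And>v. v \<in> cball 0 (\<bar>R\<bar> + 2) \<Longrightarrow> norm (pd (Some j) w v) \<le> M"
  proof -
    have "compact (pd (Some j) w ` cball 0 (\<bar>R\<bar> + 2))"
      by (intro compact_continuous_image continuous_on_subset[OF c]) auto
    then have "bounded (pd (Some j) w ` cball 0 (\<bar>R\<bar> + 2))" by (rule compact_imp_bounded)
    then show ?thesis using that unfolding bounded_iff by blast
  qed
  have z: "R < norm v \<Longrightarrow> pd (Some j) w v = 0" for v by (rule pd_eq_0_outside[OF R])
  have M': "norm (pd (Some j) w v) \<le> \<bar>M\<bar>" for v
  proof (cases "R < norm v")
    case False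
    then have "v \<in> cball 0 (\<bar>R\<bar> + 2)" by simp
    from M[OF this] show ?thesis by linarith
  qed (simp add: z)
  have diff: "norm (w (v + s *\<^sub>R e) - w v) \<le> \<bar>M\<bar> * s" if "0 \<le> s" for v s
  proof -
    have "norm (w (v + s *\<^sub>R e) - w (v + 0 *\<^sub>R e)) \<le> \<bar>M\<bar> * norm (s - 0)"
    proof (rule differentiable_bound[where S = UNIV and f' = "\<lambda>s h. h *\<^sub>R pd (Some j) w (v + s *\<^sub>R e)"])
      show "((\<lambda>s. w (v + s *\<^sub>R e)) has_derivative (\<lambda>h. h *\<^sub>R pd (Some j) w (v + s *\<^sub>R e))) (at s within UNIV)" for s
        unfolding e_def has_vector_derivative_def[symmetric]
        by (intro has_vector_derivative_pd Ck_diff[OF w])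
      show "onorm (\<lambda>h. h *\<^sub>R pd (Some j) w (v + s *\<^sub>R e)) \<le> \<bar>M\<bar>" for s
        using M' by (intro onorm_le) (simp add: mult.commute mult_left_mono)
    qed auto
    then show ?thesis using that by simp
  qed
  have up: "indicator upper (v + s *\<^sub>R e) = (indicator upper v :: real)" for v s
    by (auto simp: upper_def e_def axis_def split: split_indicator)
  have iw: "integrable lborel (\<lambda>v. indicator upper v *\<^sub>R w v)" by (rule integrable_upper[OF cw R])
  have "(\<integral>v. g n v \<partial>lborel) = 0" for n
  proof -
    define F where "F v = indicator upper v *\<^sub>R w v" for v
    have F: "integrable lborel F" using iw by (simp add: F_def[abs_def])
    then have [measurable]: "F \<in> borel_measurable borel" by simp
    have D: "distr lborel borel ((+) (h n *\<^sub>R e)) = (lborel :: (real^'m option) measure)"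
      by (rule lborel_distr_plus)
    have F': "integrable lborel (\<lambda>v. F (h n *\<^sub>R e + v))"
      using F by (subst (asm) D[symmetric], subst (asm) integrable_distr_eq) simp_all
    have "(\<integral>v. F (h n *\<^sub>R e + v) \<partial>lborel) = (\<integral>v. F v \<partial>lborel)"
      by (subst (2) D[symmetric], subst integral_distr) simp_all
    then have "(\<integral>v. inverse (h n) *\<^sub>R (F (h n *\<^sub>R e + v) - F v) \<partial>lborel) = 0"
      using F F' by simp
    moreover have "g n v = inverse (h n) *\<^sub>R (F (h n *\<^sub>R e + v) - F v)" for v
      unfolding g_def F_def using up[of v "h n"] by (simp add: algebra_simps)
    ultimately show ?thesis by simp
  qed
  moreover have "(\<lambda>n. \<integral>v. g n v \<partial>lborel) \<longlonglongrightarrow> (\<integral>v. indicator upper v *\<^sub>R pd (Some j) w v \<partial>lborel)"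
  \<comment> \<open>Steps have length at most 1, so all difference quotients vanish outside the ball
    of radius \<open>\<bar>R\<bar> + 2\<close>; the mean value inequality bounds them by
    \<open>\<bar>M\<bar>\<close>.\<close>
  proof (rule integral_dominated_convergence[where w = "\<lambda>v. indicator (cball 0 (\<bar>R\<bar> + 2)) v *\<^sub>R \<bar>M\<bar>"])
    show "(\<lambda>v. indicator upper v *\<^sub>R pd (Some j) w v) \<in> borel_measurable lborel" by measurable
    show "g n \<in> borel_measurable lborel" for n unfolding g_def by measurable
    show "integrable lborel (\<lambda>v :: real^'m option. indicator (cball 0 (\<bar>R\<bar> + 2)) v *\<^sub>R \<bar>M\<bar>)"
      by (intro borel_integrable_compact) auto
    show "AE v in lborel. (\<lambda>n. g n v) \<longlonglongrightarrow> indicator upper v *\<^sub>R pd (Some j) w v"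
    proof (rule AE_I2)
      fix v :: "real^'m option"
      have "((\<lambda>s. w (v + s *\<^sub>R e)) has_vector_derivative pd (Some j) w (v + 0 *\<^sub>R e)) (at 0)"
        unfolding e_def by (intro has_vector_derivative_pd Ck_diff[OF w])
      from vector_derivative_limit[OF this]
      have "((\<lambda>s. inverse s *\<^sub>R (w (v + s *\<^sub>R e) - w v)) \<longlongrightarrow> pd (Some j) w v) (at 0)"
        by simp
      moreover have "filterlim h (at 0) sequentially"
        unfolding filterlim_at using LIMSEQ_inverse_real_of_nat h
        by (auto simp: h_def[abs_def] less_imp_neq[symmetric])
      ultimately have "(\<lambda>n. inverse (h n) *\<^sub>R (w (v + h n *\<^sub>R e) - w v)) \<longlonglongrightarrow> pd (Some j) w v"
        by (rule filterlim_compose)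
      then show "(\<lambda>n. g n v) \<longlonglongrightarrow> indicator upper v *\<^sub>R pd (Some j) w v"
        unfolding g_def by (intro tendsto_intros)
    qed
    show "AE v in lborel. norm (g n v) \<le> indicator (cball 0 (\<bar>R\<bar> + 2)) v *\<^sub>R \<bar>M\<bar>" for n
    proof (rule AE_I2)
      fix v :: "real^'m option"
      have e1: "norm (h n *\<^sub>R e) \<le> 1" using h[of n] by (simp add: e_def)
      show "norm (g n v) \<le> indicator (cball 0 (\<bar>R\<bar> + 2)) v *\<^sub>R \<bar>M\<bar>"
      proof (cases "v \<in> cball 0 (\<bar>R\<bar> + 2)")
        case True
        have "inverse (h n) * norm (w (v + h n *\<^sub>R e) - w v) \<le> inverse (h n) * (\<bar>M\<bar> * h n)"
          using diff[of "h n" v] h[of n] by (intro mult_left_mono) auto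
        also have "\<dots> = \<bar>M\<bar>" using h(1)[of n] by simp
        finally have "norm (inverse (h n) *\<^sub>R (w (v + h n *\<^sub>R e) - w v)) \<le> \<bar>M\<bar>"
          using h(1)[of n] by simp
        then show ?thesis using True unfolding g_def by (auto split: split_indicator)
      next
        case False
        then have v: "\<bar>R\<bar> + 2 < norm v" by simp
        have "norm v \<le> norm (v + h n *\<^sub>R e) + norm (h n *\<^sub>R e)"
          by (metis add_diff_cancel_right' norm_triangle_ineq4)
        then have "w (v + h n *\<^sub>R e) = 0" "w v = 0" using v e1 by (auto intro!: R)
        then show ?thesis unfolding g_def by (simp split: split_indicator)
      qed
    qed
  qed
  ultimately show ?thesis by (simp add: LIMSEQ_const_iff)
qed

subsection \<open>Green's identity\<close>

text \<open>The inverse metric of \<open>matrix_inv_hmetric\<close>, with complex values so that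
  \<open>Ck\<close> applies.\<close>

definition ginv :: "'k \<Rightarrow> 'k \<Rightarrow> real^('k::finite) \<Rightarrow> complex" where
  "ginv i j v = (if i = j then 1 else 0) + complex_of_real (v $ i) * complex_of_real (v $ j)"

definition rho :: "real^('k::finite) \<Rightarrow> complex" where "rho v = complex_of_real (hdensity v)"

text \<open>The gradient of \<open>f\<close> times the volume density: its coordinate divergence is
  the density times the analyst's Laplacian, hence the minus sign in
  \<open>sum_pd_flux\<close>.\<close>

definition flux :: "(real^('k::finite) \<Rightarrow> complex) \<Rightarrow> 'k \<Rightarrow> real^'k \<Rightarrow> complex" where
  "flux f i v = rho v * (\<Sum>j\<in>UNIV. ginv i j v * pd j f v)"

lemma Ck_rho: "Ck n rho"
  using Ck_hdensity[of n] unfolding rho_def[abs_def] .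

lemma Ck_ginv: "Ck n (ginv i j)"
  unfolding ginv_def[abs_def] by (intro Ck_add Ck_const Ck_mult Ck_coord)

lemma Ck_flux: "Ck (Suc n) f \<Longrightarrow> Ck n (flux f i)"
  unfolding flux_def[abs_def] by (intro Ck_mult Ck_rho Ck_sum Ck_ginv Ck_pd)

lemma rho_nonzero: "rho v \<noteq> 0"
  using hdensity_pos[of v] by (simp add: rho_def)

lemma sum_pd_flux: "(\<Sum>i\<in>UNIV. pd i (flux f i) v) = - (rho v * laplacian f v)"
proof -
  have "flux f i = (\<lambda>w. hdensity w *\<^sub>R (\<Sum>j\<in>UNIV. (matrix_inv (hmetric w) $ i $ j) *\<^sub>R pd j f w))" for i
    by (auto simp: fun_eq_iff flux_def rho_def ginv_def matrix_inv_hmetric scaleR_conv_of_real intro!: sum.cong)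
  then show ?thesis
    using rho_nonzero[of v] by (simp add: laplacian_def rho_def scaleR_conv_of_real)
qed

text \<open>The derivative of \<open>arsinh\<close> at \<open>v $ None\<close>, that is the only
  nonzero partial derivative of the signed distance t.\<close>

definition tau :: "real^('m::finite) option \<Rightarrow> real" where
  "tau v = inverse (sqrt (1 + (v $ None)\<^sup>2))"

lemma one_plus_sq_pos: "0 < 1 + (x :: real)\<^sup>2"
  by (simp add: add_pos_nonneg)

text \<open>The eikonal equation: the gradient of the distance t has length 1.\<close>

lemma tau_sq: "complex_of_real (tau v) * complex_of_real (tau v) * ginv None None v = 1"
proof -
  have "tau v * tau v * (1 + (v $ None)\<^sup>2) = 1"
    using one_plus_sq_pos[of "v $ None"]
    by (simp add: tau_def field_simps flip: power2_eq_square)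
  then have "complex_of_real (tau v * tau v * (1 + (v $ None)\<^sup>2)) = 1" by (simp only: of_real_1)
  then show ?thesis by (simp add: ginv_def power2_eq_square)
qed

lemma Ck_tau: "Ck n (\<lambda>v :: real^('m::finite) option. complex_of_real (tau v))"
proof -
  have "Ck n (\<lambda>v :: real^'m option. complex_of_real (1 + (v $ None)\<^sup>2))"
    by (simp add: power2_eq_square) (intro Ck_add Ck_const Ck_mult Ck_coord)
  then have "Ck n (\<lambda>v :: real^'m option. inverse (complex_of_real (sqrt (1 + (v $ None)\<^sup>2))))"
    using one_plus_sq_pos by (intro Ck_inverse Ck_sqrt) (auto simp: less_imp_neq[symmetric])
  then show ?thesis by (simp add: tau_def)
qed

text \<open>The signed distance of \<^term>\<open>hpt v\<close> to the hyperplane \<open>v $ None = 0\<close> is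
  \<^term>\<open>arsinh (v $ None)\<close>.\<close>

definition sig :: "real \<Rightarrow> real^('m::finite) option \<Rightarrow> complex" where
  "sig k v = complex_of_real (sin (k * arsinh (v $ None)) / k)"

definition kap :: "real \<Rightarrow> real^('m::finite) option \<Rightarrow> complex" where
  "kap k v = complex_of_real (cos (k * arsinh (v $ None)))"

lemma sig_kap:
  assumes "k \<noteq> 0"
  shows "sig k differentiable (at v)" "kap k differentiable (at v)"
    "pd i (sig k) v = (if i = None then kap k v * complex_of_real (tau v) else 0)"
    "pd i (kap k) v = (if i = None then - (complex_of_real (k\<^sup>2) * sig k v * complex_of_real (tau v)) else 0)"
proof -
  have d: "(\<lambda>v :: real^'a option. complex_of_real (v $ None)) differentiable (at v)"
    using Ck_diff[OF Ck_coord] .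
  have t: "inverse (sqrt ((v $ None)\<^sup>2 + 1)) = tau v" by (simp add: tau_def add.commute)
  have s: "((\<lambda>x. sin (k * arsinh x) / k) has_real_derivative cos (k * arsinh (v $ None)) * tau v) (at (v $ None))"
    using assms by (auto intro!: derivative_eq_intros simp: t[symmetric] inverse_eq_divide)
  have c: "((\<lambda>x. cos (k * arsinh x)) has_real_derivative
      - (k\<^sup>2 * (sin (k * arsinh (v $ None)) / k) * tau v)) (at (v $ None))"
    using assms by (auto intro!: derivative_eq_intros simp: t[symmetric] inverse_eq_divide power2_eq_square)
  show "sig k differentiable (at v)" "kap k differentiable (at v)"
    using pd_of_real_compose(1)[OF d s] pd_of_real_compose(1)[OF d c]
    by (simp_all add: sig_def[abs_def] kap_def[abs_def])
  show "pd i (sig k) v = (if i = None then kap k v * complex_of_real (tau v) else 0)"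
    using pd_of_real_compose(2)[OF d s, of i] by (simp add: sig_def[abs_def] kap_def pd_coord)
  show "pd i (kap k) v = (if i = None then - (complex_of_real (k\<^sup>2) * sig k v * complex_of_real (tau v)) else 0)"
    using pd_of_real_compose(2)[OF d c, of i] by (simp add: kap_def[abs_def] sig_def pd_coord)
qed

lemma Ck_sig_kap:
  assumes "k \<noteq> 0"
  shows "Ck n (sig k :: real^('m::finite) option \<Rightarrow> complex) \<and> Ck n (kap k :: real^'m option \<Rightarrow> complex)"
proof (induction n)
  case 0
  have "continuous_on UNIV (sig k :: real^'m option \<Rightarrow> complex)"
    "continuous_on UNIV (kap k :: real^'m option \<Rightarrow> complex)"
    using sig_kap(1,2)[OF assms] by (auto intro!: differentiable_imp_continuous_on simp: differentiable_on_def)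
  then show ?case by simp
next
  case (Suc n)
  note S = conjunct1[OF Suc] conjunct2[OF Suc]
  have "Ck n (\<lambda>v :: real^'m option. if i = None then kap k v * complex_of_real (tau v) else 0)" for i :: "'m option"
    by (cases "i = None"; simp only: if_True if_False simp_thms; intro Ck_const Ck_mult S Ck_tau)
  moreover have "Ck n (\<lambda>v :: real^'m option. if i = None then - (complex_of_real (k\<^sup>2) * sig k v * complex_of_real (tau v)) else 0)"
    for i :: "'m option"
    by (cases "i = None"; simp only: if_True if_False simp_thms; intro Ck_const Ck_uminus Ck_mult S Ck_tau)
  ultimately show ?case
    by (intro conjI Ck_SucI[OF sig_kap(1)[OF assms] ext[OF sig_kap(3)[OF assms]]]
        Ck_SucI[OF sig_kap(2)[OF assms] ext[OF sig_kap(4)[OF assms]]])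
qed

lemma norm_sig_le: "1 \<le> k \<Longrightarrow> norm (sig k v) \<le> 1"
proof -
  assume k: "1 \<le> k"
  have "\<bar>sin (k * arsinh (v $ None))\<bar> \<le> k" using abs_sin_le_one[of "k * arsinh (v $ None)"] k by linarith
  then show ?thesis using k by (simp add: sig_def norm_divide)
qed

lemma norm_kap_le: "norm (kap k v) \<le> 1"
  by (simp add: kap_def)

text \<open>The vector field b grad t, multiplied by the volume density.\<close>

definition ntrace :: "(real^('m::finite) option \<Rightarrow> complex) \<Rightarrow> 'm option \<Rightarrow> real^'m option \<Rightarrow> complex" where
  "ntrace b i v = rho v * (b v * (complex_of_real (tau v) * ginv i None v))"

text \<open>The coefficient of \<open>sig k\<close> that survives in the divergence of
  \<open>green\<close>; it equals \<open>rho\<close> times the divergence of grad b and does not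
  involve k.\<close>

definition dsig :: "(real^('m::finite) option \<Rightarrow> complex) \<Rightarrow> real^'m option \<Rightarrow> complex" where
  "dsig b v = (\<Sum>i\<in>UNIV. pd i (flux b i) v)"

text \<open>The coefficient of \<open>kap k\<close>: \<open>rho\<close> times 2 <grad b, grad t> + b
  div grad t. One of the two mixed products comes from the first summand, the other from
  differentiating \<open>ntrace\<close>. Again k is absent.\<close>

definition dkap :: "(real^('m::finite) option \<Rightarrow> complex) \<Rightarrow> real^'m option \<Rightarrow> complex" where
  "dkap b v = complex_of_real (tau v) * flux b None v + (\<Sum>i\<in>UNIV. pd i (ntrace b i) v)"

lemma Ck_ntrace: "Ck n b \<Longrightarrow> Ck n (ntrace b i)"
  unfolding ntrace_def[abs_def] by (intro Ck_mult Ck_rho Ck_tau Ck_ginv)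

lemma Ck_dsig_dkap:
  assumes "Ck 2 b"
  shows "Ck 0 (dsig b)" "Ck 0 (dkap b)"
proof -
  have b: "Ck (Suc (Suc 0)) b" using assms by (simp only: numeral_2_eq_2)
  show "Ck 0 (dsig b)"
    unfolding dsig_def[abs_def] by (intro Ck_sum Ck_pd Ck_flux b)
  show "Ck 0 (dkap b)"
    unfolding dkap_def[abs_def]
    by (intro Ck_add Ck_mult Ck_tau Ck_sum Ck_pd Ck_ntrace Ck_flux b Ck_SucD[OF b])
qed

lemma flux_zero: "(\<And>v. R < norm v \<Longrightarrow> b v = 0) \<Longrightarrow> R < norm v \<Longrightarrow> flux b i v = 0"
  by (simp add: flux_def pd_eq_0_outside[of R b v])

lemma ntrace_zero: "(\<And>v. R < norm v \<Longrightarrow> b v = 0) \<Longrightarrow> R < norm v \<Longrightarrow> ntrace b i v = 0"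
  by (simp add: ntrace_def)

lemma dsig_dkap_zero:
  assumes "\<And>v. R < norm v \<Longrightarrow> b v = 0" "R < norm v"
  shows "dsig b v = 0" "dkap b v = 0"
proof -
  have "pd i (flux b i) v = 0" for i by (rule pd_eq_0_outside[OF flux_zero[OF assms(1)] assms(2)])
  moreover have "pd i (ntrace b i) v = 0" for i by (rule pd_eq_0_outside[OF ntrace_zero[OF assms(1)] assms(2)])
  ultimately show "dsig b v = 0" "dkap b v = 0"
    by (simp_all add: dsig_def dkap_def flux_zero[OF assms])
qed

lemma flux_symmetric:
  "(\<Sum>i\<in>UNIV. pd i f v * flux g i v) = (\<Sum>i\<in>UNIV. pd i g v * flux f i v)"
proof -
  have "(\<Sum>i\<in>UNIV. pd i f v * flux g i v) =
      (\<Sum>i\<in>UNIV. \<Sum>j\<in>UNIV. rho v * ginv i j v * pd i f v * pd j g v)"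
    unfolding flux_def sum_distrib_left by (simp add: mult_ac)
  also have "\<dots> = (\<Sum>j\<in>UNIV. \<Sum>i\<in>UNIV. rho v * ginv i j v * pd i f v * pd j g v)"
    by (rule sum.swap)
  also have "\<dots> = (\<Sum>j\<in>UNIV. \<Sum>i\<in>UNIV. pd j g v * (rho v * (ginv j i v * pd i f v)))"
  proof -
    have "ginv i j v = ginv j i v" for i j by (auto simp: ginv_def)
    then show ?thesis by (simp add: mult_ac)
  qed
  also have "\<dots> = (\<Sum>i\<in>UNIV. pd i g v * flux f i v)"
    unfolding flux_def sum_distrib_left ..
  finally show ?thesis .
qed

lemma pd_ntrace_sum: "(\<Sum>i\<in>UNIV. pd i f v * ntrace b i v) = b v * complex_of_real (tau v) * flux f None v"
proof -
  have "ginv i None v = ginv None i v" for i by (auto simp: ginv_def)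
  then show ?thesis
    unfolding flux_def ntrace_def sum_distrib_left by (simp add: mult_ac)
qed

text \<open>The field u grad f - f grad u times the density, for u = b \<open>sig k\<close>; the
  product rule has been carried out in grad u.\<close>

definition green :: "real \<Rightarrow> (real^('m::finite) option \<Rightarrow> complex) \<Rightarrow> (real^'m option \<Rightarrow> complex)
    \<Rightarrow> 'm option \<Rightarrow> real^'m option \<Rightarrow> complex" where
  "green k f b i v = b v * sig k v * flux f i v - f v * (sig k v * flux b i v + kap k v * ntrace b i v)"

text \<open>The products of first derivatives of \<open>f\<close> with those of u cancel by symmetry
  of the metric. The two terms with \<open>k\<^sup>2\<close>, one from the eigenvalue and one from
  differentiating \<open>sig k\<close> twice, cancel because grad t has length 1.\<close>

lemma sum_pd_green:
  assumes f: "Ck 2 f" and b: "Ck 2 b" and k: "k \<noteq> 0"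
    and eig: "laplacian f v = complex_of_real (k\<^sup>2) * f v"
  shows "(\<Sum>i\<in>UNIV. pd i (green k f b i) v) = - (f v * (sig k v * dsig b v + kap k v * dkap b v))"
proof -
  have f2: "Ck (Suc (Suc 0)) f" and b2: "Ck (Suc (Suc 0)) b" using f b by (simp_all only: numeral_2_eq_2)
  have sk: "Ck (Suc 0) (sig k)" "Ck (Suc 0) (kap k)" using Ck_sig_kap[OF k] by blast+
  note C = f2[THEN Ck_SucD] b2[THEN Ck_SucD] f2[THEN Ck_flux] b2[THEN Ck_flux] sk
    Ck_ntrace[OF b2[THEN Ck_SucD]]
  note d = C[THEN Ck_diff]
  define \<sigma> \<kappa> t F B N where "\<sigma> = sig k v" and "\<kappa> = kap k v" and "t = complex_of_real (tau v)"
    and "F = (\<lambda>i. flux f i v)" and "B = (\<lambda>i. flux b i v)" and "N = (\<lambda>i. ntrace b i v)"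
  note defs = \<sigma>_def \<kappa>_def t_def F_def B_def N_def
  have h: "pd i (green k f b i) v =
      (pd i b v * \<sigma> + b v * pd i (sig k) v) * F i + b v * \<sigma> * pd i (flux f i) v
      - (pd i f v * (\<sigma> * B i + \<kappa> * N i)
        + f v * ((pd i (sig k) v * B i + \<sigma> * pd i (flux b i) v) + (pd i (kap k) v * N i + \<kappa> * pd i (ntrace b i) v)))" for i
    unfolding green_def[abs_def] defs
    by (simp only: pd_diff pd_mult pd_add d differentiable_mult differentiable_diff differentiable_add)
  have "(\<Sum>i\<in>UNIV. pd i (green k f b i) v) =
      \<sigma> * (\<Sum>i\<in>UNIV. pd i b v * F i) + b v * (\<Sum>i\<in>UNIV. pd i (sig k) v * F i)
      + b v * \<sigma> * (\<Sum>i\<in>UNIV. pd i (flux f i) v)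
      - (\<sigma> * (\<Sum>i\<in>UNIV. pd i f v * B i) + \<kappa> * (\<Sum>i\<in>UNIV. pd i f v * N i)
        + f v * ((\<Sum>i\<in>UNIV. pd i (sig k) v * B i) + \<sigma> * dsig b v
          + (\<Sum>i\<in>UNIV. pd i (kap k) v * N i) + \<kappa> * (\<Sum>i\<in>UNIV. pd i (ntrace b i) v)))"
    unfolding h by (simp add: sum.distrib sum_subtractf sum_distrib_left dsig_def algebra_simps)
  also have "(\<Sum>i\<in>UNIV. pd i (sig k) v * F i) = \<kappa> * t * F None"
    by (simp add: UNIV_option_sum sig_kap[OF k] defs)
  also have "(\<Sum>i\<in>UNIV. pd i (sig k) v * B i) = \<kappa> * t * B None"
    by (simp add: UNIV_option_sum sig_kap[OF k] defs)
  also have "(\<Sum>i\<in>UNIV. pd i (kap k) v * N i) = - (complex_of_real (k\<^sup>2) * \<sigma> * (t * N None))"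
    by (simp add: UNIV_option_sum sig_kap[OF k] defs)
  \<comment> \<open>This is where the eikonal equation enters: it makes the \<open>k\<^sup>2\<close>
    term from \<open>kap k\<close> match the one from the eigenvalue exactly.\<close>
  also have "t * N None = rho v * b v"
  proof -
    have "t * N None = rho v * b v * (t * t * ginv None None v)"
      by (simp add: defs ntrace_def)
    then show ?thesis by (simp add: tau_sq t_def)
  qed
  also have "(\<Sum>i\<in>UNIV. pd i (flux f i) v) = - (rho v * (complex_of_real (k\<^sup>2) * f v))"
    by (simp add: sum_pd_flux eig)
  also have "(\<Sum>i\<in>UNIV. pd i f v * B i) = (\<Sum>i\<in>UNIV. pd i b v * F i)"
    unfolding defs by (rule flux_symmetric)
  also have "(\<Sum>i\<in>UNIV. pd i f v * N i) = b v * t * F None"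
    unfolding defs by (rule pd_ntrace_sum)
  also have "(\<Sum>i\<in>UNIV. pd i (ntrace b i) v) = dkap b v - t * B None"
    by (simp add: dkap_def defs)
  finally show ?thesis unfolding \<sigma>_def[symmetric] \<kappa>_def[symmetric] by (simp add: algebra_simps)
qed

lemma Ck_green:
  assumes f: "Ck 2 f" and b: "Ck 2 b" and k: "k \<noteq> 0"
  shows "Ck (Suc 0) (green k f b i)"
proof -
  have f2: "Ck (Suc (Suc 0)) f" and b2: "Ck (Suc (Suc 0)) b" using f b by (simp_all only: numeral_2_eq_2)
  have sk: "Ck (Suc 0) (sig k)" "Ck (Suc 0) (kap k)" using Ck_sig_kap[OF k] by blast+
  show ?thesis unfolding green_def[abs_def]
    by (intro Ck_minus Ck_mult Ck_add sk Ck_flux[OF f2] Ck_flux[OF b2] Ck_ntrace Ck_SucD[OF f2] Ck_SucD[OF b2])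
qed

text \<open>On the hypersurface \<open>sig k\<close> vanishes while \<open>kap k\<close>,
  \<open>tau\<close> and the normal entry of \<open>ginv\<close> are 1, so no derivative of
  \<open>f\<close> survives.\<close>

lemma green_boundary:
  "green k f b None (cons x 0) = - (complex_of_real (hdensity (cons x 0)) * (f (cons x 0) * b (cons x 0)))"
  by (simp add: green_def sig_def kap_def ntrace_def tau_def ginv_def rho_def)

text \<open>Lets the boundary term be read as an integral for the hyperbolic measure of the
  hypersurface.\<close>

lemma hdensity_cons: "hdensity (cons x 0) = hdensity x"
  by (simp add: hdensity_eq inner_vec_def UNIV_option_sum)

text \<open>The test function is \<open>b sin(k t) / k\<close>, that is \<^term>\<open>\<lambda>v. b v * sig k v\<close>.\<close>

lemma boundary_integral:
  fixes f b :: "real^('m::finite) option \<Rightarrow> complex"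
  assumes f: "Ck 2 f" and b: "Ck 2 b" and k: "k \<noteq> 0"
    and eig: "\<And>v. laplacian f v = complex_of_real (k\<^sup>2) * f v"
    and R: "\<And>v. R < norm v \<Longrightarrow> b v = 0"
  shows "(\<integral>x. complex_of_real (hdensity x) * (f (cons x 0) * b (cons x 0)) \<partial>lborel) =
    - (\<integral>v. indicator upper v *\<^sub>R (f v * (sig k v * dsig b v + kap k v * dkap b v)) \<partial>lborel)"
proof -
  note G = Ck_green[OF f b k]
  have z: "green k f b i v = 0" if "R < norm v" for i v
    using that by (simp add: green_def R flux_zero[OF R] ntrace_zero[OF R])
  have cont: "continuous_on UNIV (pd i (green k f b i))" for i using Ck_pd[OF G] by simp
  have int: "integrable lborel (\<lambda>v. indicator upper v *\<^sub>R pd i (green k f b i) v)" for i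
    by (rule integrable_upper[OF cont pd_eq_0_outside[OF z]])
  have "(\<integral>v. indicator upper v *\<^sub>R (\<Sum>i\<in>UNIV. pd i (green k f b i) v) \<partial>lborel) =
      (\<Sum>i\<in>UNIV. \<integral>v. indicator upper v *\<^sub>R pd i (green k f b i) v \<partial>lborel)"
    unfolding scaleR_sum_right by (rule Bochner_Integration.integral_sum) (rule int)
  also have "\<dots> = - (\<integral>x. green k f b None (cons x 0) \<partial>lborel)"
    by (simp add: UNIV_option_sum integral_pd_normal[OF G z] integral_pd_tangential[OF G z])
  also have "\<dots> = (\<integral>x. complex_of_real (hdensity x) * (f (cons x 0) * b (cons x 0)) \<partial>lborel)"
    by (simp add: green_boundary hdensity_cons)
  finally show ?thesis by (simp add: sum_pd_green[OF f b k eig])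
qed

text \<open>\<open>M\<close> is fixed before \<open>f\<close> and \<open>k\<close>: it bounds
  \<open>dsig b\<close> and \<open>dkap b\<close> on the ball, and the frequency enters only through
  \<open>sig k\<close> and \<open>kap k\<close>, which have modulus at most 1.\<close>

lemma boundary_integral_bound:
  fixes b :: "real^('m::finite) option \<Rightarrow> complex"
  assumes b: "Ck 2 b" and R: "\<And>v. R < norm v \<Longrightarrow> b v = 0"
  obtains M where "0 \<le> M"
    "\<And>f k. Ck 2 f \<Longrightarrow> 1 \<le> k \<Longrightarrow> (\<And>v. laplacian f v = complex_of_real (k\<^sup>2) * f v) \<Longrightarrow>
      cmod (\<integral>x. complex_of_real (hdensity x) * (f (cons x 0) * b (cons x 0)) \<partial>lborel)
      \<le> M * (\<integral>v. indicator (cball 0 R) v * cmod (f v) \<partial>lborel)"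
proof -
  have c: "continuous_on UNIV (dsig b)" "continuous_on UNIV (dkap b)" using Ck_dsig_dkap[OF b] by simp_all
  have "bounded (dsig b ` cball 0 R)" "bounded (dkap b ` cball 0 R)"
    by (intro compact_imp_bounded compact_continuous_image continuous_on_subset[OF c(1)]
        continuous_on_subset[OF c(2)] compact_cball subset_UNIV)+
  then obtain M1 M2 where M1: "\<And>v. v \<in> cball 0 R \<Longrightarrow> norm (dsig b v) \<le> M1"
    and M2: "\<And>v. v \<in> cball 0 R \<Longrightarrow> norm (dkap b v) \<le> M2"
    unfolding bounded_iff by blast
  define M where "M = \<bar>M1\<bar> + \<bar>M2\<bar>"
  show thesis
  proof (rule that[of M])
    fix f :: "real^'m option \<Rightarrow> complex" and k :: real
    assume f: "Ck 2 f" and k: "1 \<le> k" and eig: "\<And>v. laplacian f v = complex_of_real (k\<^sup>2) * f v"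
    have cf: "continuous_on UNIV f" by (rule Ck_cont[OF f])
    have "norm (\<integral>v. indicator upper v *\<^sub>R (f v * (sig k v * dsig b v + kap k v * dkap b v)) \<partial>lborel)
      \<le> (\<integral>v. M * (indicator (cball 0 R) v * cmod (f v)) \<partial>lborel)"
    proof (rule order.trans[OF integral_norm_bound integral_mono])
      have sk: "continuous_on UNIV (sig k)" "continuous_on UNIV (kap k)"
        using Ck_sig_kap[of k 0] k by auto
      show "integrable lborel (\<lambda>v. norm (indicator upper v *\<^sub>R (f v * (sig k v * dsig b v + kap k v * dkap b v))))"
        by (rule integrable_norm)
           (rule integrable_upper[where R = R],
            auto intro!: continuous_intros cf c sk simp: dsig_dkap_zero[OF R])
      have "integrable lborel (\<lambda>v. indicator (cball 0 R) v *\<^sub>R cmod (f v))"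
        by (intro borel_integrable_compact continuous_intros continuous_on_subset[OF cf]) auto
      then show "integrable lborel (\<lambda>v. M * (indicator (cball 0 R) v * cmod (f v)))" by simp
      fix v :: "real^'m option"
      show "norm (indicator upper v *\<^sub>R (f v * (sig k v * dsig b v + kap k v * dkap b v)))
          \<le> M * (indicator (cball 0 R) v * cmod (f v))"
      proof (cases "v \<in> cball 0 R")
        case True
        have "norm (sig k v * dsig b v) \<le> 1 * \<bar>M1\<bar>"
          unfolding norm_mult using M1[OF True] norm_sig_le[OF k, of v] by (intro mult_mono) auto
        moreover have "norm (kap k v * dkap b v) \<le> 1 * \<bar>M2\<bar>"
          unfolding norm_mult using M2[OF True] norm_kap_le[of k v] by (intro mult_mono) auto
        ultimately have "norm (sig k v * dsig b v + kap k v * dkap b v) \<le> 1 * \<bar>M1\<bar> + 1 * \<bar>M2\<bar>"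
          by (rule norm_triangle_mono)
        then have "cmod (f v) * norm (sig k v * dsig b v + kap k v * dkap b v) \<le> cmod (f v) * M"
          unfolding M_def by (intro mult_left_mono) auto
        then have "norm (f v * (sig k v * dsig b v + kap k v * dkap b v)) \<le> M * cmod (f v)"
          by (simp only: norm_mult mult.commute)
        then show ?thesis using True by (auto simp: M_def split: split_indicator)
      next
        case False
        then show ?thesis using dsig_dkap_zero[OF R, where v = v] by simp
      qed
    qed
    then show "cmod (\<integral>x. complex_of_real (hdensity x) * (f (cons x 0) * b (cons x 0)) \<partial>lborel)
      \<le> M * (\<integral>v. indicator (cball 0 R) v * cmod (f v) \<partial>lborel)"
      using boundary_integral[OF f b _ eig R] k by simp
  qed (simp add: M_def)
qed

subsection \<open>Partition of unity and local bounds\<close>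

context free_proper
begin

definition cutoff :: "real \<Rightarrow> real^'k option \<Rightarrow> real" where
  "cutoff R x = (max 0 (R - x $ None)) ^ 3"

text \<open>The finite sum is the sum over the whole group wherever \<^term>\<open>cutoff R\<close> does not vanish; the
  last summand only keeps the denominator positive elsewhere.\<close>

definition den :: "real \<Rightarrow> real^'k option \<Rightarrow> real" where
  "den R x = (\<Sum>A\<in>near R. cutoff R (act A x)) + (max 0 (x $ None - R)) ^ 3"

definition punit :: "real \<Rightarrow> real^'k option \<Rightarrow> real" where
  "punit R x = cutoff R x / den R x"

lemma cutoff_nonneg: "0 \<le> cutoff R x"
  by (simp add: cutoff_def)

lemma cutoff_pos: "0 < cutoff R x \<longleftrightarrow> x $ None < R"
  by (auto simp: cutoff_def zero_less_power_eq)

lemma cutoff_zero: "R \<le> x $ None \<Longrightarrow> cutoff R x = 0"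
  by (simp add: cutoff_def)

text \<open>Beyond time \<open>R\<close> the extra summand is positive. Up to time \<open>R\<close>,
  an element supplied by \<open>cover\<close> has both \<open>x\<close> and its image in the ball,
  hence already occurs in the finite sum.\<close>

lemma den_pos:
  assumes x: "x \<in> hyp" and cover: "\<And>x. x \<in> hyp \<Longrightarrow> \<exists>A\<in>\<Gamma>. act A x $ None < R"
  shows "0 < den R x"
proof (cases "R < x $ None")
  case True
  then have "0 < (max 0 (x $ None - R)) ^ 3" by simp
  moreover have "0 \<le> (\<Sum>A\<in>near R. cutoff R (act A x))" by (intro sum_nonneg cutoff_nonneg)
  ultimately show ?thesis unfolding den_def by linarith
next
  case False
  obtain A where A: "A \<in> \<Gamma>" "act A x $ None < R" using cover[OF x] by blast
  then have "A \<in> near R" using False x by (auto simp: near_def intro!: bexI[of _ x])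
  then have "0 < (\<Sum>A\<in>near R. cutoff R (act A x))"
    using A(2) cutoff_pos by (intro sum_pos2[of _ A]) (auto intro: cutoff_nonneg)
  moreover have "0 \<le> (max 0 (x $ None - R)) ^ 3" by simp
  ultimately show ?thesis unfolding den_def by linarith
qed

lemma punit_nonneg: "0 \<le> punit R x"
  by (auto simp: punit_def den_def intro!: divide_nonneg_nonneg add_nonneg_nonneg sum_nonneg cutoff_nonneg)

lemma measurable_time: "(\<lambda>x :: real^'k option. x $ None) \<in> borel_measurable borel"
  by (intro borel_measurable_continuous_onI continuous_intros)

lemma measurable_punit [measurable]: "punit R \<in> borel_measurable borel"
proof -
  note measurable_time [measurable]
  show ?thesis unfolding punit_def[abs_def] den_def cutoff_def by measurable
qed

text \<open>Seen from a point of the orbit inside the ball, every element with nonzero cutoff lies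
  in \<open>near R\<close>. The finite sum is then the full orbit sum, reindexed by right
  multiplication, and so is the same at all such points.\<close>

lemma sum_cutoff_near:
  assumes x: "x \<in> hyp" and B: "B \<in> \<Gamma>" "act B x $ None < R"
  shows "(\<Sum>A\<in>near R. cutoff R (act A (act B x))) = (\<Sum>A\<in>{A\<in>\<Gamma>. act A x $ None < R}. cutoff R (act A x))"
proof -
  let ?S = "{A\<in>near R. act A (act B x) $ None < R}" and ?T = "{A\<in>\<Gamma>. act A x $ None < R}"
  have nG: "A \<in> \<Gamma>" if "A \<in> near R" for A using that by (simp add: near_def)
  have "(\<Sum>A\<in>near R. cutoff R (act A (act B x))) = (\<Sum>A\<in>?S. cutoff R (act A (act B x)))"
    by (intro sum.mono_neutral_right) (auto simp: cutoff_zero not_less)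
  also have "\<dots> = (\<Sum>A\<in>?S. cutoff R (act (A ** B) x))"
    using nG B(1) x by (intro sum.cong) (auto simp: act_comp)
  also have "\<dots> = (\<Sum>A\<in>?T. cutoff R (act A x))"
  proof (rule sum.reindex_bij_witness[where i = "\<lambda>A. A ** iv B" and j = "\<lambda>A. A ** B"])
    show "A ** B ** iv B = A" "A ** iv B ** B = A" for A
      using iv[OF B(1)] by (simp_all flip: matrix_mul_assoc)
    show "A ** B \<in> ?T" if "A \<in> ?S" for A
      using that nG B(1) x mult_in by (auto simp: act_comp)
    show "A ** iv B \<in> ?S" if "A \<in> ?T" for A
    proof -
      have "act (A ** iv B) (act B x) = act A x"
        using that B(1) x by (simp add: act_comp iv(1) act_hyp act_iv)
      then show ?thesis
        using that B x mult_in[OF _ iv(1)[OF B(1)]] act_hyp[OF B(1) x]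
        by (auto simp: near_def intro!: bexI[of _ "act B x"])
    qed
  qed simp
  finally show ?thesis .
qed

text \<open>All nonzero terms belong to orbit points of time below \<open>R\<close>; they share the
  denominator \<open>a\<close>, which is the sum of their numerators.\<close>

lemma nn_integral_punit:
  assumes x: "x \<in> hyp" and cover: "\<And>x. x \<in> hyp \<Longrightarrow> \<exists>A\<in>\<Gamma>. act A x $ None < R"
  shows "(\<integral>\<^sup>+A. ennreal (punit R (act A x)) \<partial>count_space \<Gamma>) = 1"
proof -
  define T where "T = {A\<in>\<Gamma>. act A x $ None < R}"
  define a where "a = (\<Sum>A\<in>T. cutoff R (act A x))"
  obtain B where B: "B \<in> \<Gamma>" "act B x $ None < R" using cover[OF x] by blast
  have fin: "finite T"
    by (rule finite_subset[OF _ conjunct1[OF card_return_le[OF x, of R]]]) (auto simp: T_def)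
  have a: "0 < a"
    unfolding a_def using B cutoff_pos
    by (intro sum_pos2[OF fin, of B]) (auto simp: T_def intro: cutoff_nonneg)
  have pu: "punit R (act A x) = (if A \<in> T then cutoff R (act A x) / a else 0)" if "A \<in> \<Gamma>" for A
  proof (cases "A \<in> T")
    case True
    then have A: "act A x $ None < R" by (simp add: T_def)
    then have "den R (act A x) = a"
      using sum_cutoff_near[OF x that A] by (simp add: den_def a_def T_def)
    then show ?thesis using True by (simp add: punit_def)
  next
    case False
    then show ?thesis using that by (simp add: punit_def T_def cutoff_zero)
  qed
  have "(\<integral>\<^sup>+A. ennreal (punit R (act A x)) \<partial>count_space \<Gamma>) = (\<Sum>A\<in>T. ennreal (punit R (act A x)))"
    by (rule nn_integral_count_space'[OF fin]) (auto simp: pu T_def)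
  also have "\<dots> = ennreal (\<Sum>A\<in>T. punit R (act A x))"
    by (rule sum_ennreal) (rule punit_nonneg)
  also have "(\<Sum>A\<in>T. punit R (act A x)) = (\<Sum>A\<in>T. cutoff R (act A x) / a)"
    by (intro sum.cong) (auto simp: pu T_def)
  also have "\<dots> = 1" using a by (simp add: a_def flip: sum_divide_distrib)
  finally show ?thesis by simp
qed

lemma Ck_punit:
  assumes cover: "\<And>x. x \<in> hyp \<Longrightarrow> \<exists>A\<in>\<Gamma>. act A x $ None < R"
  shows "Ck 2 (\<lambda>v. complex_of_real (punit R (hpt v)))"
proof -
  have cut: "Ck 2 (\<lambda>v. complex_of_real (cutoff R (act A (hpt v))))" if "A \<in> \<Gamma>" for A
    unfolding cutoff_def
    by (rule Ck_max_cube) (simp only: of_real_diff, intro Ck_minus Ck_const Ck_act_time carr that)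
  have cut1: "Ck 2 (\<lambda>v. complex_of_real (cutoff R (hpt v)))"
    using cut[OF one_in] by (simp add: act_one)
  have t: "Ck 2 (\<lambda>v :: real^'k. complex_of_real (hpt v $ None))"
    using Ck_act_time[OF carr[OF one_in]] by (simp only: act_one hpt_in_hyp)
  have "Ck 2 (\<lambda>v :: real^'k. complex_of_real ((max 0 (hpt v $ None - R)) ^ 3))"
    by (rule Ck_max_cube) (simp only: of_real_diff, intro Ck_minus Ck_const t)
  then have "Ck 2 (\<lambda>v. complex_of_real (den R (hpt v)))"
    unfolding den_def of_real_add of_real_sum by (intro Ck_add Ck_sum cut) (auto simp: near_def)
  then have "Ck 2 (\<lambda>v. inverse (complex_of_real (den R (hpt v))))"
    using den_pos[OF hpt_in_hyp cover] by (intro Ck_inverse) (auto simp: less_imp_neq[symmetric])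
  from Ck_mult[OF cut1 this] show ?thesis
    by (simp add: punit_def divide_inverse)
qed

lemma integral_orbit_measure:
  fixes h :: "(real^'k option) set \<Rightarrow> complex"
  assumes cover: "\<And>x. x \<in> hyp \<Longrightarrow> \<exists>A\<in>\<Gamma>. act A x $ None < R"
    and h: "continuous_on UNIV (\<lambda>v. h (orbit \<Gamma> (hpt v)))"
  shows "(\<integral>c. h c \<partial>orbit_measure \<Gamma>) =
    (\<integral>v. complex_of_real (hdensity v) * (complex_of_real (punit R (hpt v)) * h (orbit \<Gamma> (hpt v))) \<partial>lborel)"
proof -
  note hm [measurable] = measurable_from_orbit[OF h]
  have hv [measurable]: "(\<lambda>v. h (orbit \<Gamma> (hpt v))) \<in> borel_measurable borel"
    by (rule borel_measurable_continuous_onI[OF h])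
  have e: "ennreal (hdensity v) * ennreal (punit R (hpt v)) = ennreal (hdensity v * punit R (hpt v))" for v :: "real^'k"
    by (simp add: ennreal_mult less_imp_le[OF hdensity_pos] punit_nonneg)
  have om: "orbit_measure \<Gamma> = distr (density lborel (\<lambda>v. ennreal (hdensity v * punit R (hpt v))))
    (borel_of (orbit_topology \<Gamma>)) (\<lambda>v. orbit \<Gamma> (hpt v))"
    unfolding e[symmetric]
    by (rule orbit_measure_eq_distr[OF measurable_punit]) (rule nn_integral_punit[OF _ cover])
  have "(\<integral>c. h c \<partial>orbit_measure \<Gamma>) =
    (\<integral>v. h (orbit \<Gamma> (hpt v)) \<partial>density lborel (\<lambda>v. ennreal (hdensity v * punit R (hpt v))))"
    unfolding om by (rule integral_distr) measurable
  also have "\<dots> = (\<integral>v. (hdensity v * punit R (hpt v)) *\<^sub>R h (orbit \<Gamma> (hpt v)) \<partial>lborel)"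
    by (rule integral_density) (auto intro!: AE_I2 mult_nonneg_nonneg less_imp_le[OF hdensity_pos] punit_nonneg)
  finally show ?thesis by (simp add: scaleR_conv_of_real mult.assoc)
qed

text \<open>The bound is independent of \<phi>. The estimate x \<le> 1 + x^2 splits off the volume
  of the ball, and the square integral is unfolded to the normalized one on the quotient, with the
  number of returns as multiplicity.\<close>

lemma integral_ball_le:
  fixes \<phi> :: "(real^'k option) set \<Rightarrow> complex"
  assumes cont: "continuous_on UNIV (lift \<Gamma> \<phi>)"
    and int: "integrable (orbit_measure \<Gamma>) (\<lambda>c. (cmod (\<phi> c))\<^sup>2)"
    and one: "(\<integral>c. (cmod (\<phi> c))\<^sup>2 \<partial>orbit_measure \<Gamma>) = 1"
  shows "(\<integral>v. indicator (cball 0 r) v * cmod (lift \<Gamma> \<phi> v) \<partial>lborel) \<le>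
    measure lborel (cball (0 :: real^'k) r) + sqrt (1 + r\<^sup>2) * real (card (near (sqrt (1 + r\<^sup>2))))"
proof -
  define R where "R = sqrt (1 + r\<^sup>2)"
  have R: "0 < R" by (simp add: R_def add_pos_nonneg)
  define N where "N = card (near R)"
  define f where "f = lift \<Gamma> \<phi>"
  have f: "f v = \<phi> (orbit \<Gamma> (hpt v))" for v by (simp add: f_def lift_def)
  have [measurable]: "cball (0 :: real^'k) r \<in> sets borel" by simp
  have [measurable]: "f \<in> borel_measurable borel"
    unfolding f_def by (rule borel_measurable_continuous_onI[OF cont])
  have c2: "continuous_on UNIV (\<lambda>v. (cmod (f v))\<^sup>2)"
    using cont by (auto simp: f_def intro!: continuous_intros)
  have G: "(\<lambda>c. ennreal ((cmod (\<phi> c))\<^sup>2)) \<in> borel_measurable (borel_of (orbit_topology \<Gamma>))"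
    using measurable_from_orbit[of "\<lambda>c. (cmod (\<phi> c))\<^sup>2"] c2 by (simp add: f)
  \<comment> \<open>\<open>R\<close> is the time of \<open>hpt\<close> on the sphere of radius
    \<open>r\<close>. On the ball \<open>hdensity\<close> is at least \<open>1 / R\<close>, which is
    the price for replacing Lebesgue measure by hyperbolic measure.\<close>
  have hb: "indicator (cball 0 r) v * ennreal ((cmod (f v))\<^sup>2) \<le>
     ennreal R * (ennreal (hdensity v) * (indicator {..R} (hpt v $ None) * ennreal ((cmod (\<phi> (orbit \<Gamma> (hpt v))))\<^sup>2)))" for v :: "real^'k"
  proof (cases "v \<in> cball 0 r")
    case True
    then have "v \<bullet> v \<le> r\<^sup>2" by (metis dist_0_norm mem_cball norm_ge_zero power2_norm_eq_inner power_mono)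
    then have t: "sqrt (1 + v \<bullet> v) \<le> R" by (simp add: R_def)
    have p: "0 < sqrt (1 + v \<bullet> v)" using one_plus_inner_pos[of v] by (simp del: one_plus_inner_pos)
    have "1 \<le> R * hdensity v" using t p by (simp add: hdensity_eq)
    then have "1 * (cmod (f v))\<^sup>2 \<le> R * hdensity v * (cmod (f v))\<^sup>2" by (intro mult_right_mono) auto
    then have "ennreal ((cmod (f v))\<^sup>2) \<le> ennreal R * (ennreal (hdensity v) * ennreal ((cmod (f v))\<^sup>2))"
      using R hdensity_pos[of v] by (simp add: mult.assoc flip: ennreal_mult)
    then show ?thesis using True t by (simp add: f)
  qed simp
  have "(\<integral>\<^sup>+v. indicator (cball 0 r) v * ennreal ((cmod (f v))\<^sup>2) \<partial>lborel) \<le>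
    (\<integral>\<^sup>+v. ennreal R * (ennreal (hdensity v) * (indicator {..R} (hpt v $ None) * ennreal ((cmod (\<phi> (orbit \<Gamma> (hpt v))))\<^sup>2))) \<partial>lborel)"
    by (intro nn_integral_mono hb)
  also have "\<dots> = ennreal R * (\<integral>\<^sup>+v. (ennreal (hdensity v) * (indicator {..R} (hpt v $ None) * ennreal ((cmod (\<phi> (orbit \<Gamma> (hpt v))))\<^sup>2))) \<partial>lborel)"
  proof (rule nn_integral_cmult)
    note G [measurable] measurable_time [measurable]
    show "(\<lambda>v. ennreal (hdensity v) * (indicator {..R} (hpt v $ None) * ennreal ((cmod (\<phi> (orbit \<Gamma> (hpt v))))\<^sup>2))) \<in> borel_measurable lborel"
      unfolding f[symmetric] by measurable
  qed
  also have "\<dots> \<le> ennreal R * (of_nat N * (\<integral>\<^sup>+c. ennreal ((cmod (\<phi> c))\<^sup>2) \<partial>orbit_measure \<Gamma>))"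
    unfolding N_def by (intro mult_left_mono nn_integral_ball_le G) auto
  also have "(\<integral>\<^sup>+c. ennreal ((cmod (\<phi> c))\<^sup>2) \<partial>orbit_measure \<Gamma>) = 1"
    using nn_integral_eq_integral[OF int] one by simp
  finally have bound: "(\<integral>\<^sup>+v. indicator (cball 0 r) v * ennreal ((cmod (f v))\<^sup>2) \<partial>lborel) \<le> ennreal (R * real N)"
    using R by (simp add: ennreal_mult ennreal_of_nat_eq_real_of_nat)
  have le: "x \<le> 1 + x\<^sup>2" for x :: real
    using zero_le_power2[of "x - 1"] sum_power2_ge_zero[of x 0] by (simp add: power2_diff) (smt (verit) zero_le_power2)
  have "(\<integral>\<^sup>+v. ennreal (indicator (cball 0 r) v * cmod (f v)) \<partial>lborel) \<le>
    (\<integral>\<^sup>+v. indicator (cball 0 r) v + indicator (cball 0 r) v * ennreal ((cmod (f v))\<^sup>2) \<partial>lborel)"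
  proof (intro nn_integral_mono)
    fix v :: "real^'k"
    have "ennreal (cmod (f v)) \<le> ennreal (1 + (cmod (f v))\<^sup>2)" by (intro ennreal_leI le)
    then show "ennreal (indicator (cball 0 r) v * cmod (f v)) \<le>
      indicator (cball 0 r) v + indicator (cball 0 r) v * ennreal ((cmod (f v))\<^sup>2)"
      by (auto split: split_indicator simp: ennreal_plus)
  qed
  also have "\<dots> = emeasure lborel (cball (0 :: real^'k) r) + (\<integral>\<^sup>+v. indicator (cball 0 r) v * ennreal ((cmod (f v))\<^sup>2) \<partial>lborel)"
    by (subst nn_integral_add) auto
  also have "\<dots> \<le> ennreal (measure lborel (cball (0 :: real^'k) r)) + ennreal (R * real N)"
  proof (rule add_mono[OF _ bound])
    have "emeasure lborel (cball (0 :: real^'k) r) = ennreal (measure lborel (cball (0 :: real^'k) r))"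
      using emeasure_lborel_cball_finite[of "0 :: real^'k" r]
      by (intro emeasure_eq_ennreal_measure) auto
    then show "emeasure lborel (cball (0 :: real^'k) r) \<le> ennreal (measure lborel (cball (0 :: real^'k) r))" by simp
  qed
  also have "\<dots> = ennreal (measure lborel (cball (0 :: real^'k) r) + R * real N)"
    using R by (simp add: ennreal_plus)
  finally have fin: "(\<integral>\<^sup>+v. ennreal (indicator (cball 0 r) v * cmod (f v)) \<partial>lborel) \<le>
    ennreal (measure lborel (cball (0 :: real^'k) r) + R * real N)" .
  have "(\<integral>v. indicator (cball 0 r) v * cmod (f v) \<partial>lborel) \<le> measure lborel (cball (0 :: real^'k) r) + R * real N"
    using R by (intro integral_real_bounded fin) (auto intro!: add_nonneg_nonneg)
  then show ?thesis by (simp add: f_def N_def R_def)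
qed

end

text \<open>All powers of an element fixing \<open>x\<close> fix \<open>x\<close> too, so they lie
  in a finite set. Two powers coincide, and the element has finite order.\<close>

lemma torsion_free_imp_free:
  fixes A :: "real^('k::finite) option^'k option"
  assumes tf: "torsion_free_in lorentz_group \<Gamma>" and sub: "subgroup \<Gamma> lorentz_group"
    and dis: "discrete \<Gamma>" and A: "A \<in> \<Gamma>" and x: "x \<in> hyp" "act A x = x"
  shows "A = mat 1"
proof -
  let ?G = "lorentz_group :: (real^'k option^'k option) monoid"
  interpret G: group ?G by (rule group_lorentz)
  interpret S: subgroup \<Gamma> ?G by (rule sub)
  have mult: "B \<otimes>\<^bsub>?G\<^esub> C = B ** C" "\<one>\<^bsub>?G\<^esub> = mat 1" for B C by (simp_all add: lorentz_group_def)
  have AG: "A \<in> carrier ?G" using A by (rule S.mem_carrier)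
  have P: "A [^]\<^bsub>?G\<^esub> (n :: nat) \<in> \<Gamma> \<and> act (A [^]\<^bsub>?G\<^esub> n) x = x" for n
  proof (induction n)
    case 0
    then show ?case using subgroup_lorentz_one[OF sub] act_one[OF x(1)] by (simp add: mult)
  next
    case (Suc n)
    then have "act (A [^]\<^bsub>?G\<^esub> n ** A) x = x"
      using act_mult[of "A [^]\<^bsub>?G\<^esub> n" A x] S.mem_carrier AG x by simp
    then show ?case using Suc subgroup_lorentz_mult[OF sub _ A] by (simp add: mult)
  qed
  have "range (\<lambda>n :: nat. A [^]\<^bsub>?G\<^esub> n) \<subseteq> {A\<in>\<Gamma>. \<exists>y\<in>hyp. y $ None \<le> x $ None \<and> act A y $ None \<le> x $ None}"
    using P x(1) by (auto intro!: bexI[of _ x])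
  then have "finite (range (\<lambda>n :: nat. A [^]\<^bsub>?G\<^esub> n))"
    using discrete_imp_proper[OF sub dis] finite_subset by blast
  then have "\<not> inj (\<lambda>n :: nat. A [^]\<^bsub>?G\<^esub> n)" using finite_imageD infinite_UNIV_nat by blast
  then obtain m n :: nat where mn: "m < n" "A [^]\<^bsub>?G\<^esub> m = A [^]\<^bsub>?G\<^esub> n"
    unfolding inj_def by (metis linorder_neqE_nat)
  have "A [^]\<^bsub>?G\<^esub> m \<otimes>\<^bsub>?G\<^esub> A [^]\<^bsub>?G\<^esub> (n - m) = A [^]\<^bsub>?G\<^esub> m \<otimes>\<^bsub>?G\<^esub> \<one>\<^bsub>?G\<^esub>"
    using G.nat_pow_mult[OF AG, of m "n - m"] mn AG by simp
  then have "A [^]\<^bsub>?G\<^esub> (n - m) = \<one>\<^bsub>?G\<^esub>" using AG by simp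
  then show ?thesis using tf A mn(1) unfolding torsion_free_in_def by (metis mult(2) zero_less_diff)
qed

lemma free_proper_lattice:
  assumes "lattice_in lorentz_group \<Gamma>" "torsion_free_in lorentz_group \<Gamma>"
  shows "free_proper \<Gamma>"
proof (rule free_proper.intro)
  show sub: "subgroup \<Gamma> lorentz_group" using assms(1) by (simp add: lattice_in_def)
  have dis: "discrete \<Gamma>" using assms(1) by (simp add: lattice_in_def)
  show "finite {A\<in>\<Gamma>. \<exists>x\<in>hyp. x $ None \<le> R \<and> act A x $ None \<le> R}" for R
    by (rule discrete_imp_proper[OF sub dis])
  show "A = mat 1" if "A \<in> \<Gamma>" "x \<in> hyp" "act A x = x" for A x
    by (rule torsion_free_imp_free[OF assms(2) sub dis that])
qed

lemma block_inj:
  assumes "block A s = block B t"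
  shows "A = B" "s = t"
proof -
  have "A $ i $ j = B $ i $ j" for i j
    using arg_cong[OF assms, of "\<lambda>M. M $ map_option Some i $ map_option Some j"] by (simp add: block_nth)
  then show "A = B" by (simp add: vec_eq_iff)
  show "s = t" using arg_cong[OF assms, of "\<lambda>M. M $ Some None $ Some None"] by (simp add: block_nth)
qed

text \<open>\<open>incl\<close> intertwines the action of \<open>A\<close> with that of
  \<open>block A s\<close>, and \<open>block\<close> is injective in \<open>A\<close>. So properness
  and freeness on the hyperplane are inherited from \<Gamma>.\<close>

lemma free_proper_cycle:
  fixes \<Gamma> :: "(real^('m::finite) option option^'m option option) set"
  assumes "free_proper \<Gamma>"
  shows "free_proper (cycle_lattice \<Gamma>)"
proof (rule free_proper.intro)
  interpret free_proper \<Gamma> by fact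
  let ?L = "lorentz_group :: (real^'m option^'m option) monoid"
  let ?C = "cycle_lattice \<Gamma>"
  have memI: "A \<in> ?C" if "block A s \<in> \<Gamma>" "A \<in> carrier ?L" "s \<in> {1, -1}" for A s
    using that by (auto simp: cycle_lattice_def)
  show "subgroup ?C ?L"
  proof (rule group.subgroupI[OF group_lorentz])
    show "?C \<subseteq> carrier ?L" by (auto simp: cycle_lattice_def)
    have "mat 1 \<in> ?C" by (rule memI[of _ 1]) (auto simp: block_one one_in)
    then show "?C \<noteq> {}" by blast
    fix A assume "A \<in> ?C"
    then obtain s where A: "A \<in> carrier ?L" "s \<in> {1, -1}" "block A s \<in> \<Gamma>"
      by (auto simp: cycle_lattice_def)
    obtain B where B: "B \<in> carrier ?L" "B ** A = mat 1" using lorentz_invertible[OF A(1)] by blast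
    have "block B s ** block A s = mat 1" using A(2) B(2) by (auto simp: block_mult block_one)
    then have "block B s = iv (block A s)"
      using iv[OF A(3)] by (metis matrix_mul_assoc matrix_mul_lid matrix_mul_rid)
    then have "B \<in> ?C" using iv(1)[OF A(3)] B(1) A(2) by (intro memI[of _ s]) auto
    moreover have "inv\<^bsub>?L\<^esub> A = B"
      using group.inv_equality[OF group_lorentz, of B A] A(1) B by (simp add: lorentz_group_def)
    ultimately show "inv\<^bsub>?L\<^esub> A \<in> ?C" by simp
    fix B assume "B \<in> ?C"
    then obtain t where B: "B \<in> carrier ?L" "t \<in> {1, -1}" "block B t \<in> \<Gamma>"
      by (auto simp: cycle_lattice_def)
    have "block (A ** B) (s * t) \<in> \<Gamma>" using mult_in[OF A(3) B(3)] by (simp add: block_mult)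
    moreover have "A ** B \<in> carrier ?L" by (rule lorentz_mult_closed[OF A(1) B(1)])
    moreover have "s * t \<in> {1, -1}" using A(2) B(2) by auto
    ultimately have "A ** B \<in> ?C" by (intro memI)
    then show "A \<otimes>\<^bsub>?L\<^esub> B \<in> ?C" by (simp add: lorentz_group_def)
  qed
  \<comment> \<open>A sign that puts \<open>block A (e A)\<close> into \<Gamma>, chosen to embed the
    set of returning elements into \<open>near R\<close>.\<close>
  define e where "e A = (SOME s. s \<in> {1, -1 :: real} \<and> block A s \<in> \<Gamma>)" for A :: "real^'m option^'m option"
  have e: "block A (e A) \<in> \<Gamma>" if "A \<in> ?C" for A
  proof -
    have "\<exists>s. s \<in> {1, -1 :: real} \<and> block A s \<in> \<Gamma>" using that by (auto simp: cycle_lattice_def)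
    from someI_ex[OF this] show ?thesis by (simp add: e_def)
  qed
  fix R :: real
  let ?S = "{A\<in>?C. \<exists>x\<in>hyp. x $ None \<le> R \<and> act A x $ None \<le> R}"
  have img: "(\<lambda>A. block A (e A)) ` ?S \<subseteq> near R"
  proof
    fix B assume "B \<in> (\<lambda>A. block A (e A)) ` ?S"
    then obtain A x where A: "A \<in> ?C" "B = block A (e A)" "x \<in> hyp" "x $ None \<le> R" "act A x $ None \<le> R" by blast
    then show "B \<in> near R" unfolding near_def
      using e[OF A(1)] incl_in_hyp[OF A(3)] by (auto simp: act_block_incl intro!: bexI[of _ "incl x"])
  qed
  have "inj_on (\<lambda>A. block A (e A)) ?S" by (rule inj_onI) (rule block_inj(1))
  then show "finite ?S" by (rule inj_on_finite[OF _ img finite_near])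
  fix A :: "real^'m option^'m option" and x
  assume A: "A \<in> ?C" "x \<in> hyp" "act A x = x"
  then have "block A (e A) = mat 1"
    using free[OF e[OF A(1)] incl_in_hyp[OF A(2)]] by (simp add: act_block_incl)
  then show "A = mat 1" using block_inj(1)[of A "e A" "mat 1" 1] by (simp add: block_one)
qed

subsection \<open>Compactness of the cycle and the main estimate\<close>

lemma act_time: "act A x $ None = \<bar>(A *v x) $ None\<bar>"
  by (auto simp: act_def)

text \<open>The modulus of the entry \<open>g $ None $ None\<close> is the time of the image of
  \<open>hpt 0\<close> under \<open>g\<close>. Cosets with a representative of entry below n form an
  increasing open cover of the compact coset space, so one n suffices.\<close>

lemma cocompact_cover:
  fixes \<Gamma> :: "(real^('m::finite) option option^'m option option) set"
  assumes "uniform_lattice_in cycle_group (\<Gamma> \<inter> carrier cycle_group)"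
  obtains R where "\<And>x. x \<in> hyp \<Longrightarrow> \<exists>A\<in>cycle_lattice \<Gamma>. act A x $ None < R"
proof -
  let ?G = "cycle_group :: (real^'m option option^'m option option) monoid"
  define H where "H = \<Gamma> \<inter> carrier ?G"
  interpret G: group ?G by (rule group_cycle)
  have sub: "subgroup H ?G" and comp: "compact_space (coset_topology ?G H)"
    using assms by (auto simp: uniform_lattice_in_def lattice_in_def H_def)
  interpret H: subgroup H ?G by (rule sub)
  have mult: "a \<otimes>\<^bsub>?G\<^esub> b = a ** b" for a b by (simp add: cycle_group_def lorentz_group_def)
  note open_iff = openin_coset_topology[OF G.is_group sub]
  define U where "U n = {C \<in> rcosets\<^bsub>?G\<^esub> H. \<exists>g\<in>C. \<bar>g $ None $ None\<bar> < real n}" for n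
  \<comment> \<open>Any element of a coset represents it, so membership is a union over
    \<open>h\<close> of conditions that are open in \<open>g\<close>.\<close>
  have UU: "\<Union>(U n) = (\<Union>h\<in>H. carrier ?G \<inter> {g. \<bar>(h ** g) $ None $ None\<bar> < real n})" for n
  proof (intro subset_antisym subsetI)
    fix g assume "g \<in> \<Union>(U n)"
    then obtain C g' where C: "C \<in> rcosets\<^bsub>?G\<^esub> H" "g \<in> C" "g' \<in> C" "\<bar>g' $ None $ None\<bar> < real n"
      by (auto simp: U_def)
    then obtain a where a: "a \<in> carrier ?G" "C = H #>\<^bsub>?G\<^esub> a" by (auto simp: RCOSETS_def)
    have "H #>\<^bsub>?G\<^esub> a = H #>\<^bsub>?G\<^esub> g"
      using C(2) a by (intro G.repr_independence sub) auto
    then obtain h where "h \<in> H" "g' = h ** g"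
      using C(3) a(2) by (auto simp: r_coset_def mult)
    moreover have "g \<in> carrier ?G" using C(1,2) G.rcosets_part_G[OF sub] by blast
    ultimately show "g \<in> (\<Union>h\<in>H. carrier ?G \<inter> {g. \<bar>(h ** g) $ None $ None\<bar> < real n})"
      using C(4) by blast
  next
    fix g assume "g \<in> (\<Union>h\<in>H. carrier ?G \<inter> {g. \<bar>(h ** g) $ None $ None\<bar> < real n})"
    then obtain h where h: "h \<in> H" "g \<in> carrier ?G" "\<bar>(h ** g) $ None $ None\<bar> < real n" by blast
    have "H #>\<^bsub>?G\<^esub> g \<in> U n"
      using h G.rcosetsI[OF H.subset h(2)] by (auto simp: U_def r_coset_def mult)
    then show "g \<in> \<Union>(U n)" using G.rcos_self[OF h(2) sub] by blast
  qed
  have "openin (top_of_set (carrier ?G)) (\<Union>(U n))" for n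
    unfolding UU
  proof (intro openin_Union, safe)
    fix h
    have "continuous_on UNIV (\<lambda>g :: real^'m option option^'m option option. \<bar>(h ** g) $ None $ None\<bar>)"
      unfolding matrix_matrix_mult_def by (simp, intro continuous_intros)
    then have "open {g :: real^'m option option^'m option option. \<bar>(h ** g) $ None $ None\<bar> < real n}"
      by (rule open_Collect_less[OF _ continuous_on_const])
    then show "openin (top_of_set (carrier ?G)) (carrier ?G \<inter> {g. \<bar>(h ** g) $ None $ None\<bar> < real n})"
      by (rule openin_open_Int)
  qed
  then have opn: "openin (coset_topology ?G H) (U n)" for n
    unfolding open_iff by (auto simp: U_def)
  have all: "rcosets\<^bsub>?G\<^esub> H \<subseteq> (\<Union>n. U n)"
  proof
    fix C assume C: "C \<in> rcosets\<^bsub>?G\<^esub> H"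
    then obtain a where "a \<in> carrier ?G" "C = H #>\<^bsub>?G\<^esub> a" by (auto simp: RCOSETS_def)
    then have "a \<in> C" using G.rcos_self sub by blast
    moreover obtain n where "\<bar>a $ None $ None\<bar> < real n" using reals_Archimedean2 by blast
    ultimately show "C \<in> (\<Union>n. U n)" using C by (auto simp: U_def)
  qed
  have top: "topspace (coset_topology ?G H) = rcosets\<^bsub>?G\<^esub> H"
  proof
    show "topspace (coset_topology ?G H) \<subseteq> rcosets\<^bsub>?G\<^esub> H"
      using openin_topspace[of "coset_topology ?G H"] unfolding open_iff by blast
    show "rcosets\<^bsub>?G\<^esub> H \<subseteq> topspace (coset_topology ?G H)"
      using all openin_subset[OF opn] by blast
  qed
  obtain \<F> where F: "finite \<F>" "\<F> \<subseteq> range U" "rcosets\<^bsub>?G\<^esub> H \<subseteq> \<Union>\<F>"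
  proof -
    have "compactin (coset_topology ?G H) (rcosets\<^bsub>?G\<^esub> H)"
      using comp by (simp add: compact_space_def top)
    then have "\<exists>\<F>. finite \<F> \<and> \<F> \<subseteq> range U \<and> rcosets\<^bsub>?G\<^esub> H \<subseteq> \<Union>\<F>"
      unfolding compactin_def using opn all by (auto simp: image_iff)
    then show thesis using that by blast
  qed
  then obtain N where N: "finite N" "\<F> = U ` N" by (metis finite_subset_image subset_UNIV)
  define n where "n = Max (insert 0 N)"
  have n: "i \<le> n" if "i \<in> N" for i using that N(1) by (simp add: n_def)
  have "\<exists>A\<in>cycle_lattice \<Gamma>. act A x $ None < real n" if x: "x \<in> hyp" for x :: "real^'m option"
  proof -
    obtain A where A: "A \<in> carrier lorentz_group" "act A (hpt 0) = x"
      using act_transitive[OF hpt_in_hyp[of 0] x] by blast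
    have g: "block A 1 \<in> carrier ?G" using A(1) by (auto simp: cycle_group_def)
    have "H #>\<^bsub>?G\<^esub> block A 1 \<in> rcosets\<^bsub>?G\<^esub> H" by (rule G.rcosetsI[OF H.subset g])
    then obtain i where i: "i \<in> N" "H #>\<^bsub>?G\<^esub> block A 1 \<in> U i" using F(3) N(2) by blast
    then obtain h where h: "h \<in> H" "\<bar>(h ** block A 1) $ None $ None\<bar> < real i"
      by (auto simp: U_def r_coset_def mult)
    then have "h \<in> \<Gamma>" "h \<in> carrier ?G" by (auto simp: H_def)
    then obtain B t where B: "h = block B t" "B \<in> carrier lorentz_group" "t \<in> {1, -1}"
      by (auto simp: cycle_group_def)
    have "B \<in> cycle_lattice \<Gamma>" using B \<open>h \<in> \<Gamma>\<close> by (auto simp: cycle_lattice_def)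
    moreover have "act B x $ None = \<bar>((B ** A) *v hpt 0) $ None\<bar>"
      using act_mult[OF B(2) A(1) hpt_in_hyp[of 0]] A(2) by (simp flip: act_time)
    \<comment> \<open>\<open>x\<close> is the image of \<open>hpt 0\<close> under \<open>A\<close>,
      so the bounded entry of \<open>h ** block A 1\<close> is, up to sign, the time of
      \<open>act B x\<close>.\<close>
    moreover have "((B ** A) *v hpt 0) $ None = (h ** block A 1) $ None $ None"
      using block_nth(3)[of "B ** A" t None None]
      by (simp add: B(1) block_mult hpt_0 matrix_vector_axis)
    moreover have "real i \<le> real n" using n[OF i(1)] by simp
    ultimately show ?thesis using h(2) by (intro bexI[of _ B]) auto
  qed
  then show thesis by (rule that)
qed

text \<open>Identifies the hypersurface in the chart: restricting the lift of \<phi> to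
  \<open>cons x 0\<close> gives its values along \<open>Y\<close>.\<close>

lemma incl_hpt: "incl (hpt x) = hpt (cons x 0)"
proof -
  have "incl (hpt x) $ i = hpt (cons x 0) $ i" for i
  proof (cases i)
    case None
    then show ?thesis by (simp add: incl_def inner_vec_def UNIV_option_sum)
  next
    case (Some a)
    then show ?thesis by (cases a) (simp_all add: incl_def)
  qed
  then show ?thesis by (simp add: vec_eq_iff)
qed

theorem theorem1:
  fixes \<Gamma> :: "(real^('m::finite) option option^'m option option) set"
    and \<psi> :: "(real^'m option) set \<Rightarrow> complex"
    and \<mu> :: real
  assumes "lattice_in lorentz_group \<Gamma>"
    and "torsion_free_in lorentz_group \<Gamma>"
    and "uniform_lattice_in cycle_group (\<Gamma> \<inter> carrier cycle_group)"
    and "embedding_map (orbit_topology (cycle_lattice \<Gamma>)) (orbit_topology \<Gamma>) (cycle_map \<Gamma>)"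
    and "normalized_Maass_form (cycle_lattice \<Gamma>) \<mu> \<psi>"
  shows "\<exists>C>0. \<exists>\<Lambda>>0. \<forall>(\<phi> :: (real^'m option option) set \<Rightarrow> complex) lam.
           normalized_Maass_form \<Gamma> lam \<phi> \<longrightarrow> \<Lambda> \<le> lam \<longrightarrow> cmod (period \<Gamma> \<phi> \<psi>) \<le> C"
proof -
  interpret X: free_proper \<Gamma> by (rule free_proper_lattice[OF assms(1,2)])
  interpret Y: free_proper "cycle_lattice \<Gamma>" by (rule free_proper_cycle[OF X.free_proper_axioms])
  obtain R where R: "\<And>x. x \<in> hyp \<Longrightarrow> \<exists>A\<in>cycle_lattice \<Gamma>. act A x $ None < R"
    using cocompact_cover[OF assms(3)] by blast
  define \<psi>' where "\<psi>' = lift (cycle_lattice \<Gamma>) \<psi>"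
  define a where "a x = complex_of_real (Y.punit R (hpt x)) * \<psi>' x" for x
  \<comment> \<open>The normal factor is 1 at \<open>v $ None = 0\<close>, so \<open>b\<close>
    restricts to \<open>a\<close> on the hypersurface, and it vanishes for normal coordinate of
    modulus at least 1.\<close>
  define b where "b v = a (chart v) * complex_of_real ((max 0 (1 - (v $ None)\<^sup>2)) ^ 3)" for v :: "real^'m option"
  \<comment> \<open>\<open>R\<close> bounds the tangential extent of the support of \<open>b\<close>
    and 1 the normal extent.\<close>
  define r where "r = \<bar>R\<bar> + 1"
  have \<psi>': "Ck 2 \<psi>'" using assms(5) by (simp add: normalized_Maass_form_def Maass_form_def smooth_def \<psi>'_def)
  have a: "Ck 2 a" unfolding a_def[abs_def] by (intro Ck_mult \<psi>' Y.Ck_punit R)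
  have "Ck 2 (\<lambda>v :: real^'m option. complex_of_real (1 - (v $ None)\<^sup>2))"
    unfolding power2_eq_square of_real_diff of_real_mult by (intro Ck_minus Ck_mult Ck_const Ck_coord)
  then have b: "Ck 2 b" unfolding b_def[abs_def] by (intro Ck_mult Ck_compose_tang[OF a] Ck_max_cube)
  have b0: "b v = 0" if "r < norm v" for v
  proof (cases "1 \<le> \<bar>v $ None\<bar>")
    case True
    then have "1 \<le> (v $ None)\<^sup>2" by (simp add: abs_le_square_iff[of 1, simplified])
    then show ?thesis by (simp add: b_def)
  next
    case False
    have "v = cons (chart v) (v $ None)" by (auto simp: vec_eq_iff cons_def split: option.split)
    then have "norm v \<le> norm (chart v) + \<bar>v $ None\<bar>" using norm_cons_bounds(3) by metis
    then have "R \<le> norm (chart v)" using that False by (simp add: r_def)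
    also have "\<dots> \<le> hpt (chart v) $ None" by (simp add: norm_eq_sqrt_inner)
    finally have "Y.punit R (hpt (chart v)) = 0" by (simp only: Y.punit_def Y.cutoff_zero div_0)
    then show ?thesis by (simp add: b_def a_def)
  qed
  obtain M where M: "0 \<le> M"
    "\<And>f k. Ck 2 f \<Longrightarrow> 1 \<le> k \<Longrightarrow> (\<And>v. laplacian f v = complex_of_real (k\<^sup>2) * f v) \<Longrightarrow>
      cmod (\<integral>x. complex_of_real (hdensity x) * (f (cons x 0) * b (cons x 0)) \<partial>lborel)
      \<le> M * (\<integral>v. indicator (cball 0 r) v * cmod (f v) \<partial>lborel)"
    using boundary_integral_bound[OF b b0] by blast
  define D where "D = measure lborel (cball (0 :: real^'m option) r)
    + sqrt (1 + r\<^sup>2) * real (card (X.near (sqrt (1 + r\<^sup>2))))"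
  have D: "0 \<le> D" by (simp add: D_def)
  \<comment> \<open>\<open>M\<close> and \<open>D\<close> were fixed before \<phi>; the summand 1
    makes the constant strictly positive.\<close>
  have "cmod (period \<Gamma> \<phi> \<psi>) \<le> M * D + 1"
    if \<phi>: "normalized_Maass_form \<Gamma> lam \<phi>" and lam: "1 \<le> lam"
    for \<phi> :: "(real^'m option option) set \<Rightarrow> complex" and lam
  proof -
    define f where "f = lift \<Gamma> \<phi>"
    have f: "Ck 2 f" and eig: "\<And>v. laplacian f v = lam *\<^sub>R f v"
      and int: "integrable (orbit_measure \<Gamma>) (\<lambda>c. (cmod (\<phi> c))\<^sup>2)"
      and one: "(\<integral>c. (cmod (\<phi> c))\<^sup>2 \<partial>orbit_measure \<Gamma>) = 1"
      using \<phi> by (auto simp: normalized_Maass_form_def Maass_form_def smooth_def f_def)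
    have cyc: "\<phi> (cycle_map \<Gamma> (orbit (cycle_lattice \<Gamma>) (hpt x))) = f (cons x 0)" for x
      by (simp add: cycle_map_orbit[OF X.sub] incl_hpt f_def lift_def)
    have ps: "\<psi> (orbit (cycle_lattice \<Gamma>) (hpt x)) = \<psi>' x" for x
      by (simp add: \<psi>'_def lift_def)
    have cf: "continuous_on UNIV f" and cp: "continuous_on UNIV \<psi>'"
      using Ck_cont f \<psi>' by blast+
    have "continuous_on UNIV (\<lambda>x :: real^'m. (case i of None \<Rightarrow> 0 | Some j \<Rightarrow> x $ j) :: real)" for i
      by (cases i) (auto intro!: continuous_intros)
    then have "continuous_on UNIV (\<lambda>x :: real^'m. cons x 0)"
      unfolding cons_def by (intro continuous_intros)
    then have "continuous_on UNIV (\<lambda>x :: real^'m. f (cons x 0) * \<psi>' x)"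
      by (intro continuous_intros cp continuous_on_compose2[OF cf]) auto
    then have "period \<Gamma> \<phi> \<psi> = (\<integral>x. complex_of_real (hdensity x) *
        (complex_of_real (Y.punit R (hpt x)) * (f (cons x 0) * \<psi>' x)) \<partial>lborel)"
      unfolding period_def using Y.integral_orbit_measure[OF R, of "\<lambda>y. \<phi> (cycle_map \<Gamma> y) * \<psi> y"]
      by (simp add: cyc ps)
    also have "\<dots> = (\<integral>x. complex_of_real (hdensity x) * (f (cons x 0) * b (cons x 0)) \<partial>lborel)"
    proof -
      have "chart (cons x 0) = x" for x :: "real^'m" by (simp add: vec_eq_iff)
      then show ?thesis by (simp add: b_def a_def mult_ac)
    qed
    also have "cmod \<dots> \<le> M * (\<integral>v. indicator (cball 0 r) v * cmod (f v) \<partial>lborel)"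
      using lam by (intro M(2)[where k = "sqrt lam"] f) (simp_all add: eig scaleR_conv_of_real)
    also have "\<dots> \<le> M * D"
      unfolding D_def f_def
      by (intro mult_left_mono M(1) X.integral_ball_le int one cf[unfolded f_def])
    finally show ?thesis by simp
  qed
  moreover have "0 < M * D + 1" using M(1) D by (simp add: add_nonneg_pos)
  ultimately show ?thesis by (intro exI[of _ "M * D + 1"] conjI exI[of _ 1]) auto
qed

end
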